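(* Let $\mathcal{A}$ be a finite measurable acyclic topological category. Then the Euler characteristic $\chi(\mathcal{A})$ coincides with the topological Euler characteristic $\chi(B\mathcal{A})$ of the classifying space $B\mathcal{A}$ of $\mathcal{A}$.
   Context: $\mathbf{Top}$ is the category of compactly generated weak Hausdorff spaces. A topological category is a category enriched in $(\mathbf{Top},\times,* )$; it is finite if its set of objects $\mathcal{A}_0$ is finite, and measurable if each hom-space $\mathcal{A}(a,b)$ has the homotopy type of a finite CW complex. It is acyclic if $\mathcal{A}(x,x)$ is a single point for every object $x$, and for objects $y\neq z$, $\mathcal{A}(y,z)\neq\emptyset$ implies $\mathcal{A}(z,y)=\emptyset$. For a finite measurable topological category put $\xi(a,b)=\chi(\mathcal{A}(a,b))\in\mathbb{Z}\subset\mathbb{Q}$ (topological Euler characteristic). A weighting is $w:\mathcal{A}_0\to\mathbb{Q}$ with $\sum_b\xi(a,b)w(b)=1$ for all $a$; a coweighting is $v:\mathcal{A}_0\to\mathbb{Q}$ with $\sum_a v(a)\xi(a,b)=1$ for all $b$. If both exist, $\chi(\mathcal{A})=\sum_a w(a)=\sum_a v(a)$, which is independent of the choices. The nerve $N\mathcal{A}$ is the simplicial space with $N_n\mathcal{A}=\coprod_{x_0,\dots,x_n\in\mathcal{A}_0}\mathcal{A}(x_n,x_{n-1})\times\cdots\times\mathcal{A}(x_1,x_0)$, with face maps given by composing or removing morphisms and degeneracies by inserting identities. The classifying space $B\mathcal{A}$ is its geometric realization $|N\mathcal{A}|=\left(\coprod_{n\ge0}\Delta^n\times N_n\mathcal{A}\right)/\big((t,\varphi_*(x))\sim(\varphi^*(t),x)\big)$,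 over all order preserving maps $\varphi$. *)

theory Defs
  imports "HOL-Homology.Homology"
begin

section \<open>Compactly generated weak Hausdorff spaces\<close>

text \<open>
  The usual definitions quantify over all compact Hausdorff spaces \<open>K\<close> and all continuous maps
  \<open>K \<rightarrow> X\<close>, with no bound on the size of \<open>K\<close>. Here \<open>K\<close> ranges over the compact Hausdorff spaces
  carried by the type \<^typ>\<open>'a \<Rightarrow> real\<close>, where \<^typ>\<open>'a\<close> is the type of points of \<open>X\<close>. For a space
  \<open>X\<close> whose points are closed (this covers every weak Hausdorff space, and products of such
  spaces) nothing is lost. Given a continuous \<open>u\<close> from an arbitrary compact Hausdorff \<open>K\<close>, choose
  for each pair of distinct points \<open>a\<close>, \<open>b\<close> of \<open>X\<close> a Urysohn function on \<open>K\<close> separating the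
  closed sets \<open>u\<^sup>-\<^sup>1(a)\<close> and \<open>u\<^sup>-\<^sup>1(b)\<close>. Together these functions map \<open>K\<close> onto a compact Hausdorff
  quotient \<open>L\<close> inside a power of the unit interval indexed by pairs of points of \<open>X\<close>, and
  \<open>u\<close> factors through \<open>L\<close>. The points of \<open>L\<close> inject into \<^typ>\<open>'a \<Rightarrow> real\<close>, and testing a subset
  of \<open>X\<close> along \<open>u\<close> is the same as testing it along the induced map \<open>L \<rightarrow> X\<close>.
\<close>

definition weak_Hausdorff_space :: "'a topology \<Rightarrow> bool" where
  "weak_Hausdorff_space X \<longleftrightarrow>
    (\<forall>(K :: ('a \<Rightarrow> real) topology) u.
       compact_space K \<and> Hausdorff_space K \<and> continuous_map K X u
         \<longrightarrow> closedin X (u ` topspace K))"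

definition k_open :: "'a topology \<Rightarrow> 'a set \<Rightarrow> bool" where
  "k_open X U \<longleftrightarrow> U \<subseteq> topspace X \<and>
    (\<forall>(K :: ('a \<Rightarrow> real) topology) u.
       compact_space K \<and> Hausdorff_space K \<and> continuous_map K X u
         \<longrightarrow> openin K {z \<in> topspace K. u z \<in> U})"

definition compactly_generated :: "'a topology \<Rightarrow> bool" where
  "compactly_generated X \<longleftrightarrow> (\<forall>U. k_open X U \<longrightarrow> openin X U)"

definition CGWH_space :: "'a topology \<Rightarrow> bool" where
  "CGWH_space X \<longleftrightarrow> compactly_generated X \<and> weak_Hausdorff_space X"

definition kify :: "'a topology \<Rightarrow> 'a topology" where
  "kify X = topology (k_open X)"

lemma istopology_k_open: "istopology (k_open X)"
  unfolding istopology_def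
proof (intro conjI allI impI)
  fix S T assume S: "k_open X S" and T: "k_open X T"
  have "openin K {z \<in> topspace K. u z \<in> S \<inter> T}"
    if "compact_space K \<and> Hausdorff_space K \<and> continuous_map K X u"
    for K :: "('a \<Rightarrow> real) topology" and u
  proof -
    have "{z \<in> topspace K. u z \<in> S \<inter> T}
            = {z \<in> topspace K. u z \<in> S} \<inter> {z \<in> topspace K. u z \<in> T}" by auto
    moreover have "openin K {z \<in> topspace K. u z \<in> S}" using S that unfolding k_open_def by blast
    moreover have "openin K {z \<in> topspace K. u z \<in> T}" using T that unfolding k_open_def by blast
    ultimately show ?thesis by (simp add: openin_Int)
  qed
  moreover have "S \<inter> T \<subseteq> topspace X" using S unfolding k_open_def by blast
  ultimately show "k_open X (S \<inter> T)" unfolding k_open_def by blast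
next
  fix \<U> assume \<U>: "\<forall>U\<in>\<U>. k_open X U"
  have "openin K {z \<in> topspace K. u z \<in> \<Union>\<U>}"
    if "compact_space K \<and> Hausdorff_space K \<and> continuous_map K X u"
    for K :: "('a \<Rightarrow> real) topology" and u
  proof -
    have "{z \<in> topspace K. u z \<in> \<Union>\<U>} = (\<Union>U\<in>\<U>. {z \<in> topspace K. u z \<in> U})" by auto
    moreover have "openin K {z \<in> topspace K. u z \<in> U}" if "U \<in> \<U>" for U
      using \<U> that \<open>compact_space K \<and> _\<close> unfolding k_open_def by blast
    ultimately show ?thesis by (auto intro: openin_Union)
  qed
  moreover have "\<Union>\<U> \<subseteq> topspace X" using \<U> unfolding k_open_def by blast
  ultimately show "k_open X (\<Union>\<U>)" unfolding k_open_def by blast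
qed

lemma openin_kify: "openin (kify X) U \<longleftrightarrow> k_open X U"
  by (simp add: kify_def istopology_k_open topology_inverse')

lemma k_open_if_openin: "openin X U \<Longrightarrow> k_open X U"
  unfolding k_open_def using openin_subset openin_continuous_map_preimage[of _ X _ U] by blast

lemma topspace_kify [simp]: "topspace (kify X) = topspace X"
proof
  show "topspace (kify X) \<subseteq> topspace X"
    using openin_kify[of X "topspace (kify X)"] unfolding k_open_def by simp
  show "topspace X \<subseteq> topspace (kify X)"
    using openin_kify[of X "topspace X"] k_open_if_openin[of X "topspace X"]
    by (simp add: openin_subset)
qed

lemma kify_eq_if_compactly_generated: "compactly_generated X \<Longrightarrow> kify X = X"
  by (auto simp: topology_eq openin_kify compactly_generated_def intro: k_open_if_openin)

text \<open>Categorical products in the category of CGWH spaces.\<close>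

definition kprod :: "'a topology \<Rightarrow> 'b topology \<Rightarrow> ('a \<times> 'b) topology" where
  "kprod X Y = kify (prod_topology X Y)"

definition kproduct :: "('i \<Rightarrow> 'a topology) \<Rightarrow> 'i set \<Rightarrow> ('i \<Rightarrow> 'a) topology" where
  "kproduct X I = kify (product_topology X I)"


section \<open>Finite CW complexes\<close>

definition disc_space :: "nat \<Rightarrow> (nat \<Rightarrow> real) topology" where
  "disc_space n = subtopology (Euclidean_space n) {x. (\<Sum>i<n. x i ^ 2) \<le> 1}"

definition open_disc :: "nat \<Rightarrow> (nat \<Rightarrow> real) set" where
  "open_disc n = {x \<in> topspace (disc_space n). (\<Sum>i<n. x i ^ 2) < 1}"

definition disc_boundary :: "nat \<Rightarrow> (nat \<Rightarrow> real) set" where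
  "disc_boundary n = {x \<in> topspace (disc_space n). (\<Sum>i<n. x i ^ 2) = 1}"

text \<open>
  A Hausdorff space with finitely many cells, given by characteristic maps \<open>\<Phi> i\<close> for \<open>i < k\<close>.
  Closure finiteness, the weak topology and the fact that \<open>\<Phi> i\<close> restricts to a homeomorphism
  from the open disc onto the open cell are automatic, since there are finitely many cells, discs
  are compact and the space is Hausdorff. The empty space is allowed (\<open>k = 0\<close>).
\<close>

definition finite_CW_complex :: "'a topology \<Rightarrow> bool" where
  "finite_CW_complex X \<longleftrightarrow> Hausdorff_space X \<and>
    (\<exists>(k :: nat) (d :: nat \<Rightarrow> nat) (\<Phi> :: nat \<Rightarrow> (nat \<Rightarrow> real) \<Rightarrow> 'a).
       (\<forall>i<k. continuous_map (disc_space (d i)) X (\<Phi> i) \<and> inj_on (\<Phi> i) (open_disc (d i))) \<and>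
       disjoint_family_on (\<lambda>i. \<Phi> i ` open_disc (d i)) {..<k} \<and>
       (\<Union>i<k. \<Phi> i ` open_disc (d i)) = topspace X \<and>
       (\<forall>i<k. \<Phi> i ` disc_boundary (d i)
                \<subseteq> (\<Union>j\<in>{j. j < k \<and> d j < d i}. \<Phi> j ` open_disc (d j))))"

text \<open>
  Every finite CW complex embeds into some Euclidean space, so the type of \<open>Y\<close> below is no
  restriction.
\<close>

definition finite_CW_homotopy_type :: "'a topology \<Rightarrow> bool" where
  "finite_CW_homotopy_type X \<longleftrightarrow>
    (\<exists>Y :: (nat \<Rightarrow> real) topology. finite_CW_complex Y \<and> X homotopy_equivalent_space Y)"


section \<open>The topological Euler characteristic\<close>

definition int_independent :: "('g, 'b) monoid_scheme \<Rightarrow> 'g set \<Rightarrow> bool" where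
  "int_independent G S \<longleftrightarrow> finite S \<and> S \<subseteq> carrier G \<and>
    (\<forall>c :: 'g \<Rightarrow> int.
       finprod G (\<lambda>s. s [^]\<^bsub>G\<^esub> c s) S = \<one>\<^bsub>G\<^esub> \<longrightarrow> (\<forall>s\<in>S. c s = 0))"

definition finite_rank :: "('g, 'b) monoid_scheme \<Rightarrow> bool" where
  "finite_rank G \<longleftrightarrow> bdd_above (card ` {S. int_independent G S})"

text \<open>The rank of an abelian group, meaningful under \<^const>\<open>finite_rank\<close>.\<close>

definition group_rank :: "('g, 'b) monoid_scheme \<Rightarrow> nat" where
  "group_rank G = Sup (card ` {S. int_independent G S})"

definition betti :: "nat \<Rightarrow> 'a topology \<Rightarrow> nat" where
  "betti p X = group_rank (homology_group (int p) X)"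

definition has_euler_char :: "'a topology \<Rightarrow> bool" where
  "has_euler_char X \<longleftrightarrow>
    (\<forall>p. finite_rank (homology_group (int p) X)) \<and> finite {p. betti p X \<noteq> 0}"

definition euler_char :: "'a topology \<Rightarrow> int" where
  "euler_char X = (\<Sum>p | betti p X \<noteq> 0. (-1) ^ p * int (betti p X))"


section \<open>Topological categories\<close>

text \<open>
  \<open>Cmp A a b c g f\<close> is the composite of \<open>g : b \<rightarrow> c\<close> after \<open>f : a \<rightarrow> b\<close>. Hom-spaces for different
  pairs of objects need not be disjoint, so composition carries its objects.
\<close>

record ('o, 'm) topcat =
  Obj :: "'o set"
  Hom :: "'o \<Rightarrow> 'o \<Rightarrow> 'm topology"
  Cmp :: "'o \<Rightarrow> 'o \<Rightarrow> 'o \<Rightarrow> 'm \<Rightarrow> 'm \<Rightarrow> 'm"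
  Idn :: "'o \<Rightarrow> 'm"

locale topological_category =
  fixes A :: "('o, 'm) topcat"
  assumes CGWH_Hom: "\<lbrakk>a \<in> Obj A; b \<in> Obj A\<rbrakk> \<Longrightarrow> CGWH_space (Hom A a b)"
    and continuous_Cmp: "\<lbrakk>a \<in> Obj A; b \<in> Obj A; c \<in> Obj A\<rbrakk> \<Longrightarrow>
      continuous_map (kprod (Hom A b c) (Hom A a b)) (Hom A a c) (\<lambda>(g, f). Cmp A a b c g f)"
    and Idn_in_Hom: "a \<in> Obj A \<Longrightarrow> Idn A a \<in> topspace (Hom A a a)"
    and Cmp_Idn_left: "\<lbrakk>a \<in> Obj A; b \<in> Obj A; f \<in> topspace (Hom A a b)\<rbrakk> \<Longrightarrow>
      Cmp A a b b (Idn A b) f = f"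
    and Cmp_Idn_right: "\<lbrakk>a \<in> Obj A; b \<in> Obj A; f \<in> topspace (Hom A a b)\<rbrakk> \<Longrightarrow>
      Cmp A a a b f (Idn A a) = f"
    and Cmp_assoc: "\<lbrakk>a \<in> Obj A; b \<in> Obj A; c \<in> Obj A; d \<in> Obj A;
      f \<in> topspace (Hom A a b); g \<in> topspace (Hom A b c); h \<in> topspace (Hom A c d)\<rbrakk> \<Longrightarrow>
      Cmp A a b d (Cmp A b c d h g) f = Cmp A a c d h (Cmp A a b c g f)"

definition finite_topcat :: "('o, 'm) topcat \<Rightarrow> bool" where
  "finite_topcat A \<longleftrightarrow> finite (Obj A)"

definition measurable_topcat :: "('o, 'm) topcat \<Rightarrow> bool" where
  "measurable_topcat A \<longleftrightarrow> (\<forall>a\<in>Obj A. \<forall>b\<in>Obj A. finite_CW_homotopy_type (Hom A a b))"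

definition acyclic_topcat :: "('o, 'm) topcat \<Rightarrow> bool" where
  "acyclic_topcat A \<longleftrightarrow>
    (\<forall>x\<in>Obj A. \<exists>p. topspace (Hom A x x) = {p}) \<and>
    (\<forall>y\<in>Obj A. \<forall>z\<in>Obj A. y \<noteq> z \<and> topspace (Hom A y z) \<noteq> {} \<longrightarrow> topspace (Hom A z y) = {})"


section \<open>The Euler characteristic of a topological category\<close>

definition zeta :: "('o, 'm) topcat \<Rightarrow> 'o \<Rightarrow> 'o \<Rightarrow> rat" where
  "zeta A a b = of_int (euler_char (Hom A a b))"

definition weighting :: "('o, 'm) topcat \<Rightarrow> ('o \<Rightarrow> rat) \<Rightarrow> bool" where
  "weighting A w \<longleftrightarrow> (\<forall>a\<in>Obj A. (\<Sum>b\<in>Obj A. zeta A a b * w b) = 1)"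

definition coweighting :: "('o, 'm) topcat \<Rightarrow> ('o \<Rightarrow> rat) \<Rightarrow> bool" where
  "coweighting A v \<longleftrightarrow> (\<forall>b\<in>Obj A. (\<Sum>a\<in>Obj A. v a * zeta A a b) = 1)"

definition has_cat_euler_char :: "('o, 'm) topcat \<Rightarrow> bool" where
  "has_cat_euler_char A \<longleftrightarrow> (\<exists>w. weighting A w) \<and> (\<exists>v. coweighting A v)"

definition cat_euler_char :: "('o, 'm) topcat \<Rightarrow> rat" where
  "cat_euler_char A = (\<Sum>a\<in>Obj A. (SOME w. weighting A w) a)"

lemma weighting_sum_eq_coweighting_sum:
  assumes w: "weighting A w" and v: "coweighting A v"
  shows "(\<Sum>a\<in>Obj A. w a) = (\<Sum>a\<in>Obj A. v a)"
proof -
  have "(\<Sum>a\<in>Obj A. v a) = (\<Sum>a\<in>Obj A. v a * (\<Sum>b\<in>Obj A. zeta A a b * w b))"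
    using w by (intro sum.cong) (auto simp: weighting_def)
  also have "\<dots> = (\<Sum>a\<in>Obj A. \<Sum>b\<in>Obj A. v a * zeta A a b * w b)"
    by (simp add: sum_distrib_left mult.assoc)
  also have "\<dots> = (\<Sum>b\<in>Obj A. \<Sum>a\<in>Obj A. v a * zeta A a b * w b)"
    by (rule sum.swap)
  also have "\<dots> = (\<Sum>b\<in>Obj A. (\<Sum>a\<in>Obj A. v a * zeta A a b) * w b)"
    by (simp add: sum_distrib_right)
  also have "\<dots> = (\<Sum>b\<in>Obj A. w b)"
    using v by (intro sum.cong) (auto simp: coweighting_def)
  finally show ?thesis ..
qed

lemma cat_euler_char_eq_coweighting:
  assumes "has_cat_euler_char A" and "coweighting A v"
  shows "cat_euler_char A = (\<Sum>a\<in>Obj A. v a)"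
proof -
  have "weighting A (SOME w. weighting A w)"
    using assms(1) unfolding has_cat_euler_char_def by (metis someI_ex)
  from weighting_sum_eq_coweighting_sum[OF this assms(2)] show ?thesis
    unfolding cat_euler_char_def .
qed

lemma cat_euler_char_eq_weighting:
  assumes "has_cat_euler_char A" and "weighting A w"
  shows "cat_euler_char A = (\<Sum>a\<in>Obj A. w a)"
proof -
  obtain v where v: "coweighting A v"
    using assms(1) unfolding has_cat_euler_char_def by blast
  show ?thesis
    using cat_euler_char_eq_coweighting[OF assms(1) v] weighting_sum_eq_coweighting_sum[OF assms(2) v]
    by simp
qed


section \<open>Geometric realization\<close>

definition quotient_topology :: "'a topology \<Rightarrow> ('a \<times> 'a) set \<Rightarrow> 'a set topology" where
  "quotient_topology X r = topology (\<lambda>U. U \<subseteq> topspace X // r \<and>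
     openin X {x \<in> topspace X. r `` {x} \<in> U})"

lemma openin_quotient_topology:
  "openin (quotient_topology X r) U \<longleftrightarrow>
     U \<subseteq> topspace X // r \<and> openin X {x \<in> topspace X. r `` {x} \<in> U}"
proof -
  have 1: "{x \<in> topspace X. r `` {x} \<in> S \<inter> T}
             = {x \<in> topspace X. r `` {x} \<in> S} \<inter> {x \<in> topspace X. r `` {x} \<in> T}" for S T
    by auto
  have 2: "{x \<in> topspace X. r `` {x} \<in> \<Union>\<U>} = (\<Union>U\<in>\<U>. {x \<in> topspace X. r `` {x} \<in> U})" for \<U>
    by auto
  have "istopology (\<lambda>U. U \<subseteq> topspace X // r \<and> openin X {x \<in> topspace X. r `` {x} \<in> U})"
    unfolding istopology_def
  proof (intro conjI allI impI)
    fix S T :: "'a set set"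
    assume "S \<subseteq> topspace X // r \<and> openin X {x \<in> topspace X. r `` {x} \<in> S}"
      and "T \<subseteq> topspace X // r \<and> openin X {x \<in> topspace X. r `` {x} \<in> T}"
    then show "S \<inter> T \<subseteq> topspace X // r" "openin X {x \<in> topspace X. r `` {x} \<in> S \<inter> T}"
      unfolding 1 by (auto intro: openin_Int)
  next
    fix \<U> :: "'a set set set"
    assume "\<forall>U\<in>\<U>. U \<subseteq> topspace X // r \<and> openin X {x \<in> topspace X. r `` {x} \<in> U}"
    then show "\<Union>\<U> \<subseteq> topspace X // r" "openin X {x \<in> topspace X. r `` {x} \<in> \<Union>\<U>}"
      unfolding 2 by (blast, intro openin_Union) auto
  qed
  then show ?thesis
    by (simp add: quotient_topology_def topology_inverse')
qed

lemma quotient_map_quotient_topology: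
  "quotient_map X (quotient_topology X r) (\<lambda>x. r `` {x})"
proof -
  let ?Q = "quotient_topology X r"
  have "{x \<in> topspace X. r `` {x} \<in> topspace X // r} = topspace X"
    by (auto simp: quotient_def)
  then have "openin ?Q (topspace X // r)"
    by (simp add: openin_quotient_topology)
  then have "topspace X // r \<subseteq> topspace ?Q"
    by (rule openin_subset)
  moreover have "topspace ?Q \<subseteq> topspace X // r"
    using openin_quotient_topology[of X r "topspace ?Q"] openin_topspace[of ?Q] by blast
  ultimately have top: "topspace ?Q = topspace X // r"
    by (rule subset_antisym[rotated])
  have "(\<lambda>x. r `` {x}) ` topspace X = topspace X // r"
    unfolding quotient_def by blast
  then show ?thesis
    unfolding quotient_map_def top by (simp add: openin_quotient_topology)
qed

text \<open>The least equivalence relation on \<open>T\<close> containing \<open>r\<close>, for \<open>r \<subseteq> T \<times> T\<close>.\<close>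

definition generated_equiv :: "'a set \<Rightarrow> ('a \<times> 'a) set \<Rightarrow> ('a \<times> 'a) set" where
  "generated_equiv T r = Restr ((r \<union> r\<inverse>)\<^sup>*) T"

text \<open>Order preserving maps from \<open>{0, \<dots>, m}\<close> to \<open>{0, \<dots>, n}\<close>.\<close>

definition order_maps :: "nat \<Rightarrow> nat \<Rightarrow> (nat \<Rightarrow> nat) set" where
  "order_maps m n = {\<phi> \<in> {..m} \<rightarrow> {..n}. mono_on {..m} \<phi>}"

definition simplex_space :: "nat \<Rightarrow> (nat \<Rightarrow> real) topology" where
  "simplex_space n = subtopology (powertop_real UNIV) (standard_simplex n)"

definition simplex_act :: "nat \<Rightarrow> (nat \<Rightarrow> nat) \<Rightarrow> (nat \<Rightarrow> real) \<Rightarrow> (nat \<Rightarrow> real)" where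
  "simplex_act m \<phi> t = (\<lambda>i. \<Sum>j | j \<le> m \<and> \<phi> j = i. t j)"

text \<open>
  For a simplicial space with spaces \<open>X n\<close>, where \<open>act m \<phi> : X n \<rightarrow> X m\<close> is the operator of the
  order preserving map \<open>\<phi> : {0, \<dots>, m} \<rightarrow> {0, \<dots>, n}\<close>.
\<close>

definition realization_cells :: "(nat \<Rightarrow> 'a topology) \<Rightarrow> (nat \<times> (nat \<Rightarrow> real) \<times> 'a) topology" where
  "realization_cells X = sum_topology (\<lambda>n. kprod (simplex_space n) (X n)) UNIV"

definition realization_glue ::
  "(nat \<Rightarrow> 'a topology) \<Rightarrow> (nat \<Rightarrow> (nat \<Rightarrow> nat) \<Rightarrow> 'a \<Rightarrow> 'a) \<Rightarrow>
     ((nat \<times> (nat \<Rightarrow> real) \<times> 'a) \<times> (nat \<times> (nat \<Rightarrow> real) \<times> 'a)) set" where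
  "realization_glue X act =
     {((m, t, act m \<phi> x), (n, simplex_act m \<phi> t, x)) | m n \<phi> t x.
        \<phi> \<in> order_maps m n \<and> t \<in> standard_simplex m \<and> x \<in> topspace (X n)}"

definition geometric_realization ::
  "(nat \<Rightarrow> 'a topology) \<Rightarrow> (nat \<Rightarrow> (nat \<Rightarrow> nat) \<Rightarrow> 'a \<Rightarrow> 'a) \<Rightarrow>
     (nat \<times> (nat \<Rightarrow> real) \<times> 'a) set topology" where
  "geometric_realization X act =
     quotient_topology (realization_cells X)
       (generated_equiv (topspace (realization_cells X)) (realization_glue X act))"


section \<open>Nerve and classifying space\<close>

text \<open>
  An \<open>n\<close>-simplex is a pair \<open>(x, f)\<close> of objects \<open>x 0, \<dots>, x n\<close> and morphisms
  \<open>f i : x (i + 1) \<rightarrow> x i\<close> for \<open>i < n\<close>.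
\<close>

definition nerve :: "('o, 'm) topcat \<Rightarrow> nat \<Rightarrow> ((nat \<Rightarrow> 'o) \<times> (nat \<Rightarrow> 'm)) topology" where
  "nerve A n =
     sum_topology (\<lambda>x. kproduct (\<lambda>i. Hom A (x (Suc i)) (x i)) {..<n}) ({..n} \<rightarrow>\<^sub>E Obj A)"

text \<open>The composite \<open>x (i + k) \<rightarrow> x i\<close> of \<open>f (i + k - 1), \<dots>, f i\<close>; an identity for \<open>k = 0\<close>.\<close>

fun composite :: "('o, 'm) topcat \<Rightarrow> (nat \<Rightarrow> 'o) \<Rightarrow> (nat \<Rightarrow> 'm) \<Rightarrow> nat \<Rightarrow> nat \<Rightarrow> 'm" where
  "composite A x f i 0 = Idn A (x i)"
| "composite A x f i (Suc k) =
     Cmp A (x (i + Suc k)) (x (i + k)) (x i) (composite A x f i k) (f (i + k))"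

definition nerve_act ::
  "('o, 'm) topcat \<Rightarrow> nat \<Rightarrow> (nat \<Rightarrow> nat) \<Rightarrow> (nat \<Rightarrow> 'o) \<times> (nat \<Rightarrow> 'm) \<Rightarrow> (nat \<Rightarrow> 'o) \<times> (nat \<Rightarrow> 'm)"
  where
  "nerve_act A m \<phi> = (\<lambda>(x, f).
     (restrict (\<lambda>j. x (\<phi> j)) {..m},
      restrict (\<lambda>j. composite A x f (\<phi> j) (\<phi> (Suc j) - \<phi> j)) {..<m}))"

definition classifying_space ::
  "('o, 'm) topcat \<Rightarrow> (nat \<times> (nat \<Rightarrow> real) \<times> (nat \<Rightarrow> 'o) \<times> (nat \<Rightarrow> 'm)) set topology" where
  "classifying_space A = geometric_realization (nerve A) (nerve_act A)"

end

theory Submission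
  imports Defs "HOL-Analysis.Urysohn"
begin

text \<open>
  Two ideas carry the proof. The first is that a few rules suffice to compute the Euler
  characteristics that occur here: it is a homotopy invariant, it is \<open>0\<close> for the empty space and \<open>1\<close>
  for a point, and \<open>\<chi>(U \<union> V) = \<chi>(U) + \<chi>(V) - \<chi>(U \<inter> V)\<close> for open sets. The last rule is
  \<open>has_chi_Mayer_Vietoris\<close>; it follows from excision and the long exact sequence of a pair, once ranks
  of abelian groups are known to be additive (\<open>rank_nullity\<close>).

  The second idea is an open cover of the classifying space. A point of \<open>BA\<close> is given by a chain of
  composable morphisms \<open>x\<^sub>n \<rightarrow> \<dots> \<rightarrow> x\<^sub>0\<close> and barycentric coordinates on its vertices. Adding up the
  coordinates at all vertices equal to an object \<open>a\<close> gives a continuous function on \<open>BA\<close>, the weight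
  at \<open>a\<close>. The open star of a set \<open>S\<close> of objects consists of the points whose weights at all objects of
  \<open>S\<close> are positive. The stars of single objects cover \<open>BA\<close>, because the weights have sum \<open>1\<close>, and the
  star of \<open>S\<close> is the intersection of the stars of its elements.

  Because the category is acyclic, the elements \<open>s\<^sub>0, \<dots>, s\<^sub>k\<close> of \<open>S\<close> can occur in a chain of morphisms in
  one order only, and the composites between their occurrences are well defined. Letting the weights
  off \<open>S\<close> shrink to \<open>0\<close> and those on \<open>S\<close> become equal deforms the star of \<open>S\<close> to the product of the
  spaces of morphisms \<open>s\<^sub>i\<^sub>+\<^sub>1 \<rightarrow> s\<^sub>i\<close> (\<open>star_homotopy_equivalent\<close>). The same rules show that the
  Euler characteristic is multiplicative for products with finite CW complexes, by induction on the
  cells (\<open>has_chi_prod_CW\<close>). So the star of \<open>S\<close> has Euler characteristic \<open>\<Prod>\<^sub>i \<xi>(s\<^sub>i\<^sub>+\<^sub>1, s\<^sub>i)\<close>, and inclusion and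
  exclusion gives \<open>\<chi>(BA) = \<Sum>\<^sub>S (-1)\<^sup>k \<Prod>\<^sub>i \<xi>(s\<^sub>i\<^sub>+\<^sub>1, s\<^sub>i)\<close>. On the other side, the matrix \<open>\<xi>\<close> is unitriangular
  when the objects are listed in a suitable order. Its weighting is given by a recursion along this
  order, and the same recursion computes \<open>\<chi>(BA)\<close> when the stars are added one at a time
  (\<open>has_chi_classifying_space\<close>).

  All products are taken in compactly generated spaces. This has two consequences. Homology does not see
  the change of topology, since simplices are compact Hausdorff (\<open>has_chi_kify\<close>). Maps and homotopies
  on \<open>BA\<close> are proved continuous by composing with maps from compact Hausdorff spaces to the cells
  (\<open>continuous_map_interval_quotient\<close>).
\<close>

section \<open>Rank of abelian groups\<close>

text \<open>Gaussian elimination over the integers: one equation is used to eliminate one unknown, and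
  the remaining unknowns are scaled to avoid division.\<close>

lemma int_homogeneous_system:
  fixes M :: "'r \<Rightarrow> 'b \<Rightarrow> int"
  assumes "finite B" "finite R" "card B < card R"
  shows "\<exists>x. (\<exists>r\<in>R. x r \<noteq> 0) \<and> (\<forall>b\<in>B. (\<Sum>r\<in>R. x r * M r b) = 0)"
  using assms
proof (induction B arbitrary: R M rule: finite_induct)
  case empty
  then have "R \<noteq> {}" by auto
  then show ?case by (intro exI[of _ "\<lambda>_. 1"]) auto
next
  case (insert b B)
  show ?case
  proof (cases "\<forall>r\<in>R. M r b = 0")
    case True
    have "card B < card R" using insert by simp
    from insert.IH[OF insert.prems(1) this] obtain x
      where x: "\<exists>r\<in>R. x r \<noteq> 0" "\<forall>c\<in>B. (\<Sum>r\<in>R. x r * M r c) = 0" by blast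
    moreover have "(\<Sum>r\<in>R. x r * M r b) = 0" using True by simp
    ultimately show ?thesis by blast
  next
    case False
    then obtain r0 where r0: "r0 \<in> R" "M r0 b \<noteq> 0" by blast
    let ?R = "R - {r0}"
    have "card B < card ?R" "finite ?R" using insert r0 by auto
    from insert.IH[OF this(2,1), of "\<lambda>r c. M r0 b * M r c - M r b * M r0 c"]
    obtain x r1 where r1: "r1 \<in> ?R" "x r1 \<noteq> 0"
      and x: "\<And>c. c \<in> B \<Longrightarrow> (\<Sum>r\<in>?R. x r * (M r0 b * M r c - M r b * M r0 c)) = 0"
      by blast
    define y where "y r = (if r = r0 then - (\<Sum>r\<in>?R. x r * M r b) else M r0 b * x r)" for r
    have split: "(\<Sum>r\<in>R. y r * M r c) =
        (\<Sum>r\<in>?R. x r * (M r0 b * M r c - M r b * M r0 c))" for c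
    proof -
      have "(\<Sum>r\<in>R. y r * M r c) = y r0 * M r0 c + (\<Sum>r\<in>?R. y r * M r c)"
        using insert.prems(1) r0 by (simp add: sum.remove)
      also have "(\<Sum>r\<in>?R. y r * M r c) = (\<Sum>r\<in>?R. M r0 b * x r * M r c)"
        by (intro sum.cong) (auto simp: y_def)
      also have "y r0 * M r0 c = - (\<Sum>r\<in>?R. x r * M r b * M r0 c)"
        by (simp add: y_def sum_distrib_right)
      finally show ?thesis by (simp add: algebra_simps sum_subtractf)
    qed
    have "(\<Sum>r\<in>R. y r * M r b) = 0"
      unfolding split by (intro sum.neutral) (auto simp: algebra_simps)
    moreover have "y r1 \<noteq> 0" using r1 r0 by (auto simp: y_def)
    ultimately show ?thesis using r1 x split by (intro exI[of _ y]) auto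
  qed
qed

text \<open>Combinations of a family rather than of a set, so that images and lifts of a set need not be
  reindexed.\<close>

definition lincomb :: "('g, 'b) monoid_scheme \<Rightarrow> ('i \<Rightarrow> 'g) \<Rightarrow> 'i set \<Rightarrow> ('i \<Rightarrow> int) \<Rightarrow> 'g" where
  "lincomb G a I c = finprod G (\<lambda>i. a i [^]\<^bsub>G\<^esub> c i) I"

lemma int_independent_iff_lincomb:
  "int_independent G S \<longleftrightarrow> finite S \<and> S \<subseteq> carrier G \<and>
    (\<forall>c. lincomb G id S c = \<one>\<^bsub>G\<^esub> \<longrightarrow> (\<forall>s\<in>S. c s = 0))"
  by (simp add: int_independent_def lincomb_def)

context comm_group
begin

lemma lincomb_closed: "a \<in> I \<rightarrow> carrier G \<Longrightarrow> lincomb G a I c \<in> carrier G"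
  unfolding lincomb_def by (rule finprod_closed) auto

lemma lincomb_insert:
  "finite I \<Longrightarrow> i \<notin> I \<Longrightarrow> a \<in> insert i I \<rightarrow> carrier G \<Longrightarrow>
    lincomb G a (insert i I) c = a i [^] c i \<otimes> lincomb G a I c"
  unfolding lincomb_def by (rule finprod_insert) auto

lemma lincomb_cong:
  "\<lbrakk>I = J; \<And>i. i \<in> J \<Longrightarrow> a i = b i; \<And>i. i \<in> J \<Longrightarrow> c i = d i; b \<in> J \<rightarrow> carrier G\<rbrakk> \<Longrightarrow>
    lincomb G a I c = lincomb G b J d"
  unfolding lincomb_def by (rule finprod_cong') auto

lemma lincomb_zero: "(\<And>i. i \<in> I \<Longrightarrow> c i = 0) \<Longrightarrow> lincomb G a I c = \<one>"
  unfolding lincomb_def by (rule finprod_one_eqI) auto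

lemma lincomb_add:
  assumes "a \<in> I \<rightarrow> carrier G"
  shows "lincomb G a I (\<lambda>i. c i + d i) = lincomb G a I c \<otimes> lincomb G a I d"
proof -
  have "lincomb G a I (\<lambda>i. c i + d i) = finprod G (\<lambda>i. a i [^] c i \<otimes> a i [^] d i) I"
    unfolding lincomb_def using assms by (intro finprod_cong') (auto simp: int_pow_mult Pi_iff)
  also have "\<dots> = lincomb G a I c \<otimes> lincomb G a I d"
    unfolding lincomb_def using assms by (intro finprod_multf) auto
  finally show ?thesis .
qed

lemma lincomb_pow:
  assumes "finite I" "a \<in> I \<rightarrow> carrier G"
  shows "lincomb G a I c [^] (n::int) = lincomb G a I (\<lambda>i. n * c i)"
  using assms
proof (induction I rule: finite_induct)
  case empty
  then show ?case by (simp add: lincomb_def)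
next
  case (insert i I)
  then have "a i \<in> carrier G" "a \<in> I \<rightarrow> carrier G" by auto
  with insert show ?case
    by (simp add: lincomb_insert int_pow_distrib lincomb_closed int_pow_pow mult.commute)
qed

lemma lincomb_union:
  assumes "finite I" "finite J" "I \<inter> J = {}" "a \<in> I \<rightarrow> carrier G" "a \<in> J \<rightarrow> carrier G"
  shows "lincomb G a (I \<union> J) c = lincomb G a I c \<otimes> lincomb G a J c"
  unfolding lincomb_def using assms by (intro finprod_Un_disjoint) auto

lemma lincomb_reindex:
  assumes "inj_on h I" "a \<in> h ` I \<rightarrow> carrier G"
  shows "lincomb G a (h ` I) c = lincomb G (a \<circ> h) I (c \<circ> h)"
  unfolding lincomb_def using assms by (subst finprod_reindex) (auto simp: o_def)

lemma lincomb_lincomb: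
  assumes "finite R" "finite B" "a \<in> B \<rightarrow> carrier G"
  shows "lincomb G (\<lambda>r. lincomb G a B (M r)) R x = lincomb G a B (\<lambda>b. \<Sum>r\<in>R. x r * M r b)"
  using assms
proof (induction R rule: finite_induct)
  case empty
  then show ?case by (subst lincomb_zero) (auto simp: lincomb_def)
next
  case (insert r R)
  have "lincomb G (\<lambda>r. lincomb G a B (M r)) (insert r R) x =
      lincomb G a B (\<lambda>b. x r * M r b) \<otimes> lincomb G a B (\<lambda>b. \<Sum>r\<in>R. x r * M r b)"
    using insert by (subst lincomb_insert) (auto simp: lincomb_closed lincomb_pow)
  also have "\<dots> = lincomb G a B (\<lambda>b. x r * M r b + (\<Sum>r\<in>R. x r * M r b))"
    using insert by (simp add: lincomb_add)
  finally show ?case using insert by simp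
qed

end

lemma (in group_hom) hom_lincomb:
  assumes "comm_group G" "comm_group H" "finite I" "a \<in> I \<rightarrow> carrier G"
  shows "h (lincomb G a I c) = lincomb H (h \<circ> a) I c"
  using assms(3,4)
proof (induction I rule: finite_induct)
  case empty
  interpret G: comm_group G by fact
  interpret H: comm_group H by fact
  show ?case by (simp add: lincomb_def)
next
  case (insert i I)
  interpret G: comm_group G by fact
  interpret H: comm_group H by fact
  have "a i \<in> carrier G" "a \<in> I \<rightarrow> carrier G" using insert by auto
  moreover from this have "h \<circ> a \<in> I \<rightarrow> carrier H" by (simp add: Pi_iff)
  moreover have "h \<circ> a \<in> insert i I \<rightarrow> carrier H"
    using insert by (simp add: Pi_iff)
  ultimately show ?case using insert
    by (subst H.lincomb_insert) (simp_all add: G.lincomb_insert G.lincomb_closed hom_int_pow comp_def)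
qed

text \<open>The rank relative to a subset \<open>N\<close> makes it possible to speak of the rank of a kernel or an
  image inside the ambient group, without forming the subgroup as a group of its own.\<close>

definition rank_finite_on :: "('g, 'b) monoid_scheme \<Rightarrow> 'g set \<Rightarrow> bool" where
  "rank_finite_on G N \<longleftrightarrow> bdd_above (card ` {S. int_independent G S \<and> S \<subseteq> N})"

definition rank_on :: "('g, 'b) monoid_scheme \<Rightarrow> 'g set \<Rightarrow> nat" where
  "rank_on G N = Sup (card ` {S. int_independent G S \<and> S \<subseteq> N})"

text \<open>Spanning after tensoring with the rationals.\<close>

definition torsion_spans :: "('g, 'b) monoid_scheme \<Rightarrow> ('i \<Rightarrow> 'g) \<Rightarrow> 'i set \<Rightarrow> 'g \<Rightarrow> bool" where
  "torsion_spans G a I x \<longleftrightarrow> (\<exists>n c. n \<noteq> 0 \<and> x [^]\<^bsub>G\<^esub> (n::int) = lincomb G a I c)"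

lemma finite_rank_iff_on: "finite_rank G \<longleftrightarrow> rank_finite_on G (carrier G)"
proof -
  have "{S. int_independent G S \<and> S \<subseteq> carrier G} = {S. int_independent G S}"
    by (auto simp: int_independent_def)
  then show ?thesis by (simp add: finite_rank_def rank_finite_on_def)
qed

lemma group_rank_eq_on: "group_rank G = rank_on G (carrier G)"
proof -
  have "{S. int_independent G S \<and> S \<subseteq> carrier G} = {S. int_independent G S}"
    by (auto simp: int_independent_def)
  then show ?thesis by (simp add: group_rank_def rank_on_def)
qed

lemma int_independent_empty: "int_independent G {}"
  by (simp add: int_independent_def)

lemma rank_on_attained:
  assumes "rank_finite_on G N"
  obtains S where "int_independent G S" "S \<subseteq> N" "card S = rank_on G N"
proof -
  let ?C = "card ` {S. int_independent G S \<and> S \<subseteq> N}"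
  have ne: "?C \<noteq> {}" using int_independent_empty by blast
  have "finite ?C" using assms by (simp add: rank_finite_on_def bdd_above_nat)
  then have "Sup ?C \<in> ?C" using ne by (simp only: Sup_nat_def if_False Max_in not_False_eq_True)
  then obtain S where "int_independent G S" "S \<subseteq> N" "card S = Sup ?C" by fastforce
  then show ?thesis using that unfolding rank_on_def by blast
qed

lemma card_le_rank_on:
  "rank_finite_on G N \<Longrightarrow> int_independent G S \<Longrightarrow> S \<subseteq> N \<Longrightarrow> card S \<le> rank_on G N"
  unfolding rank_finite_on_def rank_on_def by (intro cSup_upper) auto

lemma rank_on_bounded:
  assumes "\<And>S. int_independent G S \<Longrightarrow> S \<subseteq> N \<Longrightarrow> card S \<le> k"
  shows "rank_finite_on G N" "rank_on G N \<le> k"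
proof -
  show "rank_finite_on G N"
    unfolding rank_finite_on_def using assms by (intro bdd_aboveI[of _ k]) auto
  then show "rank_on G N \<le> k"
    by (metis assms rank_on_attained)
qed

context comm_group
begin

text \<open>The exchange inequality: relations expressing the elements of \<open>R\<close> through fewer generators
  can be eliminated to give a relation among the elements of \<open>R\<close>.\<close>

lemma independent_card_le:
  assumes I: "finite I" "a \<in> I \<rightarrow> carrier G" and R: "int_independent G R"
    and span: "\<And>r. r \<in> R \<Longrightarrow> torsion_spans G a I r"
  shows "card R \<le> card I"
proof (rule ccontr)
  assume "\<not> card R \<le> card I"
  moreover have fR: "finite R" and RG: "R \<subseteq> carrier G"
    using R by (auto simp: int_independent_def)
  obtain n M where nM: "\<And>r. r \<in> R \<Longrightarrow> n r \<noteq> 0 \<and> r [^] (n r :: int) = lincomb G a I (M r)"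
    using span unfolding torsion_spans_def by metis
  ultimately obtain x r0 where x: "r0 \<in> R" "x r0 \<noteq> 0"
      "\<And>b. b \<in> I \<Longrightarrow> (\<Sum>r\<in>R. x r * M r b) = 0"
    using int_homogeneous_system[OF I(1) fR, of M] by force
  have "lincomb G id R (\<lambda>r. n r * x r) = lincomb G (\<lambda>r. lincomb G a I (M r)) R x"
    unfolding lincomb_def[of G id] lincomb_def[of G "\<lambda>r. lincomb G a I (M r)"]
  proof (rule finprod_cong')
    show "(\<lambda>r. lincomb G a I (M r) [^] x r) \<in> R \<rightarrow> carrier G"
      using I by (auto intro: lincomb_closed)
  next
    fix r assume r: "r \<in> R"
    then have "r [^] (n r * x r) = (r [^] n r) [^] x r"
      using RG by (auto simp: int_pow_pow)
    then show "id r [^] (n r * x r) = lincomb G a I (M r) [^] x r" using nM r by simp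
  qed simp
  also have "\<dots> = lincomb G a I (\<lambda>b. \<Sum>r\<in>R. x r * M r b)"
    using lincomb_lincomb fR I by blast
  also have "\<dots> = \<one>" using x(3) by (rule lincomb_zero)
  finally have "\<forall>r\<in>R. n r * x r = 0" using R unfolding int_independent_iff_lincomb by blast
  with nM x show False by (metis mult_eq_0_iff)
qed

text \<open>Enlarging a maximal independent set by \<open>x\<close> creates a relation, and its coefficient at \<open>x\<close> cannot
  vanish.\<close>

lemma maximal_independent_torsion_spans:
  assumes fin: "rank_finite_on G N" and N: "N \<subseteq> carrier G"
    and S: "int_independent G S" "S \<subseteq> N" "card S = rank_on G N" and x: "x \<in> N"
  shows "torsion_spans G id S x"
proof (cases "x \<in> S")
  case True
  have fS: "finite S" "S \<subseteq> carrier G" using S by (auto simp: int_independent_def)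
  let ?c = "\<lambda>s. if s = x then 1 else (0::int)"
  have "lincomb G id S ?c = lincomb G id (insert x (S - {x})) ?c"
    using True by (simp add: insert_absorb)
  also have "\<dots> = x [^] (1::int) \<otimes> lincomb G id (S - {x}) ?c"
    using fS True by (subst lincomb_insert) auto
  also have "lincomb G id (S - {x}) ?c = \<one>" by (rule lincomb_zero) auto
  also have "x [^] (1::int) \<otimes> \<one> = x [^] (1::int)"
    using fS True by (intro r_one int_pow_closed) auto
  finally have "x [^] (1::int) = lincomb G id S ?c" by (rule sym)
  then show ?thesis unfolding torsion_spans_def by (metis zero_neq_one)
next
  case False
  have fS: "finite S" "S \<subseteq> carrier G" "x \<in> carrier G"
    using S N x by (auto simp: int_independent_def)
  have "\<not> int_independent G (insert x S)"
  proof
    assume "int_independent G (insert x S)"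
    from card_le_rank_on[OF fin this] S x False fS show False by simp
  qed
  then obtain c s where c: "lincomb G id (insert x S) c = \<one>" "s \<in> insert x S" "c s \<noteq> 0"
    using fS by (auto simp: int_independent_iff_lincomb)
  have eq: "x [^] c x \<otimes> lincomb G id S c = \<one>"
    using c(1) fS False by (subst (asm) lincomb_insert) auto
  have cl: "lincomb G id S c \<in> carrier G" using fS by (intro lincomb_closed) auto
  have "c x \<noteq> 0"
  proof
    assume 0: "c x = 0"
    then have "lincomb G id S c = \<one>" using eq cl by simp
    with S(1) have "\<forall>s\<in>S. c s = 0" by (simp add: int_independent_iff_lincomb)
    with 0 c show False by auto
  qed
  moreover have "x [^] (- c x) = lincomb G id S c"
    using eq cl fS by (metis int_pow_closed int_pow_neg inv_equality inv_inv)
  ultimately show ?thesis unfolding torsion_spans_def by (metis neg_equal_0_iff_equal)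
qed

lemma rank_on_trivial: "rank_finite_on G {\<one>}" "rank_on G {\<one>} = 0"
proof -
  have "card S \<le> 0" if S: "int_independent G S" "S \<subseteq> {\<one>}" for S
  proof -
    have "S \<noteq> {\<one>}"
      using S(1) unfolding int_independent_iff_lincomb
      by (auto simp: lincomb_def dest: spec[of _ "\<lambda>_. 1"])
    with S(2) have "S = {}" by (simp add: subset_singleton_iff)
    then show ?thesis by simp
  qed
  from rank_on_bounded[of G "{\<one>}" 0, OF this]
  show "rank_finite_on G {\<one>}" "rank_on G {\<one>} = 0" by auto
qed

end

text \<open>Rank--nullity. An independent set in the kernel and lifts of an independent set in the image
  are jointly independent; conversely, if both are maximal, a nonzero multiple of every element is a
  combination of them.\<close>

theorem (in group_hom) rank_nullity:
  assumes cG: "comm_group G" and cH: "comm_group H"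
  shows "finite_rank G \<longleftrightarrow> rank_finite_on G (kernel G H h) \<and> rank_finite_on H (h ` carrier G)"
    and "finite_rank G \<Longrightarrow> group_rank G = rank_on G (kernel G H h) + rank_on H (h ` carrier G)"
proof -
  interpret G: comm_group G by fact
  interpret H: comm_group H by fact
  let ?K = "kernel G H h" and ?I = "h ` carrier G"
  have K: "?K \<subseteq> carrier G" by (auto simp: kernel_def)
  define g where "g = inv_into (carrier G) h"
  have g: "g t \<in> carrier G" "h (g t) = t" if "t \<in> ?I" for t
    using that by (auto simp: g_def inv_into_into f_inv_into_f)
  \<comment> \<open>An independent set of the image is lifted by a section of \<open>h\<close>. Applying \<open>h\<close> to a relation kills
    its part in the kernel and leaves a relation in the image.\<close>
  have lower: "int_independent G (S \<union> g ` T)" "card (S \<union> g ` T) = card S + card T"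
    "finite (S \<union> g ` T)" "S \<inter> g ` T = {}" "inj_on g T"
    if S: "int_independent G S" "S \<subseteq> ?K" and T: "int_independent H T" "T \<subseteq> ?I" for S T
  proof -
    have fin: "finite S" "finite T" "S \<subseteq> carrier G" "T \<subseteq> carrier H"
      using S T by (auto simp: int_independent_def)
    have gT: "g t \<in> carrier G" "h (g t) = t" if "t \<in> T" for t using g that T by auto
    show inj: "inj_on g T" by (metis inj_onI gT(2))
    have T1: "\<one>\<^bsub>H\<^esub> \<notin> T"
    proof
      assume "\<one>\<^bsub>H\<^esub> \<in> T"
      moreover have "lincomb H id T (\<lambda>t. if t = \<one>\<^bsub>H\<^esub> then 1 else 0) = \<one>\<^bsub>H\<^esub>"
        unfolding lincomb_def by (rule H.finprod_one_eqI) auto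
      ultimately have "(if \<one>\<^bsub>H\<^esub> = \<one>\<^bsub>H\<^esub> then 1 else 0) = (0::int)"
        using T(1) unfolding int_independent_iff_lincomb by blast
      then show False by simp
    qed
    show disj: "S \<inter> g ` T = {}"
    proof -
      have False if "t \<in> T" "g t \<in> S" for t
        using that S(2) T1 gT(2)[OF that(1)] by (auto simp: kernel_def)
      then show ?thesis by blast
    qed
    show "card (S \<union> g ` T) = card S + card T"
      using disj fin inj by (simp add: card_Un_disjoint card_image)
    show "finite (S \<union> g ` T)" using fin by simp
    show "int_independent G (S \<union> g ` T)"
      unfolding int_independent_iff_lincomb
    proof (intro conjI allI impI)
      show "finite (S \<union> g ` T)" using fin by simp
      show "S \<union> g ` T \<subseteq> carrier G" using fin gT by auto
    next
      fix c assume "lincomb G id (S \<union> g ` T) c = \<one>"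
      moreover have "id \<in> S \<rightarrow> carrier G" "id \<in> g ` T \<rightarrow> carrier G" using fin gT by auto
      ultimately have eq: "lincomb G id S c \<otimes> lincomb G g T (c \<circ> g) = \<one>"
        using G.lincomb_union[of S "g ` T" id c] fin disj inj G.lincomb_reindex[of g T id c]
        by simp
      have cl: "lincomb G id S c \<in> carrier G" "lincomb G g T (c \<circ> g) \<in> carrier G"
        using fin gT by (auto intro!: G.lincomb_closed)
      have "h (lincomb G id S c) = lincomb H (h \<circ> id) S c"
        using fin by (intro hom_lincomb cG cH) auto
      also have "\<dots> = \<one>\<^bsub>H\<^esub>"
        unfolding lincomb_def using S(2) by (intro H.finprod_one_eqI) (auto simp: kernel_def)
      finally have "h (lincomb G g T (c \<circ> g)) = \<one>\<^bsub>H\<^esub>"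
        using arg_cong[OF eq, of h] cl by simp
      moreover have "h (lincomb G g T (c \<circ> g)) = lincomb H (h \<circ> g) T (c \<circ> g)"
        using fin gT by (intro hom_lincomb cG cH) auto
      moreover have "\<dots> = lincomb H id T (c \<circ> g)"
        using fin gT by (intro H.lincomb_cong) auto
      ultimately have T0: "\<forall>t\<in>T. (c \<circ> g) t = 0"
        using T(1) unfolding int_independent_iff_lincomb by metis
      then have "lincomb G g T (c \<circ> g) = \<one>" by (intro G.lincomb_zero) auto
      then have "lincomb G id S c = \<one>" using eq cl by simp
      then have "\<forall>s\<in>S. c s = 0" using S(1) by (simp add: int_independent_iff_lincomb)
      with T0 show "\<forall>s\<in>S \<union> g ` T. c s = 0" by auto
    qed
  qed
  \<comment> \<open>Some multiple of \<open>r\<close> differs by an element of the kernel from a combination of the lifts, and a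
    multiple of that element is a combination of the independent set chosen there.\<close>
  have upper: "card R \<le> rank_on G ?K + rank_on H ?I"
    if fK: "rank_finite_on G ?K" and fI: "rank_finite_on H ?I" and R: "int_independent G R" for R
  proof -
    obtain S where S: "int_independent G S" "S \<subseteq> ?K" "card S = rank_on G ?K"
      using rank_on_attained[OF fK] .
    obtain T where T: "int_independent H T" "T \<subseteq> ?I" "card T = rank_on H ?I"
      using rank_on_attained[OF fI] .
    have fin: "finite S" "finite T" "S \<subseteq> carrier G" "T \<subseteq> carrier H"
      using S T by (auto simp: int_independent_def)
    have gT: "g t \<in> carrier G" "h (g t) = t" if "t \<in> T" for t using g that T by auto
    note low = lower[OF S(1,2) T(1,2)]
    have "torsion_spans G id (S \<union> g ` T) r" if r: "r \<in> carrier G" for r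
    proof -
      have "torsion_spans H id T (h r)"
        using r by (intro H.maximal_independent_torsion_spans[OF fI _ T]) auto
      then obtain n c where n: "n \<noteq> 0" "h r [^]\<^bsub>H\<^esub> (n::int) = lincomb H id T c"
        unfolding torsion_spans_def by blast
      define l where "l = lincomb G g T c"
      have l: "l \<in> carrier G" using gT by (auto simp: l_def intro!: G.lincomb_closed)
      have "h l = lincomb H (h \<circ> g) T c"
        unfolding l_def using fin gT by (intro hom_lincomb cG cH) auto
      also have "\<dots> = lincomb H id T c" using fin gT by (intro H.lincomb_cong) auto
      finally have "r [^] n \<otimes> inv l \<in> ?K"
        using r l by (simp add: kernel_def hom_int_pow n(2)[symmetric])
      from G.maximal_independent_torsion_spans[OF fK K S this]
      obtain m d where m: "m \<noteq> 0"
        "(r [^] n \<otimes> inv l) [^] (m::int) = lincomb G id S d"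
        unfolding torsion_spans_def by blast
      define e where "e s = (if s \<in> S then d s else m * c (h s))" for s
      have "lincomb G id (S \<union> g ` T) e = lincomb G id S e \<otimes> lincomb G id (g ` T) e"
        using fin gT low(4) by (intro G.lincomb_union) auto
      also have "lincomb G id S e = lincomb G id S d"
        using fin by (intro G.lincomb_cong) (auto simp: e_def)
      also have "lincomb G id (g ` T) e = lincomb G g T (\<lambda>t. m * c t)"
      proof -
        have "lincomb G id (g ` T) e = lincomb G (id \<circ> g) T (e \<circ> g)"
          using low(5) gT by (intro G.lincomb_reindex) auto
        also have "\<dots> = lincomb G g T (\<lambda>t. m * c t)"
          using gT low(4) by (intro G.lincomb_cong) (auto simp: e_def)
        finally show ?thesis .
      qed
      also have "\<dots> = l [^] m"
        unfolding l_def using fin gT by (subst G.lincomb_pow) auto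
      also have "lincomb G id S d \<otimes> l [^] m = r [^] (n * m)"
      proof -
        have "lincomb G id S d \<otimes> l [^] m =
            ((r [^] n \<otimes> inv l) \<otimes> l) [^] m"
          using r l by (simp add: m(2)[symmetric] G.int_pow_distrib)
        then show ?thesis using r l by (simp add: G.m_assoc G.int_pow_pow)
      qed
      finally have "r [^] (n * m) = lincomb G id (S \<union> g ` T) e" ..
      moreover have "n * m \<noteq> 0" using n m by simp
      ultimately show ?thesis unfolding torsion_spans_def by blast
    qed
    moreover have "R \<subseteq> carrier G" using R by (simp add: int_independent_def)
    ultimately have "card R \<le> card (S \<union> g ` T)"
      using fin gT by (intro G.independent_card_le[OF low(3) _ R, of id]) auto
    then show ?thesis using S T low(2) by simp
  qed
  have fin1: "rank_finite_on G ?K" if "finite_rank G"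
    using card_le_rank_on[of G "carrier G"] that K
    by (intro rank_on_bounded(1)[of _ _ "rank_on G (carrier G)"]) (auto simp: finite_rank_iff_on)
  have fin2: "rank_finite_on H ?I" if "finite_rank G"
  proof (intro rank_on_bounded(1)[of _ _ "rank_on G (carrier G)"])
    fix T assume T: "int_independent H T" "T \<subseteq> ?I"
    have "card T = card ({} \<union> g ` T)"
      using lower[OF int_independent_empty _ T] by simp
    also have "\<dots> \<le> rank_on G (carrier G)"
      using lower[OF int_independent_empty _ T] that
      by (intro card_le_rank_on) (auto simp: finite_rank_iff_on int_independent_def)
    finally show "card T \<le> rank_on G (carrier G)" .
  qed
  show eqv: "finite_rank G \<longleftrightarrow> rank_finite_on G ?K \<and> rank_finite_on H ?I"
    using fin1 fin2 upper rank_on_bounded(1)[of G "carrier G"] by (auto simp: finite_rank_iff_on)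
  show "group_rank G = rank_on G ?K + rank_on H ?I" if "finite_rank G"
  proof (rule antisym)
    have f: "rank_finite_on G ?K" "rank_finite_on H ?I" using eqv that by auto
    then show "group_rank G \<le> rank_on G ?K + rank_on H ?I"
      unfolding group_rank_eq_on using upper by (intro rank_on_bounded(2)) auto
    obtain S where S: "int_independent G S" "S \<subseteq> ?K" "card S = rank_on G ?K"
      using rank_on_attained[OF f(1)] .
    obtain T where T: "int_independent H T" "T \<subseteq> ?I" "card T = rank_on H ?I"
      using rank_on_attained[OF f(2)] .
    have "card (S \<union> g ` T) \<le> rank_on G (carrier G)"
      using lower(1)[OF S(1,2) T(1,2)] that
      by (intro card_le_rank_on) (auto simp: finite_rank_iff_on int_independent_def)
    then show "rank_on G ?K + rank_on H ?I \<le> group_rank G"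
      using lower(2)[OF S(1,2) T(1,2)] S T by (simp add: group_rank_eq_on)
  qed
qed

lemma rank_iso:
  assumes iso: "G \<cong> H" and cG: "comm_group G" and cH: "comm_group H"
  shows "finite_rank G \<longleftrightarrow> finite_rank H" "finite_rank G \<Longrightarrow> group_rank G = group_rank H"
proof -
  interpret G: comm_group G by fact
  interpret H: comm_group H by fact
  obtain h where h: "h \<in> iso G H" using iso by (auto simp: is_iso_def)
  then have gh: "group_hom G H h"
    by (simp add: group_hom_def group_hom_axioms_def iso_def G.is_group H.is_group)
  have "inj_on h (carrier G)" and im: "h ` carrier G = carrier H"
    using h by (auto simp: iso_def bij_betw_def)
  then have ker: "kernel G H h = {\<one>\<^bsub>G\<^esub>}"
    using group_hom.inj_iff_trivial_ker[OF gh] by simp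
  show "finite_rank G \<longleftrightarrow> finite_rank H" "finite_rank G \<Longrightarrow> group_rank G = group_rank H"
    using group_hom.rank_nullity[OF gh cG cH] G.rank_on_trivial unfolding ker im
    by (simp_all add: finite_rank_iff_on group_rank_eq_on)
qed

lemma rank_trivial_group:
  assumes "comm_group G" "trivial_group G"
  shows "finite_rank G" "group_rank G = 0"
proof -
  interpret comm_group G by fact
  have "carrier G = {\<one>\<^bsub>G\<^esub>}" using assms(2) by (simp add: trivial_group_def)
  then show "finite_rank G" "group_rank G = 0"
    using rank_on_trivial by (simp_all add: finite_rank_iff_on group_rank_eq_on)
qed

lemma rank_integer_group: "finite_rank integer_group" "group_rank integer_group = 1"
proof -
  interpret comm_group integer_group by (rule abelian_integer_group)
  have "card S \<le> 1" if S: "int_independent integer_group S" for S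
  proof -
    have "torsion_spans integer_group (\<lambda>_::unit. 1) {()} r" for r
      unfolding torsion_spans_def lincomb_def
      by (rule exI[of _ 1], rule exI[of _ "\<lambda>_. r"]) simp
    then show ?thesis using independent_card_le[of "{()}" "\<lambda>_. 1" S] S by auto
  qed
  from rank_on_bounded[of integer_group "carrier integer_group" 1, OF this]
  have fin: "finite_rank integer_group" and le: "group_rank integer_group \<le> 1"
    by (auto simp: finite_rank_iff_on group_rank_eq_on)
  show "finite_rank integer_group" by (rule fin)
  have "int_independent integer_group {1}"
    by (auto simp: int_independent_def)
  from card_le_rank_on[OF fin[unfolded finite_rank_iff_on] this]
  show "group_rank integer_group = 1" using le by (simp add: group_rank_eq_on)
qed

section \<open>Additivity of the Euler characteristic\<close>

definition rel_betti :: "nat \<Rightarrow> 'a topology \<Rightarrow> 'a set \<Rightarrow> nat" where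
  "rel_betti p X S = group_rank (relative_homology_group (int p) X S)"

definition ranks_finite :: "'a topology \<Rightarrow> 'a set \<Rightarrow> bool" where
  "ranks_finite X S \<longleftrightarrow> (\<forall>p. finite_rank (relative_homology_group (int p) X S))"

text \<open>The finiteness conditions are carried along with the value, so that the additivity results prove
  the existence of an Euler characteristic and compute it at the same time.\<close>

definition has_rel_chi :: "'a topology \<Rightarrow> 'a set \<Rightarrow> int \<Rightarrow> bool" where
  "has_rel_chi X S c \<longleftrightarrow> ranks_finite X S \<and> finite {p. rel_betti p X S \<noteq> 0} \<and>
    c = (\<Sum>p | rel_betti p X S \<noteq> 0. (-1) ^ p * int (rel_betti p X S))"

abbreviation has_chi :: "'a topology \<Rightarrow> int \<Rightarrow> bool" where
  "has_chi X c \<equiv> has_rel_chi X {} c"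

lemma has_chi_iff: "has_chi X c \<longleftrightarrow> has_euler_char X \<and> euler_char X = c"
  by (auto simp: has_rel_chi_def ranks_finite_def has_euler_char_def euler_char_def rel_betti_def betti_def)

lemma alternating_sum_eq:
  fixes b :: "nat \<Rightarrow> nat"
  assumes "\<And>p. p \<ge> N \<Longrightarrow> b p = 0"
  shows "(\<Sum>p | b p \<noteq> 0. (-1) ^ p * int (b p)) = (\<Sum>p<N. (-1) ^ p * int (b p))"
proof (rule sum.mono_neutral_left)
  show "{p. b p \<noteq> 0} \<subseteq> {..<N}"
  proof
    fix p assume "p \<in> {p. b p \<noteq> 0}"
    then show "p \<in> {..<N}" using assms[of p] by (cases "p < N") auto
  qed
qed auto

text \<open>The numbers \<open>a\<close>, \<open>x\<close>, \<open>q\<close> stand for the ranks in a long exact sequence, and \<open>i\<close>, \<open>j\<close>, \<open>d\<close> for the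
  ranks of the images of its maps. The alternating sum of \<open>a - x + q\<close> telescopes.\<close>

lemma alternating_sum_exact:
  fixes a x q i j d :: "nat \<Rightarrow> nat"
  assumes a: "\<And>p. a p = d (Suc p) + i p" and x: "\<And>p. x p = i p + j p"
    and q: "\<And>p. q p = j p + d p" and d: "d 0 = 0"
    and fin: "finite {p. a p \<noteq> 0}" "finite {p. x p \<noteq> 0}" "finite {p. q p \<noteq> 0}"
  shows "(\<Sum>p | x p \<noteq> 0. (-1) ^ p * int (x p)) =
    (\<Sum>p | a p \<noteq> 0. (-1) ^ p * int (a p)) + (\<Sum>p | q p \<noteq> 0. (-1) ^ p * int (q p))"
proof -
  have "finite ({p. a p \<noteq> 0} \<union> {p. x p \<noteq> 0} \<union> {p. q p \<noteq> 0})" using fin by simp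
  then obtain N where N: "\<And>p. p \<in> {p. a p \<noteq> 0} \<union> {p. x p \<noteq> 0} \<union> {p. q p \<noteq> 0} \<Longrightarrow> p < N"
    by (metis finite_nat_set_iff_bounded)
  then have zero: "a p = 0" "x p = 0" "q p = 0" if "p \<ge> N" for p
  proof -
    have "p \<notin> {p. a p \<noteq> 0} \<union> {p. x p \<noteq> 0} \<union> {p. q p \<noteq> 0}" using that N[of p] by linarith
    then show "a p = 0" "x p = 0" "q p = 0" by auto
  qed
  have tel: "(\<Sum>p<n. (-1) ^ p * (int (d (Suc p)) + int (d p))) = - ((-1) ^ n * int (d n))" for n
    by (induction n) (simp_all add: d algebra_simps)
  have "(\<Sum>p<N. (-1) ^ p * int (a p)) + (\<Sum>p<N. (-1) ^ p * int (q p)) - (\<Sum>p<N. (-1) ^ p * int (x p))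
      = (\<Sum>p<N. (-1) ^ p * (int (d (Suc p)) + int (d p)))"
    unfolding sum.distrib[symmetric] sum_subtractf[symmetric]
    by (intro sum.cong) (simp_all add: a x q algebra_simps)
  also have "\<dots> = 0" unfolding tel using zero(3)[of N] q[of N] by simp
  finally show ?thesis
    using alternating_sum_eq[of N a] alternating_sum_eq[of N x] alternating_sum_eq[of N q] zero
    by simp
qed

lemma long_exact_sequence_ranks:
  fixes X :: "'a topology" and S :: "'a set"
  obtains i j d :: "nat \<Rightarrow> nat" where
    "\<And>p. ranks_finite (subtopology X S) {} \<Longrightarrow> rel_betti p (subtopology X S) {} = d (Suc p) + i p"
    "\<And>p. ranks_finite X {} \<Longrightarrow> rel_betti p X {} = i p + j p"
    "\<And>p. ranks_finite X S \<Longrightarrow> rel_betti p X S = j p + d p" "d 0 = 0"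
    "ranks_finite (subtopology X S) {} \<Longrightarrow> ranks_finite X {} \<Longrightarrow> ranks_finite X S"
    "ranks_finite (subtopology X S) {} \<Longrightarrow> ranks_finite X S \<Longrightarrow> ranks_finite X {}"
proof -
  define A where "A p = homology_group (int p) (subtopology X S)" for p
  define B where "B p = homology_group (int p) X" for p
  define R where "R p = relative_homology_group (int p) X S" for p
  have ranks: "ranks_finite (subtopology X S) {} \<longleftrightarrow> (\<forall>p. finite_rank (A p))"
    "ranks_finite X {} \<longleftrightarrow> (\<forall>p. finite_rank (B p))" "ranks_finite X S \<longleftrightarrow> (\<forall>p. finite_rank (R p))"
    by (simp_all add: ranks_finite_def A_def B_def R_def)
  define fi where "fi p = hom_induced (int p) (subtopology X S) {} X {} id" for p
  define fj where "fj p = hom_induced (int p) X {} X S id" for p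
  define fd where "fd p = hom_boundary (int p) X S" for p
  define D where "D p = homology_group (int p - 1) (subtopology X S)" for p
  have grp: "comm_group (A p)" "comm_group (B p)" "comm_group (R p)" "comm_group (D p)" for p
    by (simp_all add: A_def B_def R_def D_def)
  have g: "group (A p)" "group (B p)" "group (R p)" "group (D p)" for p
    by (simp_all add: A_def B_def R_def D_def)
  have DA: "D (Suc p) = A p" for p by (simp add: D_def A_def)
  have e1: "group_hom (B p) (R p) (fj p)" "fd p \<in> hom (R p) (D p)"
      "kernel (R p) (D p) (fd p) = fj p ` carrier (B p)" for p
    using homology_exactness_axiom_1[of "int p" X S]
    by (simp_all add: A_def B_def R_def D_def fj_def fd_def)
  have e2: "group_hom (R (Suc p)) (A p) (fd (Suc p))" "fi p \<in> hom (A p) (B p)"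
      "kernel (A p) (B p) (fi p) = fd (Suc p) ` carrier (R (Suc p))" for p
    using homology_exactness_axiom_2[of "int (Suc p)" X S]
    by (simp_all add: A_def B_def R_def fi_def fd_def)
  have e3: "kernel (B p) (R p) (fj p) = fi p ` carrier (A p)" for p
    using homology_exactness_axiom_3[of "int p" X S]
    by (simp_all add: A_def B_def R_def fi_def fj_def)
  have hi: "group_hom (A p) (B p) (fi p)" and hj: "group_hom (B p) (R p) (fj p)"
    and hd: "group_hom (R p) (D p) (fd p)" for p
    using e1 e2 g by (auto simp: group_hom_def group_hom_axioms_def)
  define i where "i p = rank_on (B p) (fi p ` carrier (A p))" for p
  define j where "j p = rank_on (R p) (fj p ` carrier (B p))" for p
  define d where "d p = rank_on (D p) (fd p ` carrier (R p))" for p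
  have im0: "fd 0 ` carrier (R 0) = {\<one>\<^bsub>D 0\<^esub>}"
  proof -
    have "trivial_group (D 0)" unfolding D_def by (rule trivial_homology_group) simp
    then have "carrier (D 0) = {\<one>\<^bsub>D 0\<^esub>}" by (simp add: trivial_group_def)
    moreover have "fd 0 ` carrier (R 0) \<subseteq> carrier (D 0)"
      using e1(2)[of 0] by (auto simp: hom_def)
    moreover have "carrier (R 0) \<noteq> {}" using g(3) group.is_monoid monoid.one_closed by blast
    ultimately show ?thesis by (metis image_is_empty subset_singletonD)
  qed
  have d0: "d 0 = 0" and rf0: "rank_finite_on (D 0) (fd 0 ` carrier (R 0))"
    using comm_group.rank_on_trivial[OF grp(4)[of 0]] by (simp_all add: d_def im0)
  note RA = group_hom.rank_nullity[OF hi grp(1,2), unfolded e2(3)]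
  note RB = group_hom.rank_nullity[OF hj grp(2,3), unfolded e3]
  note RR = group_hom.rank_nullity[OF hd grp(3,4), unfolded e1(3)]
  show thesis
  proof (rule that[of d i j])
    show "rel_betti p (subtopology X S) {} = d (Suc p) + i p" if "ranks_finite (subtopology X S) {}" for p
      using RA(2)[of p] that unfolding ranks by (simp add: rel_betti_def A_def d_def i_def DA)
    show "rel_betti p X {} = i p + j p" if "ranks_finite X {}" for p
      using RB(2)[of p] that unfolding ranks by (simp add: rel_betti_def B_def i_def j_def)
    show "rel_betti p X S = j p + d p" if "ranks_finite X S" for p
      using RR(2)[of p] that unfolding ranks by (simp add: rel_betti_def R_def j_def d_def)
    show "d 0 = 0" by (rule d0)
    show "ranks_finite X S" if "ranks_finite (subtopology X S) {}" "ranks_finite X {}"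
      unfolding ranks
    proof
      fix p
      have "rank_finite_on (D p) (fd p ` carrier (R p))"
        using that RA(1) rf0 unfolding ranks by (cases p) (auto simp: DA)
      then show "finite_rank (R p)" using that RB(1) RR(1) unfolding ranks by blast
    qed
    show "ranks_finite X {}" if "ranks_finite (subtopology X S) {}" "ranks_finite X S"
      using that RA(1) RB(1) RR(1) unfolding ranks by blast
  qed
qed

lemma has_rel_chi_diff:
  assumes A: "has_chi (subtopology X S) a" and X: "has_chi X x"
  shows "has_rel_chi X S (x - a)"
proof -
  have f: "ranks_finite (subtopology X S) {}" "ranks_finite X {}"
    using A X by (simp_all add: has_rel_chi_def)
  obtain i j d where
    eqs: "\<And>p. rel_betti p (subtopology X S) {} = d (Suc p) + i p" "\<And>p. rel_betti p X {} = i p + j p"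
      "\<And>p. rel_betti p X S = j p + d p" and d0: "d 0 = 0" and fR: "ranks_finite X S"
    using f by (rule_tac long_exact_sequence_ranks[of X S]) metis
  have "{p. rel_betti p X S \<noteq> 0} \<subseteq>
      {p. rel_betti p X {} \<noteq> 0} \<union> Suc ` {p. rel_betti p (subtopology X S) {} \<noteq> 0}"
  proof
    fix p assume "p \<in> {p. rel_betti p X S \<noteq> 0}"
    then show "p \<in> {p. rel_betti p X {} \<noteq> 0} \<union> Suc ` {p. rel_betti p (subtopology X S) {} \<noteq> 0}"
      using d0 by (cases p) (auto simp: eqs)
  qed
  then have fin: "finite {p. rel_betti p X S \<noteq> 0}"
    using A X by (auto simp: has_rel_chi_def intro: finite_subset)
  have "x = a + (\<Sum>p | rel_betti p X S \<noteq> 0. (-1) ^ p * int (rel_betti p X S))"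
    using alternating_sum_exact[OF eqs d0 _ _ fin] A X by (simp add: has_rel_chi_def)
  then show ?thesis using fin fR by (simp add: has_rel_chi_def)
qed

lemma has_chi_add:
  assumes A: "has_chi (subtopology X S) a" and R: "has_rel_chi X S q"
  shows "has_chi X (a + q)"
proof -
  have f: "ranks_finite (subtopology X S) {}" "ranks_finite X S"
    using A R by (simp_all add: has_rel_chi_def)
  obtain i j d where
    eqs: "\<And>p. rel_betti p (subtopology X S) {} = d (Suc p) + i p" "\<And>p. rel_betti p X {} = i p + j p"
      "\<And>p. rel_betti p X S = j p + d p" and d0: "d 0 = 0" and fX: "ranks_finite X {}"
    using f by (rule_tac long_exact_sequence_ranks[of X S]) metis
  have "{p. rel_betti p X {} \<noteq> 0} \<subseteq>
      {p. rel_betti p X S \<noteq> 0} \<union> {p. rel_betti p (subtopology X S) {} \<noteq> 0}"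
    by (auto simp: eqs)
  then have fin: "finite {p. rel_betti p X {} \<noteq> 0}"
    using A R by (auto simp: has_rel_chi_def intro: finite_subset)
  have "(\<Sum>p | rel_betti p X {} \<noteq> 0. (-1) ^ p * int (rel_betti p X {})) = a + q"
    using alternating_sum_exact[OF eqs d0 _ fin] A R by (simp add: has_rel_chi_def)
  then show ?thesis using fin fX by (simp add: has_rel_chi_def)
qed

lemma has_rel_chi_iso:
  assumes "has_rel_chi X S c"
    and iso: "\<And>p. relative_homology_group (int p) X S \<cong> relative_homology_group (int p) Y T"
  shows "has_rel_chi Y T c"
proof -
  have fr: "finite_rank (relative_homology_group (int p) X S)" for p
    using assms(1) by (simp add: has_rel_chi_def ranks_finite_def)
  have "finite_rank (relative_homology_group (int p) Y T)" for p
    using rank_iso(1)[OF iso] fr by simp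
  moreover have "rel_betti p X S = rel_betti p Y T" for p
    unfolding rel_betti_def using fr by (intro rank_iso(2)[OF iso]) auto
  ultimately show ?thesis using assms(1) by (simp add: has_rel_chi_def ranks_finite_def)
qed

lemma has_chi_homotopy_equivalent:
  "X homotopy_equivalent_space Y \<Longrightarrow> has_chi X c \<Longrightarrow> has_chi Y c"
  by (rule has_rel_chi_iso) (auto intro: homotopy_equivalent_space_imp_isomorphic_homology_groups)

lemma has_chi_homeomorphic: "X homeomorphic_space Y \<Longrightarrow> has_chi X c \<Longrightarrow> has_chi Y c"
  by (meson has_chi_homotopy_equivalent homeomorphic_imp_homotopy_equivalent_space)

text \<open>Excision of \<open>V - U\<close> identifies the homology of the pairs \<open>(U \<union> V, V)\<close> and \<open>(U, U \<inter> V)\<close>.\<close>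

theorem has_chi_Mayer_Vietoris:
  assumes U: "openin X U" and V: "openin X V"
    and chi: "has_chi (subtopology X U) u" "has_chi (subtopology X V) v"
      "has_chi (subtopology X (U \<inter> V)) w"
  shows "has_chi (subtopology X (U \<union> V)) (u + v - w)"
proof -
  let ?Y = "subtopology X (U \<union> V)"
  have tU: "U \<subseteq> topspace X" "V \<subseteq> topspace X" using U V by (auto dest: openin_subset)
  have UY: "openin ?Y U" "openin ?Y V"
    using openin_subtopology_Int2[OF U, of "U \<union> V"] openin_subtopology_Int2[OF V, of "U \<union> V"]
    by (simp_all add: Int_absorb1)
  have sub: "subtopology ?Y U = subtopology X U" "subtopology ?Y V = subtopology X V"
      "subtopology (subtopology X U) (V \<inter> U) = subtopology X (U \<inter> V)"
    by (auto simp: subtopology_subtopology Int_commute intro!: arg_cong[of _ _ "subtopology X"])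
  have rel: "has_rel_chi (subtopology X U) (V \<inter> U) (u - w)"
    using has_rel_chi_diff[of "subtopology X U" "V \<inter> U" w u] chi sub by simp
  let ?W = "topspace ?Y - U"
  have "closedin ?Y ?W" using UY by blast
  then have "?Y closure_of ?W \<subseteq> ?Y interior_of V"
    using UY tU by (auto simp: closure_of_closedin interior_of_openin)
  from homology_excision_axiom[OF this, of "topspace ?Y"]
  have "hom_induced p (subtopology ?Y (topspace ?Y - ?W)) (V - ?W) (subtopology ?Y (topspace ?Y)) V id
      \<in> iso (relative_homology_group p (subtopology ?Y (topspace ?Y - ?W)) (V - ?W))
          (relative_homology_group p (subtopology ?Y (topspace ?Y)) V)" for p
    using tU by auto
  moreover have "topspace ?Y - ?W = U" "V - ?W = V \<inter> U" using tU by auto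
  ultimately have "relative_homology_group p (subtopology X U) (V \<inter> U) \<cong> relative_homology_group p ?Y V" for p
    using sub by (metis is_isoI subtopology_topspace)
  from has_rel_chi_iso[OF rel this] have "has_rel_chi ?Y V (u - w)" .
  from has_chi_add[OF _ this, of v] show ?thesis using chi sub by (simp add: algebra_simps)
qed

lemma has_chi_empty: "topspace X = {} \<Longrightarrow> has_chi X 0"
  using rank_trivial_group[OF _ trivial_homology_group_empty[of X]]
  by (simp add: has_rel_chi_def ranks_finite_def rel_betti_def)

lemma has_chi_singleton:
  assumes "topspace X = {a}"
  shows "has_chi X 1"
proof -
  have pos: "finite_rank (homology_group (int p) X)" "rel_betti p X {} = 0" if "p > 0" for p
    using that rank_trivial_group[OF _ homology_dimension_axiom[OF assms, of "int p"]]
    by (auto simp: rel_betti_def)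
  have "path_connected_space X" using assms
    by (metis path_connectedin_singleton path_connectedin_topspace insertI1)
  then have "homology_group 0 X \<cong> integer_group"
    using assms by (intro isomorphic_integer_zeroth_homology_group) auto
  from rank_iso[OF this _ abelian_integer_group] rank_integer_group
  have zero: "finite_rank (homology_group 0 X)" "rel_betti 0 X {} = 1"
    by (auto simp: rel_betti_def)
  have "rel_betti p X {} \<noteq> 0 \<longleftrightarrow> p = 0" for p
    using pos(2) zero(2) by (metis One_nat_def neq0_conv zero_neq_one)
  then have "{p. rel_betti p X {} \<noteq> 0} = {0}" by auto
  moreover have "finite_rank (homology_group (int p) X)" for p
    using pos(1)[of p] zero(1) by (cases "p = 0") auto
  ultimately show ?thesis using zero(2) by (simp add: has_rel_chi_def ranks_finite_def)
qed

section \<open>Products with finite CW complexes\<close>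

abbreviation unit_interval :: "real topology" where
  "unit_interval \<equiv> subtopology euclideanreal {0..1}"

abbreviation cylinder :: "'a topology \<Rightarrow> (real \<times> 'a) topology" where
  "cylinder X \<equiv> prod_topology unit_interval X"

lemma homotopic_withI:
  assumes "continuous_map (cylinder X) Y h"
    and "\<And>x. x \<in> topspace X \<Longrightarrow> h (0, x) = f x" "\<And>x. x \<in> topspace X \<Longrightarrow> h (1, x) = g x"
  shows "homotopic_with (\<lambda>_. True) X Y f g"
  using assms by (subst homotopic_with) auto

lemma deformation_retract_homotopy_equivalent:
  assumes h: "continuous_map (cylinder X) X h" and S: "S \<subseteq> topspace X"
    and h0: "\<And>x. x \<in> topspace X \<Longrightarrow> h (0, x) = x"
    and h1: "\<And>x. x \<in> topspace X \<Longrightarrow> h (1, x) \<in> S" "\<And>x. x \<in> S \<Longrightarrow> h (1, x) = x"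
  shows "X homotopy_equivalent_space subtopology X S"
proof (rule deformation_retract_imp_homotopy_equivalent_space)
  show "homotopic_with (\<lambda>_. True) X X (\<lambda>x. h (1, x)) id"
    by (subst homotopic_with_sym, rule homotopic_withI[OF h]) (simp_all add: h0)
  have "continuous_map X (cylinder X) (\<lambda>x. (1, x))"
    by (simp add: continuous_map_paired continuous_map_in_subtopology)
  from continuous_map_compose[OF this h] have "continuous_map X X (\<lambda>x. h (1, x))"
    by (simp add: o_def)
  then show "retraction_maps X (subtopology X S) (\<lambda>x. h (1, x)) id"
    using S h1 by (auto simp: retraction_maps_def continuous_map_in_subtopology)
qed

lemma homotopy_equivalent_space_prod:
  assumes "Y homotopy_equivalent_space Y'"
  shows "prod_topology Z Y homotopy_equivalent_space prod_topology Z Y'"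
proof -
  obtain f g where f: "continuous_map Y Y' f" and g: "continuous_map Y' Y g"
    and gf: "homotopic_with (\<lambda>_. True) Y Y (g \<circ> f) id" and fg: "homotopic_with (\<lambda>_. True) Y' Y' (f \<circ> g) id"
    using assms unfolding homotopy_equivalent_space_def by blast
  have idZ: "homotopic_with (\<lambda>_. True) Z Z id id" by simp
  show ?thesis unfolding homotopy_equivalent_space_def
  proof (intro exI conjI)
    show "continuous_map (prod_topology Z Y) (prod_topology Z Y') (\<lambda>(z, y). (z, f y))"
      "continuous_map (prod_topology Z Y') (prod_topology Z Y) (\<lambda>(z, y). (z, g y))"
      using f g continuous_map_prod_top[of Z Y Z Y' id f] continuous_map_prod_top[of Z Y' Z Y id g]
      by (auto simp: id_def)
    show "homotopic_with (\<lambda>_. True) (prod_topology Z Y) (prod_topology Z Y)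
        ((\<lambda>(z, y). (z, g y)) \<circ> (\<lambda>(z, y). (z, f y))) id"
      by (rule homotopic_with_eq[OF homotopic_with_prod_topology[OF idZ gf, of "\<lambda>_. True"]]) auto
    show "homotopic_with (\<lambda>_. True) (prod_topology Z Y') (prod_topology Z Y')
        ((\<lambda>(z, y). (z, f y)) \<circ> (\<lambda>(z, y). (z, g y))) id"
      by (rule homotopic_with_eq[OF homotopic_with_prod_topology[OF idZ fg, of "\<lambda>_. True"]]) auto
  qed
qed

lemma has_chi_prod_homotopy_equivalent:
  "Y homotopy_equivalent_space Y' \<Longrightarrow> has_chi (prod_topology Z Y) c \<Longrightarrow> has_chi (prod_topology Z Y') c"
  by (meson has_chi_homotopy_equivalent homotopy_equivalent_space_prod)

lemma has_chi_prod_contractible: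
  assumes "contractible_space Y" "topspace Y \<noteq> {}" "has_chi Z c"
  shows "has_chi (prod_topology Z Y) c"
proof -
  have "Y \<noteq> trivial_topology" using assms(2) by auto
  then obtain b where b: "b \<in> topspace Y" "Y homotopy_equivalent_space subtopology Y {b}"
    using assms(1) contractible_eq_homotopy_equivalent_singleton_subtopology by metis
  have "has_chi (prod_topology Z (subtopology Y {b})) c"
    using has_chi_homeomorphic[OF homeomorphic_space_prod_topology_sing1[OF b(1)] assms(3)] .
  with b(2) show ?thesis
    by (metis has_chi_prod_homotopy_equivalent homotopy_equivalent_space_sym)
qed

lemma has_chi_prod_Mayer_Vietoris:
  assumes U: "openin Y U" and V: "openin Y V"
    and chi: "has_chi (prod_topology Z (subtopology Y U)) u"
      "has_chi (prod_topology Z (subtopology Y V)) v"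
      "has_chi (prod_topology Z (subtopology Y (U \<inter> V))) w"
  shows "has_chi (prod_topology Z (subtopology Y (U \<union> V))) (u + v - w)"
proof -
  have "has_chi (subtopology (prod_topology Z Y) (topspace Z \<times> U \<union> topspace Z \<times> V)) (u + v - w)"
  proof (rule has_chi_Mayer_Vietoris)
    show "openin (prod_topology Z Y) (topspace Z \<times> U)" "openin (prod_topology Z Y) (topspace Z \<times> V)"
      using U V by (auto simp: openin_prod_Times_iff)
    show "has_chi (subtopology (prod_topology Z Y) (topspace Z \<times> U)) u"
      "has_chi (subtopology (prod_topology Z Y) (topspace Z \<times> V)) v"
      "has_chi (subtopology (prod_topology Z Y) (topspace Z \<times> U \<inter> topspace Z \<times> V)) w"
      using chi by (simp_all add: prod_topology_subtopology(2) Times_Int_Times)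
  qed
  then show ?thesis by (simp add: prod_topology_subtopology(2) Sigma_Un_distrib2)
qed

subsection \<open>Punctured discs\<close>

lemma open_disc_eq: "open_disc n = {x. (\<forall>i\<ge>n. x i = 0) \<and> (\<Sum>i<n. (x i)\<^sup>2) < 1}"
  by (auto simp: open_disc_def disc_space_def topspace_Euclidean_space)

definition punctured_disc :: "nat \<Rightarrow> (nat \<Rightarrow> real) set" where
  "punctured_disc n = {x \<in> open_disc n. \<exists>i<n. x i \<noteq> 0}"

lemma sum_squares_convex_le:
  fixes x a :: "nat \<Rightarrow> real"
  assumes "0 \<le> s" "s \<le> 1"
  shows "(\<Sum>i<n. ((1 - s) * x i + s * a i)\<^sup>2) \<le> (1 - s) * (\<Sum>i<n. (x i)\<^sup>2) + s * (\<Sum>i<n. (a i)\<^sup>2)"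
proof -
  have "((1 - s) * x i + s * a i)\<^sup>2 \<le> (1 - s) * (x i)\<^sup>2 + s * (a i)\<^sup>2" for i
  proof -
    have "0 \<le> s * (1 - s) * (x i - a i)\<^sup>2" using assms by simp
    then show ?thesis by (simp add: power2_eq_square algebra_simps)
  qed
  then have "(\<Sum>i<n. ((1 - s) * x i + s * a i)\<^sup>2) \<le> (\<Sum>i<n. (1 - s) * (x i)\<^sup>2 + s * (a i)\<^sup>2)"
    by (intro sum_mono)
  then show ?thesis by (simp add: sum.distrib sum_distrib_left)
qed

lemma open_disc_convex:
  assumes "x \<in> open_disc n" "a \<in> open_disc n" "0 \<le> s" "s \<le> 1"
  shows "(\<lambda>i. (1 - s) * x i + s * a i) \<in> open_disc n"
proof -
  have "(\<Sum>i<n. ((1 - s) * x i + s * a i)\<^sup>2) \<le> (1 - s) * (\<Sum>i<n. (x i)\<^sup>2) + s * (\<Sum>i<n. (a i)\<^sup>2)"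
    using assms by (intro sum_squares_convex_le)
  also have "\<dots> < 1"
  proof (cases "s = 0")
    case False
    have "(1 - s) * (\<Sum>i<n. (x i)\<^sup>2) \<le> (1 - s) * 1"
      using assms by (intro mult_left_mono) (auto simp: open_disc_eq)
    moreover have "s * (\<Sum>i<n. (a i)\<^sup>2) < s * 1"
      using assms False by (intro mult_strict_left_mono) (auto simp: open_disc_eq)
    ultimately show ?thesis by simp
  qed (use assms in \<open>auto simp: open_disc_eq\<close>)
  finally show ?thesis using assms by (auto simp: open_disc_eq)
qed

lemma continuous_map_coordinate:
  "continuous_map (subtopology (powertop_real UNIV) S) euclideanreal (\<lambda>x. x i)"
  by (intro continuous_map_from_subtopology continuous_map_product_projection) simp

lemma continuous_map_interval_coordinate:
  "continuous_map (cylinder (subtopology (powertop_real UNIV) S)) euclideanreal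
    (\<lambda>z. snd z i)"
  using continuous_map_compose[OF continuous_map_snd continuous_map_coordinate] by (simp add: o_def)

lemma continuous_map_interval_fst:
  "continuous_map (cylinder X) euclideanreal fst"
  by (metis continuous_map_fst continuous_map_in_subtopology)

lemma contractible_star_shaped:
  assumes a: "a \<in> S"
    and star: "\<And>x s. \<lbrakk>x \<in> S; 0 \<le> s; s \<le> 1\<rbrakk> \<Longrightarrow> (\<lambda>i. (1 - s) * x i + s * a i) \<in> S"
  shows "contractible_space (subtopology (powertop_real UNIV) S)"
  unfolding contractible_space_def
proof (intro exI, rule homotopic_withI)
  let ?X = "subtopology (powertop_real UNIV) S"
  let ?h = "\<lambda>z. \<lambda>i. (1 - fst z) * snd z i + fst z * a i"
  show "continuous_map (cylinder ?X) ?X ?h"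
    unfolding continuous_map_in_subtopology continuous_map_componentwise_UNIV
  proof (intro conjI allI)
    show "continuous_map (cylinder ?X) euclideanreal
        (\<lambda>z. (1 - fst z) * snd z i + fst z * a i)" for i
      by (intro continuous_intros continuous_map_interval_fst continuous_map_interval_coordinate)
    show "?h \<in> topspace (cylinder ?X) \<rightarrow> S" using star by auto
  qed
qed auto

lemma has_chi_prod_open_disc:
  assumes "has_chi Z c"
  shows "has_chi (prod_topology Z (subtopology (powertop_real UNIV) (open_disc n))) c"
proof (rule has_chi_prod_contractible[OF _ _ assms])
  have 0: "(\<lambda>_. 0) \<in> open_disc n" by (simp add: open_disc_eq)
  then show "topspace (subtopology (powertop_real UNIV) (open_disc n)) \<noteq> {}" by auto
  show "contractible_space (subtopology (powertop_real UNIV) (open_disc n))"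
    using 0 open_disc_convex by (intro contractible_star_shaped[of "\<lambda>_. 0"])
qed

text \<open>Removing the two closed half axes of the last coordinate, one at a time, covers the punctured
  disc by two star-shaped open sets whose intersection retracts to the punctured disc of one
  dimension less.\<close>

lemma has_chi_prod_punctured_disc:
  assumes Z: "has_chi Z c"
  shows "has_chi (prod_topology Z (subtopology (powertop_real UNIV) (punctured_disc n))) (c * (1 - (-1) ^ n))"
proof (induction n)
  case 0
  have "topspace (prod_topology Z (subtopology (powertop_real UNIV) (punctured_disc 0))) = {}"
    by (auto simp: punctured_disc_def)
  from has_chi_empty[OF this] show ?case by simp
next
  case (Suc n)
  let ?R = "powertop_real UNIV :: (nat \<Rightarrow> real) topology"
  let ?Y = "subtopology ?R (punctured_disc (Suc n))"
  define half where "half e = {x \<in> punctured_disc (Suc n). (\<Sum>i<n. (x i)\<^sup>2) \<in> {0<..} \<or> e * x n \<in> {0<..}}"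
    for e :: real
  have pos_iff: "0 < (\<Sum>i<n. (x i)\<^sup>2) \<longleftrightarrow> (\<exists>i<n. x i \<noteq> 0)" for x :: "nat \<Rightarrow> real"
    by (auto simp: sum_nonneg_eq_0_iff sum_nonneg less_le)
  have opn: "openin ?Y (half e)" for e
  proof -
    have "half e = {x \<in> topspace ?Y. (\<Sum>i<n. (x i)\<^sup>2) \<in> {0<..}} \<union> {x \<in> topspace ?Y. e * x n \<in> {0<..}}"
      by (auto simp: half_def)
    moreover have "openin ?Y {x \<in> topspace ?Y. (\<Sum>i<n. (x i)\<^sup>2) \<in> {0<..}}"
      by (rule openin_continuous_map_preimage[of _ euclideanreal])
        (intro continuous_intros continuous_map_coordinate, auto)
    moreover have "openin ?Y {x \<in> topspace ?Y. e * x n \<in> {0<..}}"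
      by (rule openin_continuous_map_preimage[of _ euclideanreal])
        (intro continuous_intros continuous_map_coordinate, auto)
    ultimately show ?thesis by (simp add: openin_Un)
  qed
  have sub: "subtopology ?Y (half e) = subtopology ?R (half e)" for e
    by (auto simp: subtopology_subtopology half_def intro!: arg_cong[of _ _ "subtopology ?R"])
  have contr: "contractible_space (subtopology ?Y (half e))" "topspace (subtopology ?Y (half e)) \<noteq> {}"
    if e: "e = 1 \<or> e = -1" for e
  proof -
    define a where "a i = (if i = n then e / 2 else 0)" for i
    have sa: "(\<Sum>i<Suc n. (a i)\<^sup>2) = 1/4" using e by (auto simp: a_def power2_eq_square)
    have ao: "a \<in> open_disc (Suc n)" using sa by (simp add: open_disc_eq) (simp add: a_def)
    then have a: "a \<in> half e" using e
      by (auto simp: half_def punctured_disc_def a_def intro!: exI[of _ n])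
    show "topspace (subtopology ?Y (half e)) \<noteq> {}" unfolding sub using a by auto
    show "contractible_space (subtopology ?Y (half e))"
      unfolding sub
    proof (rule contractible_star_shaped[OF a])
      fix x and s :: real assume x: "x \<in> half e" and s: "0 \<le> s" "s \<le> 1"
      let ?y = "\<lambda>i. (1 - s) * x i + s * a i"
      have y1: "?y \<in> open_disc (Suc n)"
        using x s ao by (intro open_disc_convex) (auto simp: half_def punctured_disc_def)
      have ea: "e * a n = 1/2" using e by (auto simp: a_def)
      have y2: "(\<exists>i<n. ?y i \<noteq> 0) \<or> e * ?y n > 0"
      proof (cases "s < 1 \<and> (\<exists>i<n. x i \<noteq> 0)")
        case True
        then show ?thesis by (auto simp: a_def)
      next
        case False
        then have cs: "s = 1 \<or> e * x n > 0"
          using s x pos_iff[of x] by (auto simp: half_def)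
        have "e * ?y n = (1 - s) * (e * x n) + s * (1/2)" using ea by (simp add: algebra_simps)
        also have "\<dots> > 0"
        proof (cases "s = 1")
          case False
          then have "1 - s > 0" "e * x n > 0" using cs s by auto
          then have "(1 - s) * (e * x n) > 0" by (rule mult_pos_pos)
          then show ?thesis using s by (intro add_pos_nonneg) auto
        qed simp
        finally show ?thesis by simp
      qed
      then have "?y \<in> punctured_disc (Suc n)"
        using y1 unfolding punctured_disc_def by (auto intro: less_SucI)
      then show "?y \<in> half e" using y2 pos_iff[of ?y] by (auto simp: half_def)
    qed
  qed
  have int_eq: "half 1 \<inter> half (-1) = {x \<in> punctured_disc (Suc n). \<exists>i<n. x i \<noteq> 0}"
    using pos_iff by (auto simp: half_def)
  have un_eq: "half 1 \<union> half (-1) = punctured_disc (Suc n)"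
  proof
    show "punctured_disc (Suc n) \<subseteq> half 1 \<union> half (-1)"
    proof
      fix x assume x: "x \<in> punctured_disc (Suc n)"
      then obtain i where "i < Suc n" "x i \<noteq> 0" by (auto simp: punctured_disc_def)
      then have "(\<exists>i<n. x i \<noteq> 0) \<or> x n \<noteq> 0" by (metis less_antisym)
      then show "x \<in> half 1 \<union> half (-1)"
        using x pos_iff[of x] by (auto simp: half_def)
    qed
  qed (auto simp: half_def)
  let ?I = "subtopology ?R (half 1 \<inter> half (-1))"
  have sub_int: "subtopology ?Y (half 1 \<inter> half (-1)) = ?I"
    by (auto simp: subtopology_subtopology half_def intro!: arg_cong[of _ _ "subtopology ?R"])
  have pd: "punctured_disc n \<subseteq> half 1 \<inter> half (-1)"
    unfolding int_eq by (auto simp: punctured_disc_def open_disc_eq intro: less_SucI)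
  have "?I homotopy_equivalent_space subtopology ?I (punctured_disc n)"
  proof (rule deformation_retract_homotopy_equivalent)
    let ?h = "\<lambda>(z :: real \<times> (nat \<Rightarrow> real)) i. if i = n then (1 - fst z) * snd z i else snd z i"
    show "continuous_map (cylinder ?I) ?I ?h"
      unfolding continuous_map_in_subtopology continuous_map_componentwise_UNIV
    proof (intro conjI allI)
      show "continuous_map (cylinder ?I) euclideanreal
          (\<lambda>z. if i = n then (1 - fst z) * snd z i else snd z i)" for i
        by (intro continuous_intros continuous_map_interval_fst continuous_map_interval_coordinate)
      show "?h \<in> topspace (cylinder ?I) \<rightarrow> half 1 \<inter> half (-1)"
      proof
        fix z assume "z \<in> topspace (cylinder ?I)"
        moreover obtain s x where z': "z = (s, x)" by (cases z)
        ultimately have "x \<in> half 1 \<inter> half (-1)" and z: "z = (s, x)" "0 \<le> s" "s \<le> 1"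
          by auto
        from this(1) have x: "x \<in> open_disc (Suc n)" "\<exists>i<n. x i \<noteq> 0"
          unfolding int_eq by (auto simp: punctured_disc_def)
        have "((1 - s) * x n)\<^sup>2 \<le> (x n)\<^sup>2"
          using z by (simp add: power_mult_distrib mult_left_le_one_le power_le_one)
        then have "(\<Sum>i<Suc n. (?h z i)\<^sup>2) \<le> (\<Sum>i<Suc n. (x i)\<^sup>2)" by (simp add: z)
        then have "?h z \<in> open_disc (Suc n)" using x by (auto simp: open_disc_eq z)
        moreover have "\<exists>i<n. ?h z i \<noteq> 0" using x by (auto simp: z)
        ultimately show "?h z \<in> half 1 \<inter> half (-1)"
          unfolding int_eq punctured_disc_def by (auto intro: less_SucI)
      qed
    qed
    show "punctured_disc n \<subseteq> topspace ?I" using pd by simp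
    show "?h (0, x) = x" for x by (rule ext) simp
    show "?h (1, x) \<in> punctured_disc n" if "x \<in> topspace ?I" for x
    proof -
      have x: "\<forall>i\<ge>Suc n. x i = 0" "(\<Sum>i<n. (x i)\<^sup>2) + (x n)\<^sup>2 < 1" "\<exists>i<n. x i \<noteq> 0"
        using that unfolding int_eq punctured_disc_def open_disc_eq by auto
      then have "(\<Sum>i<n. (x i)\<^sup>2) < 1" using zero_le_power2[of "x n"] by linarith
      then show ?thesis using x by (auto simp: punctured_disc_def open_disc_eq Suc_le_eq le_neq_implies_less)
    qed
    show "?h (1, x) = x" if "x \<in> punctured_disc n" for x
      using that by (auto simp: punctured_disc_def open_disc_eq)
  qed
  moreover have "subtopology ?I (punctured_disc n) = subtopology ?R (punctured_disc n)"
    using pd by (simp add: subtopology_subtopology Int_absorb1)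
  ultimately have "?I homotopy_equivalent_space subtopology ?R (punctured_disc n)" by simp
  then have int: "has_chi (prod_topology Z (subtopology ?Y (half 1 \<inter> half (-1)))) (c * (1 - (-1) ^ n))"
    unfolding sub_int
    using has_chi_prod_homotopy_equivalent Suc.IH homotopy_equivalent_space_sym by blast
  have "has_chi (prod_topology Z (subtopology ?Y (half 1 \<union> half (-1)))) (c + c - c * (1 - (-1) ^ n))"
    using has_chi_prod_contractible[OF contr Z] int by (intro has_chi_prod_Mayer_Vietoris opn) auto
  then show ?case
    unfolding un_eq by (simp add: subtopology_subtopology algebra_simps)
qed

subsection \<open>Induction over the cells\<close>

lemma topspace_disc_space: "topspace (disc_space n) = {x. (\<forall>i\<ge>n. x i = 0) \<and> (\<Sum>i<n. (x i)\<^sup>2) \<le> 1}"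
  by (auto simp: disc_space_def topspace_Euclidean_space)

lemma disc_space_eq: "disc_space n = subtopology (powertop_real UNIV) (topspace (disc_space n))"
  unfolding topspace_disc_space
  by (simp add: disc_space_def Euclidean_space_def subtopology_subtopology Collect_conj_eq)

lemma topspace_disc_space_Un: "topspace (disc_space n) = open_disc n \<union> disc_boundary n"
  by (auto simp: open_disc_def disc_boundary_def disc_space_def)

lemma compact_disc_space: "compact_space (disc_space n)"
proof -
  let ?R = "powertop_real UNIV :: (nat \<Rightarrow> real) topology"
  let ?D = "topspace (disc_space n)"
  have cube: "?D \<subseteq> PiE UNIV (\<lambda>_. {-1..1})"
  proof
    fix x assume x: "x \<in> ?D"
    have "\<bar>x i\<bar> \<le> 1" for i
    proof (cases "i < n")
      case True
      then have "(x i)\<^sup>2 \<le> (\<Sum>i<n. (x i)\<^sup>2)" by (intro member_le_sum) auto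
      also have "\<dots> \<le> 1" using x by (simp add: topspace_disc_space)
      finally show ?thesis by (simp add: abs_square_le_1)
    qed (use x in \<open>simp add: topspace_disc_space\<close>)
    then show "x \<in> PiE UNIV (\<lambda>_. {-1..1})" by (auto simp: abs_le_iff minus_le_iff)
  qed
  have "closedin ?R ?D"
  proof -
    have "?D = {x \<in> topspace ?R. (\<Sum>i<n. (x i)\<^sup>2) \<in> {..1}} \<inter> (\<Inter>i\<in>{n..}. {x \<in> topspace ?R. x i \<in> {0}})"
      by (auto simp: topspace_disc_space)
    moreover have "closedin ?R {x \<in> topspace ?R. (\<Sum>i<n. (x i)\<^sup>2) \<in> {..1}}"
      by (rule closedin_continuous_map_preimage[of _ euclideanreal])
        (intro continuous_intros, auto)
    moreover have "closedin ?R {x \<in> topspace ?R. x i \<in> {0}}" for i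
      by (rule closedin_continuous_map_preimage[of _ euclideanreal]) (intro continuous_intros, auto)
    ultimately show ?thesis by (auto intro!: closedin_Int closedin_INT)
  qed
  moreover have "compactin ?R (PiE UNIV (\<lambda>_. {-1..1}))"
    by (simp add: compactin_PiE)
  ultimately have "compactin ?R ?D"
    using cube by (rule closed_compactin[rotated 2])
  then show ?thesis by (metis compactin_subspace disc_space_eq)
qed

text \<open>The cells are indexed by an arbitrary finite set, which allows cells to be removed.\<close>

definition CW_structure ::
  "'a topology \<Rightarrow> 'i set \<Rightarrow> ('i \<Rightarrow> nat) \<Rightarrow> ('i \<Rightarrow> (nat \<Rightarrow> real) \<Rightarrow> 'a) \<Rightarrow> bool" where
  "CW_structure Y I d \<Phi> \<longleftrightarrow> Hausdorff_space Y \<and> finite I \<and>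
    (\<forall>i\<in>I. continuous_map (disc_space (d i)) Y (\<Phi> i) \<and> inj_on (\<Phi> i) (open_disc (d i))) \<and>
    disjoint_family_on (\<lambda>i. \<Phi> i ` open_disc (d i)) I \<and>
    (\<Union>i\<in>I. \<Phi> i ` open_disc (d i)) = topspace Y \<and>
    (\<forall>i\<in>I. \<Phi> i ` disc_boundary (d i) \<subseteq> (\<Union>j\<in>{j \<in> I. d j < d i}. \<Phi> j ` open_disc (d j)))"

lemma finite_CW_complex_iff_structure:
  "finite_CW_complex Y \<longleftrightarrow> (\<exists>(k::nat) d \<Phi>. CW_structure Y {..<k} d \<Phi>)"
  by (simp add: finite_CW_complex_def CW_structure_def Ball_def lessThan_def)

definition disc_norm :: "nat \<Rightarrow> (nat \<Rightarrow> real) \<Rightarrow> real" where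
  "disc_norm n v = sqrt (\<Sum>i<n. (v i)\<^sup>2)"

text \<open>The radial homotopy from the identity of the punctured disc to the retraction onto the
  boundary sphere.\<close>

definition radial :: "nat \<Rightarrow> real \<Rightarrow> (nat \<Rightarrow> real) \<Rightarrow> (nat \<Rightarrow> real)" where
  "radial n s v = (\<lambda>i. ((1 - s) + s / disc_norm n v) * v i)"

lemma disc_norm_pos_iff: "v \<in> topspace (disc_space n) \<Longrightarrow> 0 < disc_norm n v \<longleftrightarrow> v \<noteq> (\<lambda>_. 0)"
proof -
  assume v: "v \<in> topspace (disc_space n)"
  have "0 < disc_norm n v \<longleftrightarrow> (\<exists>i<n. v i \<noteq> 0)"
    by (auto simp: disc_norm_def sum_nonneg_eq_0_iff sum_nonneg less_le)
  also have "\<dots> \<longleftrightarrow> v \<noteq> (\<lambda>_. 0)" using v by (auto simp: topspace_disc_space fun_eq_iff) (meson not_le)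
  finally show ?thesis .
qed

lemma disc_norm_boundary: "v \<in> disc_boundary n \<Longrightarrow> disc_norm n v = 1"
  by (simp add: disc_boundary_def disc_norm_def)

lemma disc_norm_le_1: "v \<in> topspace (disc_space n) \<Longrightarrow> disc_norm n v \<le> 1"
  by (simp add: topspace_disc_space disc_norm_def)

lemma disc_norm_radial:
  assumes "0 \<le> s" "s \<le> 1" "0 < disc_norm n v"
  shows "disc_norm n (radial n s v) = (1 - s) * disc_norm n v + s"
proof -
  have c: "0 \<le> (1 - s) + s / disc_norm n v" using assms by simp
  have "disc_norm n (radial n s v) = ((1 - s) + s / disc_norm n v) * disc_norm n v"
    using c by (simp add: disc_norm_def radial_def power_mult_distrib sum_distrib_left[symmetric] real_sqrt_mult)
  also have "\<dots> = (1 - s) * disc_norm n v + s" using assms by (simp add: field_simps)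
  finally show ?thesis .
qed

lemma radial_in_disc:
  assumes "0 \<le> s" "s \<le> 1" "v \<in> topspace (disc_space n)" "v \<noteq> (\<lambda>_. 0)"
  shows "radial n s v \<in> topspace (disc_space n)" "radial n s v \<noteq> (\<lambda>_. 0)"
    "s = 1 \<Longrightarrow> radial n s v \<in> disc_boundary n"
proof -
  have p: "0 < disc_norm n v" "disc_norm n v \<le> 1"
    using assms disc_norm_pos_iff disc_norm_le_1 by auto
  note eq = disc_norm_radial[OF assms(1,2) p(1)]
  have "(1 - s) * disc_norm n v \<le> (1 - s) * 1" using assms p by (intro mult_left_mono) auto
  then have "disc_norm n (radial n s v) \<le> 1" using eq by simp
  moreover have "\<forall>i\<ge>n. radial n s v i = 0" using assms by (auto simp: radial_def topspace_disc_space)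
  ultimately show top: "radial n s v \<in> topspace (disc_space n)"
    by (auto simp: topspace_disc_space disc_norm_def)
  have "0 < (1 - s) * disc_norm n v + s"
    using assms p by (cases "s = 0") (auto intro: add_nonneg_pos)
  then show "radial n s v \<noteq> (\<lambda>_. 0)" using eq disc_norm_pos_iff[OF top] by simp
  show "radial n s v \<in> disc_boundary n" if "s = 1"
    using eq that top by (simp add: disc_boundary_def disc_norm_def)
qed

lemma radial_0 [simp]: "radial n 0 v = v"
  by (simp add: radial_def)

lemma radial_boundary: "v \<in> disc_boundary n \<Longrightarrow> radial n s v = v"
  by (simp add: radial_def disc_norm_boundary)

lemma continuous_map_radial:
  fixes n :: nat
  defines "P \<equiv> subtopology (disc_space n) (- {\<lambda>_. 0})"
  shows "continuous_map (cylinder P) P (\<lambda>(s, v). radial n s v)"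
proof -
  define S where "S = topspace (disc_space n) - {\<lambda>_. 0}"
  have P: "P = subtopology (powertop_real UNIV) S"
    unfolding P_def S_def by (subst disc_space_eq) (simp add: subtopology_subtopology Diff_eq)
  let ?X = "cylinder (subtopology (powertop_real UNIV) S)"
  have "continuous_map ?X euclideanreal (\<lambda>z. disc_norm n (snd z))"
    unfolding disc_norm_def
    by (intro continuous_intros continuous_map_interval_coordinate
        continuous_map_compose[OF _ continuous_map_sqrt, unfolded o_def]) auto
  then have "continuous_map ?X euclideanreal
      (\<lambda>z. ((1 - fst z) + fst z / disc_norm n (snd z)) * snd z i)" for i
    using disc_norm_pos_iff[of _ n]
    by (intro continuous_intros continuous_map_interval_fst continuous_map_interval_coordinate)
      (force simp: S_def)+
  moreover have "radial n s v \<in> S" if "0 \<le> s" "s \<le> 1" "v \<in> S" for s v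
    using that radial_in_disc[of s v n] by (auto simp: S_def)
  ultimately show ?thesis
    unfolding P continuous_map_in_subtopology continuous_map_componentwise_UNIV
    by (auto simp: radial_def case_prod_unfold)
qed

text \<open>No boundary of a cell meets a cell of maximal dimension. So the remaining cells form a closed set,
  and the radial retraction of the punctured disc onto its boundary extends by the identity there.\<close>

lemma CW_structure_remove_cell:
  assumes CW: "CW_structure Y I d \<Phi>" and i: "i \<in> I" and max: "\<And>j. j \<in> I \<Longrightarrow> d j \<le> d i"
  obtains C where "CW_structure (subtopology Y C) (I - {i}) d \<Phi>"
    and "openin Y (\<Phi> i ` open_disc (d i))" and "openin Y (topspace Y - {\<Phi> i (\<lambda>_. 0)})"
    and "subtopology (powertop_real UNIV) (open_disc (d i))
        homeomorphic_space subtopology Y (\<Phi> i ` open_disc (d i))"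
    and "subtopology (powertop_real UNIV) (punctured_disc (d i))
        homeomorphic_space subtopology Y (\<Phi> i ` open_disc (d i) - {\<Phi> i (\<lambda>_. 0)})"
    and "subtopology Y (topspace Y - {\<Phi> i (\<lambda>_. 0)}) homotopy_equivalent_space subtopology Y C"
    and "\<Phi> i (\<lambda>_. 0) \<in> \<Phi> i ` open_disc (d i)" and "\<Phi> i ` open_disc (d i) \<subseteq> topspace Y"
proof -
  let ?n = "d i" and ?F = "\<Phi> i"
  let ?cell = "\<lambda>j. \<Phi> j ` open_disc (d j)"
  define J where "J = I - {i}"
  define C where "C = (\<Union>j\<in>J. ?cell j)"
  define V where "V = topspace Y - {?F (\<lambda>_. 0)}"
  have H: "Hausdorff_space Y" and fin: "finite I"
    and cont: "\<And>j. j \<in> I \<Longrightarrow> continuous_map (disc_space (d j)) Y (\<Phi> j)"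
    and inj: "\<And>j. j \<in> I \<Longrightarrow> inj_on (\<Phi> j) (open_disc (d j))"
    and disj: "disjoint_family_on ?cell I" and un: "(\<Union>j\<in>I. ?cell j) = topspace Y"
    and bd: "\<And>j. j \<in> I \<Longrightarrow> \<Phi> j ` disc_boundary (d j) \<subseteq> (\<Union>l\<in>{l \<in> I. d l < d j}. ?cell l)"
    using CW by (auto simp: CW_structure_def)
  have kc: "kc_space Y" using H by (rule Hausdorff_imp_kc_space)
  have bdC: "\<Phi> j ` disc_boundary (d j) \<subseteq> C" if "j \<in> I" for j
    using bd[OF that] max[OF that] by (fastforce simp: C_def J_def)
  have C_disc: "C = (\<Union>j\<in>J. \<Phi> j ` topspace (disc_space (d j)))"
    using bdC by (auto simp: C_def J_def topspace_disc_space_Un)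
  have Csub: "C \<subseteq> topspace Y" using un by (auto simp: C_def J_def)
  have closed_disc_map: "closed_map (disc_space (d j)) Y (\<Phi> j)" if "j \<in> I" for j
    using that cont kc compact_disc_space by (intro continuous_imp_closed_map_gen)
  have closedC: "closedin Y C"
    unfolding C_disc using fin closed_disc_map
    by (intro closedin_Union) (auto simp: J_def closed_map_def)
  have cellC: "?cell i \<inter> C = {}"
    using disj i by (fastforce simp: C_def J_def disjoint_family_on_def)
  have cell_eq: "?cell i = topspace Y - C"
  proof -
    have "?cell i \<union> C = topspace Y" unfolding un[symmetric] C_def J_def using i by blast
    then show ?thesis using cellC by blast
  qed
  have open_cell: "openin Y (?cell i)" unfolding cell_eq using closedC by blast
  have 0: "(\<lambda>_. 0) \<in> open_disc ?n" by (simp add: open_disc_eq)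
  have F0: "?F (\<lambda>_. 0) \<in> ?cell i" using 0 by blast
  have cell_sub: "?cell i \<subseteq> topspace Y" using un i by blast
  have "closedin Y {?F (\<lambda>_. 0)}"
    using F0 cell_sub H by (metis closedin_t1_singleton Hausdorff_imp_t1_space subsetD)
  then have openV: "openin Y V" unfolding V_def by blast
  have disc_sub: "open_disc ?n \<subseteq> topspace (disc_space ?n)" by (simp add: topspace_disc_space_Un)
  \<comment> \<open>A point of the open cell has one preimage in the closed disc: the boundary goes to other cells.\<close>
  have F_eqD: "v = w" if "?F v = ?F w" "v \<in> open_disc ?n" "w \<in> topspace (disc_space ?n)" for v w
  proof (cases "w \<in> open_disc ?n")
    case True
    then show ?thesis using inj[OF i] that by (auto dest: inj_onD)
  next
    case False
    then have "w \<in> disc_boundary ?n" using that by (auto simp: topspace_disc_space_Un)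
    then have "?F w \<in> C" using bdC[OF i] by blast
    moreover have "?F v \<in> ?cell i" using that by blast
    ultimately show ?thesis using cellC that by auto
  qed
  have pre_cell: "{v \<in> topspace (disc_space ?n). ?F v \<in> ?F ` T} = T" if T: "T \<subseteq> open_disc ?n" for T
  proof
    show "{v \<in> topspace (disc_space ?n). ?F v \<in> ?F ` T} \<subseteq> T"
    proof
      fix v assume "v \<in> {v \<in> topspace (disc_space ?n). ?F v \<in> ?F ` T}"
      then obtain w where "w \<in> T" "?F w = ?F v" "v \<in> topspace (disc_space ?n)" by auto
      then have "w = v" using F_eqD[of w v] T by blast
      then show "v \<in> T" using \<open>w \<in> T\<close> by simp
    qed
  qed (use T disc_sub in blast)
  have cell_homeo: "subtopology (powertop_real UNIV) T homeomorphic_space subtopology Y (?F ` T)"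
    if T: "T \<subseteq> open_disc ?n" for T
  proof -
    have sT: "subtopology (disc_space ?n) T = subtopology (powertop_real UNIV) T"
      using T disc_sub by (subst disc_space_eq) (simp add: subtopology_subtopology Int_absorb1)
    have "homeomorphic_map (subtopology (disc_space ?n) T) (subtopology Y (?F ` T)) ?F"
    proof (rule bijective_closed_imp_homeomorphic_map)
      show "closed_map (subtopology (disc_space ?n) T) (subtopology Y (?F ` T)) ?F"
        using closed_disc_map[OF i] pre_cell[OF T] by (rule closed_map_restriction)
      show "continuous_map (subtopology (disc_space ?n) T) (subtopology Y (?F ` T)) ?F"
        using cont[OF i] by (auto simp: continuous_map_in_subtopology continuous_map_from_subtopology)
      show "?F ` topspace (subtopology (disc_space ?n) T) = topspace (subtopology Y (?F ` T))"
        using T disc_sub cell_sub by auto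
      show "inj_on ?F (topspace (subtopology (disc_space ?n) T))"
        using inj[OF i] T by (auto intro: inj_on_subset)
    qed
    then show ?thesis unfolding sT by (rule homeomorphic_map_imp_homeomorphic_space)
  qed
  have punct: "punctured_disc ?n = open_disc ?n - {\<lambda>_. 0}"
    by (auto simp: punctured_disc_def open_disc_eq fun_eq_iff) (meson not_le)
  have F_punct: "?F ` punctured_disc ?n = ?cell i - {?F (\<lambda>_. 0)}"
    unfolding punct using inj[OF i] 0 by (auto dest: inj_onD)

  \<comment> \<open>The complement of the centre is glued from the remaining cells and the punctured closed disc.\<close>
  let ?P = "subtopology (disc_space ?n) (- {\<lambda>_. 0})"
  let ?D = "topspace (disc_space ?n) - {\<lambda>_. 0}"
  let ?Y = "subtopology Y V"
  let ?K = "?F ` ?D"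
  have topP: "topspace ?P = ?D" by auto
  have CV: "C \<subseteq> V" using Csub cellC F0 by (auto simp: V_def)
  have preV: "{v \<in> topspace (disc_space ?n). ?F v \<in> V} = - {\<lambda>_. 0} \<inter> topspace (disc_space ?n)"
  proof -
    have "?F v \<in> V \<longleftrightarrow> v \<noteq> (\<lambda>_. 0)" if v: "v \<in> topspace (disc_space ?n)" for v
    proof -
      have "?F v \<in> topspace Y" using continuous_map_image_subset_topspace[OF cont[OF i]] v by blast
      then show ?thesis using F_eqD[OF _ 0 v] unfolding V_def by auto
    qed
    then show ?thesis by blast
  qed
  have KV: "?K \<subseteq> V" using preV by auto
  have closedK: "closed_map ?P ?Y ?F"
  proof -
    have "closed_map (subtopology (disc_space ?n) (- {\<lambda>_. 0} \<inter> topspace (disc_space ?n))) ?Y ?F"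
      using closed_disc_map[OF i] preV by (rule closed_map_restriction)
    moreover have "subtopology (disc_space ?n) (- {\<lambda>_. 0} \<inter> topspace (disc_space ?n)) = ?P"
      by (metis Int_commute subtopology_restrict)
    ultimately show ?thesis by simp
  qed
  have contK: "continuous_map ?P ?Y ?F"
    using cont[OF i] KV by (auto simp: continuous_map_in_subtopology continuous_map_from_subtopology)
  have clK: "closedin ?Y ?K"
    using closedK unfolding closed_map_def by (metis closedin_topspace topP)
  have clC: "closedin ?Y C" using closedC CV by (metis closedin_subset_topspace)
  have VCK: "V = C \<union> ?K"
  proof
    show "V \<subseteq> C \<union> ?K"
    proof
      fix y assume y: "y \<in> V"
      show "y \<in> C \<union> ?K"
      proof (cases "y \<in> C")
        case False
        then obtain v where "v \<in> open_disc ?n" "y = ?F v" using y cell_eq by (auto simp: V_def)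
        moreover from this have "v \<noteq> (\<lambda>_. 0)" using y by (auto simp: V_def)
        ultimately show ?thesis using disc_sub by auto
      qed simp
    qed
  qed (use CV KV in auto)
  have quot: "quotient_map ?P (subtopology ?Y ?K) ?F"
  proof (rule continuous_closed_imp_quotient_map)
    show "continuous_map ?P (subtopology ?Y ?K) ?F"
      by (rule continuous_map_into_subtopology[OF contK]) (simp only: topP, blast)
    show "closed_map ?P (subtopology ?Y ?K) ?F"
      by (rule closed_map_into_subtopology[OF closedK]) (simp only: topP, blast)
    show "?F ` topspace ?P = topspace (subtopology ?Y ?K)"
      unfolding topP using KV openin_subset[OF openV] by auto
  qed
  have quotI: "quotient_map (cylinder ?P) (cylinder (subtopology ?Y ?K))
      (\<lambda>(s, v). (s, ?F v))"
  proof (rule quotient_map_prod_right[OF _ _ quot])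
    show "locally_compact_space unit_interval"
      by (simp add: compact_imp_locally_compact_space compact_space_subtopology)
    show "Hausdorff_space unit_interval \<or> regular_space unit_interval"
      by (simp add: Hausdorff_space_subtopology)
  qed
  have contR: "continuous_map (cylinder ?P) ?Y (?F \<circ> (\<lambda>(s, v). radial ?n s v))"
    using continuous_map_compose[OF continuous_map_radial contK] .
  obtain G where G: "continuous_map (cylinder (subtopology ?Y ?K)) ?Y G"
    and GF: "\<And>s v. 0 \<le> s \<Longrightarrow> s \<le> 1 \<Longrightarrow> v \<in> ?D \<Longrightarrow> G (s, ?F v) = ?F (radial ?n s v)"
  proof -
    have compat: "?F (radial ?n s v) = ?F (radial ?n s w)" if "v \<in> ?D" "w \<in> ?D" "?F v = ?F w" for s v w
    proof (cases "v \<in> open_disc ?n \<or> w \<in> open_disc ?n")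
      case True
      then have "v = w" using F_eqD that by (metis DiffD1)
      then show ?thesis by simp
    next
      case False
      then have "v \<in> disc_boundary ?n" "w \<in> disc_boundary ?n"
        using that by (auto simp: topspace_disc_space_Un)
      then show ?thesis using that by (simp add: radial_boundary)
    qed
    show thesis
    proof (rule quotient_map_lift_exists[OF quotI contR])
      show "(?F \<circ> (\<lambda>(s, v). radial ?n s v)) x = (?F \<circ> (\<lambda>(s, v). radial ?n s v)) y"
        if "x \<in> topspace (cylinder ?P)" "y \<in> topspace (cylinder ?P)"
          "(\<lambda>(s, v). (s, ?F v)) x = (\<lambda>(s, v). (s, ?F v)) y" for x y
        using that compat by (auto simp: topP)
    next
      fix g assume g: "continuous_map (cylinder (subtopology ?Y ?K)) ?Y g"
        "\<And>x. x \<in> topspace (cylinder ?P) \<Longrightarrow>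
          g ((\<lambda>(s, v). (s, ?F v)) x) = (?F \<circ> (\<lambda>(s, v). radial ?n s v)) x"
      show thesis
      proof (rule that[OF g(1)])
        show "g (s, ?F v) = ?F (radial ?n s v)" if "0 \<le> s" "s \<le> 1" "v \<in> ?D" for s v
          using g(2)[of "(s, v)"] that by simp
      qed
    qed
  qed
  \<comment> \<open>On the boundary of the disc the radial homotopy is constant, so it extends by the identity on \<open>C\<close>.\<close>
  define h where "h = (\<lambda>z. if snd z \<in> C then snd z else G z)"
  have F_bd: "v \<in> disc_boundary ?n" if "v \<in> ?D" "?F v \<in> C" for v
    using that cellC by (auto simp: topspace_disc_space_Un)
  have G_C: "G (s, y) = y" if "0 \<le> s" "s \<le> 1" "y \<in> C" "y \<in> ?K" for s y
  proof -
    obtain v where v: "v \<in> ?D" "y = ?F v" using \<open>y \<in> ?K\<close> by blast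
    then show ?thesis using GF[of s v] that radial_boundary[OF F_bd[of v]] by simp
  qed
  have conth: "continuous_map (cylinder ?Y) ?Y h"
  proof (rule pasting_lemma_closed[of "{True, False}" _ "\<lambda>b. {0..1} \<times> (if b then C else ?K)" _
      "\<lambda>b. if b then snd else G"])
    show "closedin (cylinder ?Y) ({0..1} \<times> (if b then C else ?K))" for b
      using clC clK closedin_topspace[of unit_interval] by (auto simp: closedin_prod_Times_iff)
    show "continuous_map (subtopology (cylinder ?Y) ({0..1} \<times> (if b then C else ?K))) ?Y
        (if b then snd else G)" for b
    proof (cases b)
      case True
      then show ?thesis by (simp add: continuous_map_subtopology_snd)
    next
      case False
      have "subtopology (cylinder ?Y) ({0..1} \<times> ?K)
          = cylinder (subtopology ?Y ?K)"
        by (simp add: subtopology_Times subtopology_subtopology)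
      then show ?thesis using False G by simp
    qed
    show "(if b then snd else G) x = (if b' then snd else G) x"
      if "x \<in> topspace (cylinder ?Y) \<inter> ({0..1} \<times> (if b then C else ?K)) \<inter>
          ({0..1} \<times> (if b' then C else ?K))" for b b' x
      using that G_C by (cases b; cases b'; cases x) auto
    show "\<exists>b. b \<in> {True, False} \<and> x \<in> {0..1} \<times> (if b then C else ?K) \<and> h x = (if b then snd else G) x"
      if "x \<in> topspace (cylinder ?Y)" for x
    proof (cases "snd x \<in> C")
      case True
      then show ?thesis using that by (intro exI[of _ True]) (auto simp: h_def)
    next
      case False
      then have "snd x \<in> ?K" using that VCK by auto
      then show ?thesis using that False by (intro exI[of _ False]) (cases x, auto simp: h_def)
    qed
  qed simp
  have "?Y homotopy_equivalent_space subtopology ?Y C"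
  proof (rule deformation_retract_homotopy_equivalent[OF conth])
    show "C \<subseteq> topspace ?Y" using CV openV by (simp add: openin_subset Int_absorb1 Csub)
    fix y assume y: "y \<in> topspace ?Y"
    show "h (0, y) = y"
    proof (cases "y \<in> C")
      case False
      then obtain v where v: "v \<in> ?D" "y = ?F v" using y VCK by auto
      then show ?thesis using False GF[of 0 v] by (simp add: h_def)
    qed (simp add: h_def)
    show "h (1, y) \<in> C"
    proof (cases "y \<in> C")
      case False
      then obtain v where v: "v \<in> ?D" "y = ?F v" using y VCK by auto
      then show ?thesis
        using False GF[of 1 v] radial_in_disc(3)[of 1 v ?n] bdC[OF i] by (auto simp: h_def)
    qed (simp add: h_def)
  qed (simp add: h_def)
  moreover have "subtopology ?Y C = subtopology Y C"
    using CV by (simp add: subtopology_subtopology Int_absorb1)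
  ultimately have retr: "?Y homotopy_equivalent_space subtopology Y C" by simp

  have "CW_structure (subtopology Y C) J d \<Phi>"
    unfolding CW_structure_def
  proof (intro conjI ballI)
    show "Hausdorff_space (subtopology Y C)" using H by (rule Hausdorff_space_subtopology)
    show "finite J" using fin by (simp add: J_def)
    show "disjoint_family_on ?cell J"
      using disj by (rule disjoint_family_on_mono[rotated]) (auto simp: J_def)
    show "(\<Union>j\<in>J. ?cell j) = topspace (subtopology Y C)" using Csub by (auto simp: C_def)
    fix j assume j: "j \<in> J"
    then have jI: "j \<in> I" by (simp add: J_def)
    show "continuous_map (disc_space (d j)) (subtopology Y C) (\<Phi> j)"
      using cont[OF jI] j C_disc by (auto simp: continuous_map_in_subtopology)
    show "inj_on (\<Phi> j) (open_disc (d j))" by (rule inj[OF jI])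
    show "\<Phi> j ` disc_boundary (d j) \<subseteq> (\<Union>l\<in>{l \<in> J. d l < d j}. ?cell l)"
      using bd[OF jI] max[OF jI] by (fastforce simp: J_def)
  qed
  then show thesis
    using that open_cell openV cell_homeo[of "open_disc ?n"] cell_homeo[of "punctured_disc ?n"]
      retr F0 cell_sub F_punct punct
    unfolding J_def V_def by auto
qed

text \<open>The top cell \<open>e\<close> and the complement \<open>V\<close> of its centre contribute \<open>\<chi>(Z)\<close> and, by induction, the sum over
  the other cells. Their intersection is a punctured disc, so that the cell accounts for \<open>(-1)\<^sup>d \<chi>(Z)\<close>.\<close>

lemma has_chi_prod_CW_structure:
  assumes "CW_structure Y I d \<Phi>" and Z: "has_chi Z c"
  shows "has_chi (prod_topology Z Y) (c * (\<Sum>i\<in>I. (-1) ^ d i))"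
  using assms(1)
proof (induction "card I" arbitrary: I Y)
  case 0
  then have "I = {}" by (simp add: CW_structure_def)
  then have "topspace (prod_topology Z Y) = {}" using 0 by (simp add: CW_structure_def)
  from has_chi_empty[OF this] show ?case using \<open>I = {}\<close> by simp
next
  case (Suc m)
  have fin: "finite I" using Suc.prems by (simp add: CW_structure_def)
  have "I \<noteq> {}" using Suc.hyps(2) by auto
  then have "Max (d ` I) \<in> d ` I" using fin by (intro Max_in) auto
  then obtain i where i0: "i \<in> I" "d i = Max (d ` I)" by auto
  have i: "i \<in> I" "\<And>j. j \<in> I \<Longrightarrow> d j \<le> d i" using i0 fin by auto
  let ?e = "\<Phi> i ` open_disc (d i)" and ?V = "topspace Y - {\<Phi> i (\<lambda>_. 0)}"
  obtain C where CW: "CW_structure (subtopology Y C) (I - {i}) d \<Phi>"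
    and op: "openin Y ?e" "openin Y ?V"
    and he: "subtopology (powertop_real UNIV) (open_disc (d i)) homeomorphic_space subtopology Y ?e"
    and hp: "subtopology (powertop_real UNIV) (punctured_disc (d i))
        homeomorphic_space subtopology Y (?e - {\<Phi> i (\<lambda>_. 0)})"
    and hV: "subtopology Y ?V homotopy_equivalent_space subtopology Y C"
    and F0: "\<Phi> i (\<lambda>_. 0) \<in> ?e" and sub: "?e \<subseteq> topspace Y"
    using CW_structure_remove_cell[OF Suc.prems i] .
  let ?s = "\<Sum>j\<in>I - {i}. (-1) ^ d j :: int"
  have "m = card (I - {i})" using Suc.hyps(2) i fin by simp
  from Suc.hyps(1)[OF this CW] have "has_chi (prod_topology Z (subtopology Y C)) (c * ?s)" .
  then have chiV: "has_chi (prod_topology Z (subtopology Y ?V)) (c * ?s)"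
    using has_chi_prod_homotopy_equivalent hV homotopy_equivalent_space_sym by blast
  have chie: "has_chi (prod_topology Z (subtopology Y ?e)) c"
    using has_chi_prod_homotopy_equivalent[OF homeomorphic_imp_homotopy_equivalent_space[OF he]
        has_chi_prod_open_disc[OF Z]] .
  have "?e \<inter> ?V = ?e - {\<Phi> i (\<lambda>_. 0)}" using sub by auto
  then have chip: "has_chi (prod_topology Z (subtopology Y (?e \<inter> ?V))) (c * (1 - (-1) ^ d i))"
    using has_chi_prod_homotopy_equivalent[OF homeomorphic_imp_homotopy_equivalent_space[OF hp]
        has_chi_prod_punctured_disc[OF Z]] by simp
  have "?e \<union> ?V = topspace Y" using F0 sub by auto
  moreover have "(\<Sum>j\<in>I. (-1) ^ d j) = (-1) ^ d i + ?s" using fin i by (simp add: sum.remove)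
  ultimately show ?case
    using has_chi_prod_Mayer_Vietoris[OF op chie chiV chip] by (simp add: algebra_simps)
qed

text \<open>If \<open>Z\<close> is a point, the signed count of the cells is \<open>\<chi>(Y)\<close>; for every other \<open>Z\<close> the factor is the same.\<close>

theorem has_chi_prod_CW:
  assumes "finite_CW_homotopy_type Y" and Z: "has_chi Z c"
  obtains y where "has_chi Y y" "has_chi (prod_topology Z Y) (c * y)"
proof -
  obtain W :: "(nat \<Rightarrow> real) topology" where "finite_CW_complex W" and YW: "Y homotopy_equivalent_space W"
    using assms(1) by (auto simp: finite_CW_homotopy_type_def)
  then obtain k d \<Phi> where CW: "CW_structure W {..<k::nat} d \<Phi>"
    by (auto simp: finite_CW_complex_iff_structure)
  let ?y = "\<Sum>i<k. (-1) ^ d i :: int"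
  let ?pt = "discrete_topology {()}"
  have "has_chi (prod_topology ?pt W) (1 * ?y)"
    using has_chi_prod_CW_structure[OF CW has_chi_singleton[of ?pt "()"]] by simp
  then have "has_chi W ?y"
    using has_chi_homeomorphic[OF prod_topology_homeomorphic_space_right[of ?pt "()" W]] by simp
  then have "has_chi Y ?y"
    using YW has_chi_homotopy_equivalent homotopy_equivalent_space_sym by blast
  moreover have "has_chi (prod_topology Z Y) (c * ?y)"
    using has_chi_prod_CW_structure[OF CW Z] YW has_chi_prod_homotopy_equivalent
      homotopy_equivalent_space_sym by blast
  ultimately show thesis by (rule that)
qed

lemma product_topology_Suc_homeomorphic:
  "prod_topology (product_topology X {..<n}) (X n) homeomorphic_space product_topology X {..<Suc n}"
  unfolding homeomorphic_space_def homeomorphic_maps_def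
proof (intro exI conjI ballI)
  let ?A = "prod_topology (product_topology X {..<n}) (X n)"
  let ?B = "product_topology X {..<Suc n}"
  let ?f = "\<lambda>p. (fst p)(n := snd p)"
  let ?g = "\<lambda>f. (restrict f {..<n}, f n)"
  show "continuous_map ?A ?B ?f"
    unfolding continuous_map_componentwise
  proof (intro conjI ballI)
    show "?f ` topspace ?A \<subseteq> extensional {..<Suc n}"
      by (auto simp: extensional_def PiE_def)
    fix j assume "j \<in> {..<Suc n}"
    show "continuous_map ?A (X j) (\<lambda>p. ?f p j)"
    proof (cases "j = n")
      case True
      then show ?thesis by (simp add: continuous_map_snd)
    next
      case False
      then have "j \<in> {..<n}" using \<open>j \<in> {..<Suc n}\<close> by simp
      then show ?thesis
        using False continuous_map_compose[OF continuous_map_fst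
            continuous_map_product_projection[of j "{..<n}" X], of "X n"]
        by (simp add: o_def)
    qed
  qed
  show "continuous_map ?B ?A ?g"
    unfolding continuous_map_paired continuous_map_componentwise
    by (auto intro!: continuous_map_product_projection)
  show "?g (?f p) = p" if "p \<in> topspace ?A" for p
    using that by (cases p) (auto simp: PiE_def extensional_def fun_eq_iff restrict_def)
  show "?f (?g f) = f" if "f \<in> topspace ?B" for f
    using that by (auto simp: PiE_def extensional_def fun_eq_iff restrict_def less_Suc_eq)
qed

theorem has_chi_product_topology:
  fixes n :: nat
  assumes "\<And>i. i < n \<Longrightarrow> finite_CW_homotopy_type (X i)"
  shows "has_chi (product_topology X {..<n}) (\<Prod>i<n. euler_char (X i))"
  using assms
proof (induction n)
  case 0
  show ?case using has_chi_singleton[of "product_topology X {}" "\<lambda>_. undefined"] by simp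
next
  case (Suc n)
  then have "has_chi (product_topology X {..<n}) (\<Prod>i<n. euler_char (X i))" by simp
  from has_chi_prod_CW[OF Suc.prems[of n] this]
  obtain y where "has_chi (X n) y"
      "has_chi (prod_topology (product_topology X {..<n}) (X n)) ((\<Prod>i<n. euler_char (X i)) * y)"
    by auto
  moreover from this have "y = euler_char (X n)" by (simp add: has_chi_iff)
  ultimately show ?case
    using has_chi_homeomorphic[OF product_topology_Suc_homeomorphic] by simp
qed

section \<open>Compactly generated topologies\<close>

lemma weak_Hausdorff_imp_t1:
  fixes X :: "'a topology"
  assumes "weak_Hausdorff_space X"
  shows "t1_space X"
  unfolding t1_space_closedin_singleton
proof
  fix x assume x: "x \<in> topspace X"
  let ?K = "discrete_topology {\<lambda>_::'a. 0::real}"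
  have "compact_space ?K" "Hausdorff_space ?K"
    by (simp_all add: compact_space_discrete_topology)
  moreover have "continuous_map ?K X (\<lambda>_. x)" using x by simp
  ultimately have "closedin X ((\<lambda>_. x) ` topspace ?K)"
    using assms unfolding weak_Hausdorff_space_def by blast
  then show "closedin X {x}" by simp
qed

lemma openin_kify_if: "openin X U \<Longrightarrow> openin (kify X) U"
  by (simp add: openin_kify k_open_if_openin)

lemma continuous_map_from_kify: "continuous_map X Y f \<Longrightarrow> continuous_map (kify X) Y f"
  by (auto simp: continuous_map_def intro: openin_kify_if)

lemma t1_space_kify: "t1_space X \<Longrightarrow> t1_space (kify X)"
  unfolding t1_space_def by (metis openin_kify_if topspace_kify)

lemma t1_space_sum_topology:
  "(\<And>i. i \<in> I \<Longrightarrow> t1_space (X i)) \<Longrightarrow> t1_space (sum_topology X I)"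
  unfolding t1_space_closedin_singleton
proof (intro ballI)
  fix p assume t1: "\<And>i. i \<in> I \<Longrightarrow> \<forall>x\<in>topspace (X i). closedin (X i) {x}"
    and p: "p \<in> topspace (sum_topology X I)"
  obtain i x where ix: "p = (i, x)" "i \<in> I" "x \<in> topspace (X i)" using p by auto
  have "closed_map (X i) (sum_topology X I) (\<lambda>x. (i, x))"
    using ix(2) by (rule closed_map_component_injection)
  then have "closedin (sum_topology X I) ((\<lambda>x. (i, x)) ` {x})"
    using t1 ix unfolding closed_map_def by blast
  then show "closedin (sum_topology X I) {p}" by (simp add: ix)
qed

text \<open>Testing with compact Hausdorff spaces of the one type used in the definition is enough. If the
  type of the points is infinite, a test map \<open>u\<close> from an arbitrary compact Hausdorff space factors through the
  image of that space in a power of the real line: there is one Urysohn function for each pair of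
  distinct points of \<open>X\<close>, and the type has as many pairs as elements. If it is finite, the space is
  discrete.\<close>

lemma k_open_preimage:
  fixes X :: "'a topology" and K :: "'k topology"
  assumes t1: "t1_space X" and U: "k_open X U"
    and K: "compact_space K" "Hausdorff_space K" and u: "continuous_map K X u"
  shows "openin K {z \<in> topspace K. u z \<in> U}"
proof (cases "finite (UNIV :: 'a set)")
  case True
  then have "finite (topspace X - U)" by (rule rev_finite_subset) simp
  then have "closedin X (topspace X - U)" using t1 unfolding t1_space_closedin_finite by blast
  moreover have "U \<subseteq> topspace X" using U by (simp add: k_open_def)
  ultimately have "openin X U" by (simp add: openin_closedin_eq)
  with u show ?thesis by (rule openin_continuous_map_preimage)
next
  case False
  then have "\<exists>e'. bij_betw e' (UNIV \<times> UNIV :: ('a \<times> 'a) set) (UNIV :: 'a set)"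
    unfolding card_of_ordIso by (rule card_of_Times_same_infinite)
  then obtain e' where "bij_betw e' (UNIV \<times> UNIV :: ('a \<times> 'a) set) (UNIV :: 'a set)" ..
  then have "bij e'" by simp
  define e where "e = inv_into UNIV e'"
  have e: "surj e" unfolding e_def using \<open>bij e'\<close> by (simp add: bij_imp_bij_inv bij_is_surj)
  have norm: "normal_space K" using K by (simp add: compact_Hausdorff_or_regular_imp_normal_space)
  have "\<exists>g. continuous_map K euclideanreal g \<and>
      (fst p \<noteq> snd p \<and> fst p \<in> topspace X \<and> snd p \<in> topspace X \<longrightarrow>
        (\<forall>z\<in>topspace K. (u z = fst p \<longrightarrow> g z = 0) \<and> (u z = snd p \<longrightarrow> g z = 1)))" for p
  proof (cases "fst p \<noteq> snd p \<and> fst p \<in> topspace X \<and> snd p \<in> topspace X")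
    case True
    then have cl: "closedin X {fst p}" "closedin X {snd p}"
      using t1 by (auto simp: t1_space_closedin_singleton)
    have "disjnt {z \<in> topspace K. u z \<in> {fst p}} {z \<in> topspace K. u z \<in> {snd p}}"
      using True by (auto simp: disjnt_iff)
    then obtain g where "continuous_map K euclideanreal g"
        "g ` {z \<in> topspace K. u z \<in> {fst p}} \<subseteq> {0}" "g ` {z \<in> topspace K. u z \<in> {snd p}} \<subseteq> {1}"
      using Urysohn_lemma_alt[OF norm closedin_continuous_map_preimage[OF u cl(1)]
          closedin_continuous_map_preimage[OF u cl(2)], of 0 1] by blast
    then show ?thesis by (intro exI[of _ g]) auto
  next
    case False
    then show ?thesis by (intro exI[of _ "\<lambda>_. 0"]) auto
  qed
  then obtain g where gc: "\<And>p. continuous_map K euclideanreal (g p)"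
    and g: "\<And>a b z. \<lbrakk>a \<noteq> b; a \<in> topspace X; b \<in> topspace X; z \<in> topspace K\<rbrakk> \<Longrightarrow>
        (u z = a \<longrightarrow> g (a, b) z = 0) \<and> (u z = b \<longrightarrow> g (a, b) z = 1)"
    by (metis fst_conv snd_conv)
  define q where "q z = (\<lambda>c. g (e c) z)" for z
  define L where "L = subtopology (powertop_real UNIV) (q ` topspace K)"
  have q0: "continuous_map K (powertop_real UNIV) q"
    unfolding continuous_map_componentwise_UNIV q_def using gc by blast
  have topL: "topspace L = q ` topspace K" by (simp add: L_def)
  have cq: "continuous_map K L q"
    unfolding L_def using q0 by (rule continuous_map_into_subtopology) auto
  have HL: "Hausdorff_space L"
    unfolding L_def by (intro Hausdorff_space_subtopology) (simp add: Hausdorff_space_product_topology)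
  have CL: "compact_space L"
    unfolding L_def
    by (metis K(1) compact_space_def compact_space_subtopology image_compactin q0)
  have quot: "quotient_map K L q"
    using cq K(1) HL topL
    by (intro continuous_closed_imp_quotient_map continuous_imp_closed_map_gen)
      (auto intro: Hausdorff_imp_kc_space)
  have sep: "u z = u w" if zw: "z \<in> topspace K" "w \<in> topspace K" "q z = q w" for z w
  proof (rule ccontr)
    assume ne: "u z \<noteq> u w"
    have "u z \<in> topspace X" "u w \<in> topspace X"
      using u zw continuous_map_image_subset_topspace by blast+
    with ne have "g (u z, u w) z = 0" "g (u z, u w) w = 1" using g zw by blast+
    moreover obtain c where "e c = (u z, u w)" using e by (metis surjD)
    ultimately show False using fun_cong[OF zw(3), of c] by (simp add: q_def)
  qed
  obtain v where v: "continuous_map L X v" and vq: "\<And>z. z \<in> topspace K \<Longrightarrow> v (q z) = u z"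
    using quotient_map_lift_exists[OF quot u] sep by metis
  have "openin L {l \<in> topspace L. v l \<in> U}"
    using U CL HL v unfolding k_open_def by blast
  from openin_continuous_map_preimage[OF cq this]
  have "openin K {z \<in> topspace K. q z \<in> {l \<in> topspace L. v l \<in> U}}" .
  moreover have "{z \<in> topspace K. q z \<in> {l \<in> topspace L. v l \<in> U}} = {z \<in> topspace K. u z \<in> U}"
  proof (rule Collect_cong, rule conj_cong[OF refl])
    fix z assume z: "z \<in> topspace K"
    then have "q z \<in> topspace L" using topL by blast
    then show "(q z \<in> {l \<in> topspace L. v l \<in> U}) = (u z \<in> U)" using vq[OF z] by simp
  qed
  ultimately show ?thesis by simp
qed

text \<open>Every point has a compact neighbourhood, on which the previous lemma applies.\<close>

lemma continuous_map_into_kify: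
  assumes t1: "t1_space X" and L: "locally_compact_space L" "Hausdorff_space L"
    and u: "continuous_map L X u"
  shows "continuous_map L (kify X) u"
  unfolding continuous_map_def
proof (intro conjI allI impI)
  show "u \<in> topspace L \<rightarrow> topspace (kify X)" using u by (simp add: continuous_map_def)
  fix U assume "openin (kify X) U"
  then have U: "k_open X U" by (simp add: openin_kify)
  show "openin L {z \<in> topspace L. u z \<in> U}"
  proof (subst openin_subopen, intro ballI)
    fix z assume z: "z \<in> {z \<in> topspace L. u z \<in> U}"
    then obtain V C where VC: "openin L V" "compactin L C" "z \<in> V" "V \<subseteq> C"
      using L(1) unfolding locally_compact_space_def by blast
    let ?C = "subtopology L C"
    have "compact_space ?C" using VC(2) by (rule compact_space_subtopology)
    moreover have "Hausdorff_space ?C" using L(2) by (rule Hausdorff_space_subtopology)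
    moreover have "continuous_map ?C X u" using u by (rule continuous_map_from_subtopology)
    ultimately have "openin ?C {z \<in> topspace ?C. u z \<in> U}" by (rule k_open_preimage[OF t1 U])
    then obtain W where W: "openin L W" "{z \<in> topspace ?C. u z \<in> U} = W \<inter> C"
      by (auto simp: openin_subtopology)
    have CL: "C \<subseteq> topspace L" using VC(2) by (rule compactin_subset_topspace)
    show "\<exists>T. openin L T \<and> z \<in> T \<and> T \<subseteq> {z \<in> topspace L. u z \<in> U}"
    proof (intro exI conjI)
      show "openin L (W \<inter> V)" using W VC by (simp add: openin_Int)
      show "z \<in> W \<inter> V" using W(2) z VC CL by auto
      show "W \<inter> V \<subseteq> {z \<in> topspace L. u z \<in> U}" using W(2) VC CL by auto
    qed
  qed
qed

lemma compact_Hausdorff_into_kify: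
  "\<lbrakk>t1_space X; compact_space K; Hausdorff_space K; continuous_map K X u\<rbrakk> \<Longrightarrow>
    continuous_map K (kify X) u"
  by (rule continuous_map_into_kify) (auto intro: compact_imp_locally_compact_space)

lemma continuous_map_kify_kify:
  fixes X :: "'a topology"
  assumes t1: "t1_space Y" and g: "continuous_map (kify X) Y g"
  shows "continuous_map (kify X) (kify Y) g"
  unfolding continuous_map_def openin_kify topspace_kify
proof (intro conjI allI impI)
  show "g \<in> topspace X \<rightarrow> topspace Y" using g by (simp add: continuous_map_def)
  fix U assume U: "k_open Y U"
  show "k_open X {x \<in> topspace X. g x \<in> U}"
    unfolding k_open_def
  proof (intro conjI allI impI)
    fix K :: "('a \<Rightarrow> real) topology" and u
    assume K: "compact_space K \<and> Hausdorff_space K \<and> continuous_map K X u"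
    have uk: "continuous_map K (kify X) u"
      unfolding continuous_map_def openin_kify topspace_kify
      using K by (auto simp: k_open_def continuous_map_def)
    have "openin K {z \<in> topspace K. (g \<circ> u) z \<in> U}"
      using K by (intro k_open_preimage[OF t1 U] continuous_map_compose[OF uk g]) auto
    moreover have "{z \<in> topspace K. u z \<in> {x \<in> topspace X. g x \<in> U}} = {z \<in> topspace K. (g \<circ> u) z \<in> U}"
      using K by (auto simp: continuous_map_def)
    ultimately show "openin K {z \<in> topspace K. u z \<in> {x \<in> topspace X. g x \<in> U}}" by simp
  qed auto
qed

subsection \<open>Homology does not see the change of topology\<close>

lemma homology_group_eq_if_singular_simplices:
  assumes "\<And>p f. singular_simplex p X f \<longleftrightarrow> singular_simplex p Y f"
  shows "homology_group p X = homology_group p Y"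
proof -
  have s: "singular_simplex q X = singular_simplex q Y" for q using assms by blast
  have c: "singular_chain q X = singular_chain q Y" for q
    by (simp add: fun_eq_iff singular_chain_def s)
  have z: "singular_relcycle q X {} = singular_relcycle q Y {}" for q
    by (simp add: fun_eq_iff singular_relcycle_def c)
  have b: "singular_relboundary q X {} = singular_relboundary q Y {}" for q
    by (simp add: fun_eq_iff singular_relboundary_def c)
  show ?thesis
    by (simp add: relative_homology_group_def relcycle_group_def chain_group_def s z b)
qed

text \<open>A standard simplex is compact Hausdorff, so \<open>X\<close> and \<open>kify X\<close> have the same singular simplices.\<close>

lemma has_chi_kify:
  assumes t1: "t1_space X" and "has_chi X c"
  shows "has_chi (kify X) c"
proof -
  have "singular_simplex p X f \<longleftrightarrow> singular_simplex p (kify X) f" for p f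
  proof -
    let ?S = "subtopology (powertop_real UNIV) (standard_simplex p)"
    have "compact_space ?S" using compactin_standard_simplex by (rule compact_space_subtopology)
    moreover have "Hausdorff_space ?S"
      by (intro Hausdorff_space_subtopology) (simp add: Hausdorff_space_product_topology)
    moreover have "continuous_map ?S X f" if "continuous_map ?S (kify X) f"
      using continuous_map_compose[OF that continuous_map_from_kify[OF continuous_map_id]] by simp
    ultimately show ?thesis
      unfolding singular_simplex_def using compact_Hausdorff_into_kify[OF t1] by blast
  qed
  from homology_group_eq_if_singular_simplices[of X "kify X", OF this] show ?thesis
    using assms(2) by (simp add: has_rel_chi_def ranks_finite_def rel_betti_def)
qed

subsection \<open>Quotients of compactly generated sums\<close>

lemma continuous_map_from_prod_sum:
  assumes "\<And>i. i \<in> J \<Longrightarrow> continuous_map (prod_topology Z (X i)) Y (\<lambda>(s, z). h (s, (i, z)))"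
  shows "continuous_map (prod_topology Z (sum_topology X J)) Y h"
  unfolding continuous_map_def
proof (intro conjI allI impI)
  show "h \<in> topspace (prod_topology Z (sum_topology X J)) \<rightarrow> topspace Y"
    using assms by (force simp: continuous_map_def Pi_iff)
  fix U assume U: "openin Y U"
  show "openin (prod_topology Z (sum_topology X J)) {x \<in> topspace (prod_topology Z (sum_topology X J)). h x \<in> U}"
    unfolding openin_prod_topology_alt
  proof (intro allI impI)
    fix s p assume sp: "(s, p) \<in> {x \<in> topspace (prod_topology Z (sum_topology X J)). h x \<in> U}"
    then obtain i z where iz: "p = (i, z)" "i \<in> J" "z \<in> topspace (X i)" "s \<in> topspace Z" by auto
    define N where "N = {x \<in> topspace (prod_topology Z (X i)). (\<lambda>(s, z). h (s, (i, z))) x \<in> U}"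
    have "openin (prod_topology Z (X i)) N"
      unfolding N_def using openin_continuous_map_preimage[OF assms[OF iz(2)] U] .
    moreover have "(s, z) \<in> N"
      using sp iz by (simp add: N_def)
    ultimately have "\<exists>A B. openin Z A \<and> openin (X i) B \<and> s \<in> A \<and> z \<in> B \<and> A \<times> B \<subseteq> N"
      by (rule openin_prod_topology_alt[THEN iffD1, rule_format])
    then obtain A B where AB: "openin Z A" "openin (X i) B" "s \<in> A" "z \<in> B" "A \<times> B \<subseteq> N"
      by blast
    have "openin (sum_topology X J) (Pair i ` B)"
      using open_map_component_injection[OF iz(2), of X] AB(2) by (simp add: open_map_def)
    moreover have "A \<times> Pair i ` B \<subseteq> {x \<in> topspace (prod_topology Z (sum_topology X J)). h x \<in> U}"
      using AB(5) iz(2) by (auto simp: N_def)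
    ultimately show "\<exists>V W. openin Z V \<and> openin (sum_topology X J) W \<and> s \<in> V \<and> p \<in> W \<and>
        V \<times> W \<subseteq> {x \<in> topspace (prod_topology Z (sum_topology X J)). h x \<in> U}"
      using AB iz by blast
  qed
qed

text \<open>A quotient \<open>B\<close> of a sum of compactly generated spaces is also a quotient of the sum of all
  compact Hausdorff test spaces. The latter quotient map stays one after restriction to an open set
  and multiplication with the interval, so that homotopies can be tested on compact Hausdorff spaces,
  where products need no correction of their topology.\<close>

lemma continuous_map_interval_quotient:
  fixes X :: "nat \<Rightarrow> 'a topology"
  assumes q: "quotient_map (sum_topology (\<lambda>n. kify (X n)) UNIV) B q" and W: "openin B W"
    and probe: "\<And>n (K :: ('a \<Rightarrow> real) topology) u.
      \<lbrakk>compact_space K; Hausdorff_space K; continuous_map K (X n) u\<rbrakk> \<Longrightarrow>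
      continuous_map (cylinder (subtopology K {z \<in> topspace K. q (n, u z) \<in> W})) Y
        (\<lambda>(s, z). h (s, q (n, u z)))"
  shows "continuous_map (cylinder (subtopology B W)) Y h"
proof -
  let ?C = "sum_topology (\<lambda>n. kify (X n)) UNIV"
  define Idx where "Idx = {(n, K :: ('a \<Rightarrow> real) topology, u).
      compact_space K \<and> Hausdorff_space K \<and> continuous_map K (X n) u}"
  define T where "T = sum_topology (\<lambda>(n, K, u). K) Idx"
  define P where "P = (\<lambda>((n, K :: ('a \<Rightarrow> real) topology, u), z :: 'a \<Rightarrow> real). (n :: nat, u z :: 'a))"
  have P: "quotient_map T ?C P"
    unfolding quotient_map_def
  proof (intro conjI allI impI)
    show "P ` topspace T = topspace ?C"
    proof
      show "P ` topspace T \<subseteq> topspace ?C"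
        by (auto simp: T_def P_def Idx_def continuous_map_def)
      show "topspace ?C \<subseteq> P ` topspace T"
      proof
        fix c assume "c \<in> topspace ?C"
        then obtain n x where c: "c = (n, x)" "x \<in> topspace (X n)" by auto
        let ?K = "discrete_topology {\<lambda>_::'a. 0::real}"
        have "(n, ?K, \<lambda>_. x) \<in> Idx"
          using c by (simp add: Idx_def compact_space_discrete_topology)
        then have "((n, ?K, \<lambda>_. x), \<lambda>_. 0) \<in> topspace T" by (simp add: T_def)
        then show "c \<in> P ` topspace T" by (force simp: P_def c)
      qed
    qed
    fix U assume U: "U \<subseteq> topspace ?C"
    have "openin T {x \<in> topspace T. P x \<in> U} \<longleftrightarrow>
        (\<forall>i\<in>Idx. openin (case i of (n, K, u) \<Rightarrow> K) {z. (i, z) \<in> {x \<in> topspace T. P x \<in> U}})"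
      unfolding T_def openin_sum_topology by auto
    also have "\<dots> \<longleftrightarrow> (\<forall>n (K :: ('a \<Rightarrow> real) topology) u.
        compact_space K \<and> Hausdorff_space K \<and> continuous_map K (X n) u \<longrightarrow>
        openin K {z \<in> topspace K. u z \<in> {x. (n, x) \<in> U}})"
      by (auto simp: T_def P_def Idx_def)
    also have "\<dots> \<longleftrightarrow> (\<forall>n. k_open (X n) {x. (n, x) \<in> U})"
      using U by (auto simp: k_open_def)
    also have "\<dots> \<longleftrightarrow> openin ?C U"
      using U by (auto simp: openin_sum_topology openin_kify)
    finally show "openin T {x \<in> topspace T. P x \<in> U} = openin ?C U" .
  qed
  define Om where "Om = (\<lambda>(n, K :: ('a \<Rightarrow> real) topology, u). {z \<in> topspace K. q (n, u z) \<in> W})"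
  have "quotient_map (subtopology T (Sigma Idx Om)) (subtopology B W) (q \<circ> P)"
  proof (rule quotient_map_restriction[OF quotient_map_compose[OF P q]])
    show "{x \<in> topspace T. (q \<circ> P) x \<in> W} = Sigma Idx Om"
      by (auto simp: T_def P_def Om_def)
  qed (use W in simp)
  then have "quotient_map (sum_topology (\<lambda>i. subtopology (case i of (n, K, u) \<Rightarrow> K) (Om i)) Idx)
      (subtopology B W) (q \<circ> P)"
    by (simp add: T_def subtopology_sum_topology)
  then have Q: "quotient_map (cylinder
        (sum_topology (\<lambda>i. subtopology (case i of (n, K, u) \<Rightarrow> K) (Om i)) Idx))
      (cylinder (subtopology B W)) (\<lambda>(s, x). (s, (q \<circ> P) x))"
    by (rule quotient_map_prod_right[rotated 2])
      (simp_all add: compact_imp_locally_compact_space compact_space_subtopology Hausdorff_space_subtopology)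
  have "continuous_map (cylinder
        (sum_topology (\<lambda>i. subtopology (case i of (n, K, u) \<Rightarrow> K) (Om i)) Idx)) Y
      (h \<circ> (\<lambda>(s, x). (s, (q \<circ> P) x)))"
  proof (rule continuous_map_from_prod_sum)
    fix i assume "i \<in> Idx"
    then obtain n K u where i: "i = (n, K, u)" "compact_space K" "Hausdorff_space K" "continuous_map K (X n) u"
      by (auto simp: Idx_def)
    show "continuous_map (cylinder (subtopology (case i of (n, K, u) \<Rightarrow> K) (Om i))) Y
        (\<lambda>(s, z). (h \<circ> (\<lambda>(s, x). (s, (q \<circ> P) x))) (s, i, z))"
      using probe[OF i(2-4)] by (simp add: i(1) Om_def P_def case_prod_unfold)
  qed
  then show ?thesis unfolding continuous_compose_quotient_map_eq[OF Q] .
qed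

lemma continuous_map_quotient:
  fixes X :: "nat \<Rightarrow> 'a topology"
  assumes q: "quotient_map (sum_topology (\<lambda>n. kify (X n)) UNIV) B q" and W: "openin B W"
    and probe: "\<And>n (K :: ('a \<Rightarrow> real) topology) u.
      \<lbrakk>compact_space K; Hausdorff_space K; continuous_map K (X n) u\<rbrakk> \<Longrightarrow>
      continuous_map (subtopology K {z \<in> topspace K. q (n, u z) \<in> W}) Y (\<lambda>z. r (q (n, u z)))"
  shows "continuous_map (subtopology B W) Y r"
proof -
  have c1: "continuous_map (cylinder (subtopology B W)) Y (r \<circ> snd)"
  proof (rule continuous_map_interval_quotient[OF q W])
    fix n and K :: "('a \<Rightarrow> real) topology" and u
    assume "compact_space K" "Hausdorff_space K" "continuous_map K (X n) u"
    from continuous_map_compose[OF continuous_map_snd probe[OF this]]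
    show "continuous_map (cylinder (subtopology K {z \<in> topspace K. q (n, u z) \<in> W})) Y
        (\<lambda>(s, z). (r \<circ> snd) (s, q (n, u z)))"
      by (simp add: o_def case_prod_unfold)
  qed
  have "continuous_map (subtopology B W) (cylinder (subtopology B W)) (\<lambda>x. (0, x))"
    by (simp add: continuous_map_paired continuous_map_in_subtopology)
  from continuous_map_compose[OF this c1] show ?thesis by (simp add: o_def)
qed

section \<open>Simplices of the nerve of an acyclic category\<close>

context topological_category
begin

abbreviation hom :: "'o \<Rightarrow> 'o \<Rightarrow> 'm set" where
  "hom a b \<equiv> topspace (Hom A a b)"

definition is_simplex :: "nat \<Rightarrow> (nat \<Rightarrow> 'o) \<Rightarrow> (nat \<Rightarrow> 'm) \<Rightarrow> bool" where
  "is_simplex n x f \<longleftrightarrow> x \<in> {..n} \<rightarrow>\<^sub>E Obj A \<and> f \<in> (\<Pi>\<^sub>E i\<in>{..<n}. hom (x (Suc i)) (x i))"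

lemma topspace_nerve: "(x, f) \<in> topspace (nerve A n) \<longleftrightarrow> is_simplex n x f"
  by (auto simp: nerve_def is_simplex_def kproduct_def)

lemma is_simplex_Obj: "is_simplex n x f \<Longrightarrow> i \<le> n \<Longrightarrow> x i \<in> Obj A"
  by (auto simp: is_simplex_def)

lemma is_simplex_hom: "is_simplex n x f \<Longrightarrow> i < n \<Longrightarrow> f i \<in> hom (x (Suc i)) (x i)"
  by (auto simp: is_simplex_def)

lemma Cmp_in_hom:
  assumes "a \<in> Obj A" "b \<in> Obj A" "c \<in> Obj A" "g \<in> hom b c" "f \<in> hom a b"
  shows "Cmp A a b c g f \<in> hom a c"
  using continuous_map_image_subset_topspace[OF continuous_Cmp[OF assms(1-3)]] assms(4,5)
  by (auto simp: kprod_def)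

lemma composite_in_hom:
  assumes "is_simplex n x f" "i + k \<le> n"
  shows "composite A x f i k \<in> hom (x (i + k)) (x i)"
  using assms(2)
proof (induction k)
  case 0
  then show ?case using assms(1) by (simp add: Idn_in_Hom is_simplex_Obj)
next
  case (Suc k)
  have "Cmp A (x (i + Suc k)) (x (i + k)) (x i) (composite A x f i k) (f (i + k))
      \<in> hom (x (i + Suc k)) (x i)"
    using Suc assms(1) is_simplex_hom[OF assms(1), of "i + k"]
    by (intro Cmp_in_hom) (auto intro: is_simplex_Obj)
  then show ?case by simp
qed

lemma composite_add:
  assumes s: "is_simplex n x f" and "i + k + l \<le> n"
  shows "composite A x f i (k + l) =
    Cmp A (x (i + k + l)) (x (i + k)) (x i) (composite A x f i k) (composite A x f (i + k) l)"
  using assms(2)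
proof (induction l)
  case 0
  have "Cmp A (x (i + k)) (x (i + k)) (x i) (composite A x f i k) (Idn A (x (i + k))) = composite A x f i k"
    using s 0 by (intro Cmp_Idn_right composite_in_hom) (auto intro: is_simplex_Obj)
  then show ?case by simp
next
  case (Suc l)
  have "composite A x f i (k + Suc l) =
      Cmp A (x (i + k + Suc l)) (x (i + k + l)) (x i)
        (Cmp A (x (i + k + l)) (x (i + k)) (x i) (composite A x f i k) (composite A x f (i + k) l))
        (f (i + k + l))"
    using Suc by (simp add: add.assoc)
  also have "\<dots> = Cmp A (x (i + k + Suc l)) (x (i + k)) (x i) (composite A x f i k)
      (Cmp A (x (i + k + Suc l)) (x (i + k + l)) (x (i + k)) (composite A x f (i + k) l) (f (i + k + l)))"
    using Suc.prems is_simplex_hom[OF s, of "i + k + l"]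
    by (intro Cmp_assoc composite_in_hom[OF s] is_simplex_Obj[OF s]) auto
  finally show ?case by simp
qed

text \<open>Composites indexed by their end vertices, which makes the simplicial operators act on the indices
  alone.\<close>

definition arrow :: "(nat \<Rightarrow> 'o) \<Rightarrow> (nat \<Rightarrow> 'm) \<Rightarrow> nat \<Rightarrow> nat \<Rightarrow> 'm" where
  "arrow x f p q = composite A x f p (q - p)"

lemma arrow_in_hom: "is_simplex n x f \<Longrightarrow> p \<le> q \<Longrightarrow> q \<le> n \<Longrightarrow> arrow x f p q \<in> hom (x q) (x p)"
  using composite_in_hom[of n x f p "q - p"] by (simp add: arrow_def)

lemma arrow_trans:
  "\<lbrakk>is_simplex n x f; p \<le> q; q \<le> r; r \<le> n\<rbrakk> \<Longrightarrow>
    arrow x f p r = Cmp A (x r) (x q) (x p) (arrow x f p q) (arrow x f q r)"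
  using composite_add[of n x f p "q - p" "r - q"] by (simp add: arrow_def)

lemma arrow_step:
  assumes "is_simplex n x f" "i < n"
  shows "arrow x f i (Suc i) = f i"
proof -
  have "Cmp A (x (Suc i)) (x i) (x i) (Idn A (x i)) (f i) = f i"
    using assms by (intro Cmp_Idn_left is_simplex_hom) (auto intro: is_simplex_Obj)
  then show ?thesis by (simp add: arrow_def)
qed

lemma nerve_act_arrow:
  "nerve_act A m \<phi> (x, f) = (restrict (\<lambda>j. x (\<phi> j)) {..m}, restrict (\<lambda>j. arrow x f (\<phi> j) (\<phi> (Suc j))) {..<m})"
  by (simp add: nerve_act_def arrow_def)

lemma order_mapsD:
  assumes "\<phi> \<in> order_maps m n"
  shows "j \<le> m \<Longrightarrow> \<phi> j \<le> n" "i \<le> j \<Longrightarrow> j \<le> m \<Longrightarrow> \<phi> i \<le> \<phi> j"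
  using assms by (auto simp: order_maps_def mono_on_def)

lemma is_simplex_nerve_act:
  assumes s: "is_simplex n x f" and \<phi>: "\<phi> \<in> order_maps m n"
  shows "is_simplex m (fst (nerve_act A m \<phi> (x, f))) (snd (nerve_act A m \<phi> (x, f)))"
  using is_simplex_Obj[OF s] arrow_in_hom[OF s] order_mapsD[OF \<phi>]
  unfolding nerve_act_arrow is_simplex_def fst_conv snd_conv
  by (intro conjI) (auto simp: Suc_le_eq)

lemma arrow_nerve_act:
  assumes s: "is_simplex n x f" and \<phi>: "\<phi> \<in> order_maps m n" and "p \<le> q" "q \<le> m"
  shows "arrow (fst (nerve_act A m \<phi> (x, f))) (snd (nerve_act A m \<phi> (x, f))) p q = arrow x f (\<phi> p) (\<phi> q)"
  using assms(3,4)
proof (induction q rule: dec_induct)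
  case base
  then show ?case by (simp add: arrow_def nerve_act_def)
next
  case (step q)
  let ?y = "fst (nerve_act A m \<phi> (x, f))" and ?g = "snd (nerve_act A m \<phi> (x, f))"
  note s' = is_simplex_nerve_act[OF s \<phi>]
  have y: "?y j = x (\<phi> j)" if "j \<le> m" for j using that by (simp add: nerve_act_def)
  have "arrow ?y ?g p (Suc q) = Cmp A (?y (Suc q)) (?y q) (?y p) (arrow ?y ?g p q) (arrow ?y ?g q (Suc q))"
    using step by (intro arrow_trans[OF s']) auto
  also have "arrow ?y ?g q (Suc q) = arrow x f (\<phi> q) (\<phi> (Suc q))"
    using step by (subst arrow_step[OF s']) (auto simp: nerve_act_arrow)
  also have "arrow ?y ?g p q = arrow x f (\<phi> p) (\<phi> q)" using step by simp
  also have "Cmp A (?y (Suc q)) (?y q) (?y p) (arrow x f (\<phi> p) (\<phi> q)) (arrow x f (\<phi> q) (\<phi> (Suc q)))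
      = arrow x f (\<phi> p) (\<phi> (Suc q))"
    using step order_mapsD[OF \<phi>] by (simp add: y) (intro arrow_trans[OF s, symmetric], auto)
  finally show ?case .
qed

lemma nerve_act_nerve_act:
  assumes s: "is_simplex n x f" and \<phi>: "\<phi> \<in> order_maps m n" and \<psi>: "\<psi> \<in> order_maps l m"
  shows "nerve_act A l \<psi> (nerve_act A m \<phi> (x, f)) = nerve_act A l (\<phi> \<circ> \<psi>) (x, f)"
proof -
  let ?y = "fst (nerve_act A m \<phi> (x, f))" and ?g = "snd (nerve_act A m \<phi> (x, f))"
  have "nerve_act A l \<psi> (?y, ?g) = nerve_act A l (\<phi> \<circ> \<psi>) (x, f)"
    unfolding nerve_act_arrow[of l]
  proof (intro arg_cong2[of _ _ _ _ Pair] restrict_ext)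
    show "?y (\<psi> j) = x ((\<phi> \<circ> \<psi>) j)" if "j \<in> {..l}" for j
      using that order_mapsD(1)[OF \<psi>] by (simp add: nerve_act_def)
    show "arrow ?y ?g (\<psi> j) (\<psi> (Suc j)) = arrow x f ((\<phi> \<circ> \<psi>) j) ((\<phi> \<circ> \<psi>) (Suc j))" if "j \<in> {..<l}" for j
      using that order_mapsD[OF \<psi>] by (simp add: arrow_nerve_act[OF s \<phi>] Suc_le_eq)
  qed
  then show ?thesis by simp
qed

lemma nerve_act_id: "is_simplex n x f \<Longrightarrow> nerve_act A n (\<lambda>i. i) (x, f) = (x, f)"
  unfolding nerve_act_arrow
proof (rule arg_cong2[of _ _ _ _ Pair])
  assume s: "is_simplex n x f"
  show "restrict (\<lambda>j. x j) {..n} = x"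
    using s by (auto simp: is_simplex_def)
  have "restrict (\<lambda>j. arrow x f j (Suc j)) {..<n} = restrict f {..<n}"
    using arrow_step[OF s] by (intro restrict_ext) auto
  also have "\<dots> = f" using s by (auto simp: is_simplex_def)
  finally show "restrict (\<lambda>j. arrow x f j (Suc j)) {..<n} = f" .
qed

end

locale acyclic_topological_category = topological_category A for A :: "('o, 'm) topcat" +
  assumes acyclic: "acyclic_topcat A"
begin

lemma endo_eq_Idn:
  assumes "a \<in> Obj A" "g \<in> hom a a"
  shows "g = Idn A a"
proof -
  obtain p where "hom a a = {p}" using assms(1) acyclic by (auto simp: acyclic_topcat_def)
  then show ?thesis using assms Idn_in_Hom[OF assms(1)] by auto
qed

lemma hom_antisym:
  "\<lbrakk>a \<in> Obj A; b \<in> Obj A; hom a b \<noteq> {}; hom b a \<noteq> {}\<rbrakk> \<Longrightarrow> a = b"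
  using acyclic by (auto simp: acyclic_topcat_def)

text \<open>An object cannot be left and reached again, so equal objects occur consecutively in a simplex.\<close>

lemma block_constant:
  assumes s: "is_simplex n x f" and "p \<le> q" "q \<le> r" "r \<le> n" "x p = x r"
  shows "x q = x p"
proof (rule hom_antisym)
  show "hom (x q) (x p) \<noteq> {}" using arrow_in_hom[OF s, of p q] assms by auto
  show "hom (x p) (x q) \<noteq> {}" using arrow_in_hom[OF s, of q r] assms by auto
qed (use assms is_simplex_Obj[OF s] in auto)

text \<open>Within a block of equal objects all arrows are identities, so an arrow of the simplex depends on
  its end objects only.\<close>

lemma arrow_shift_source:
  assumes s: "is_simplex n x f" and "p \<le> p'" "p' \<le> q" "q \<le> n" "x p = x p'"
  shows "arrow x f p q = arrow x f p' q"
proof -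
  have "arrow x f p p' = Idn A (x p)"
    using assms is_simplex_Obj[OF s] arrow_in_hom[OF s, of p p'] by (intro endo_eq_Idn) auto
  then have "arrow x f p q = Cmp A (x q) (x p') (x p') (Idn A (x p')) (arrow x f p' q)"
    using arrow_trans[OF s, of p p' q] assms by simp
  also have "\<dots> = arrow x f p' q"
    using assms by (intro Cmp_Idn_left is_simplex_Obj[OF s] arrow_in_hom[OF s]) auto
  finally show ?thesis .
qed

lemma arrow_shift_target:
  assumes s: "is_simplex n x f" and "p \<le> q'" "q' \<le> q" "q \<le> n" "x q = x q'"
  shows "arrow x f p q = arrow x f p q'"
proof -
  have "arrow x f q' q = Idn A (x q)"
    using assms is_simplex_Obj[OF s] arrow_in_hom[OF s, of q' q] by (intro endo_eq_Idn) auto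
  then have "arrow x f p q = Cmp A (x q') (x q') (x p) (arrow x f p q') (Idn A (x q'))"
    using arrow_trans[OF s, of p q' q] assms by simp
  also have "\<dots> = arrow x f p q'"
    using assms by (intro Cmp_Idn_right is_simplex_Obj[OF s] arrow_in_hom[OF s]) auto
  finally show ?thesis .
qed

lemma arrow_unique:
  assumes s: "is_simplex n x f" and le: "p \<le> q" "q \<le> n" "p' \<le> q'" "q' \<le> n"
    and eq: "x p = x p'" "x q = x q'"
  shows "arrow x f p q = arrow x f p' q'"
proof (cases "x p = x q")
  case True
  have "arrow x f p q = Idn A (x p)"
    using le True is_simplex_Obj[OF s] arrow_in_hom[OF s le(1,2)] by (intro endo_eq_Idn) auto
  moreover have "arrow x f p' q' = Idn A (x p')"
    using le True eq is_simplex_Obj[OF s] arrow_in_hom[OF s le(3,4)] by (intro endo_eq_Idn) auto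
  ultimately show ?thesis using eq by simp
next
  case False
  let ?P = "max p p'" and ?Q = "min q q'"
  have "p' \<le> q"
  proof (rule ccontr)
    assume "\<not> p' \<le> q"
    then have "x q = x p" using block_constant[OF s, of p q p'] le eq by auto
    with False show False by simp
  qed
  moreover have "p \<le> q'"
  proof (rule ccontr)
    assume "\<not> p \<le> q'"
    then have "x q' = x p'" using block_constant[OF s, of p' q' p] le eq by auto
    with False eq show False by simp
  qed
  ultimately have PQ: "?P \<le> ?Q" using le by auto
  have xP: "x ?P = x p" "x ?P = x p'" and xQ: "x ?Q = x q" "x ?Q = x q'"
    using eq by (auto simp: max_def min_def)
  have "arrow x f p q = arrow x f ?P q" using PQ xP le by (intro arrow_shift_source[OF s]) auto
  also have "\<dots> = arrow x f ?P ?Q" using PQ xQ le by (intro arrow_shift_target[OF s]) auto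
  also have "\<dots> = arrow x f ?P q'" using PQ xQ le by (intro arrow_shift_target[OF s, symmetric]) auto
  also have "\<dots> = arrow x f p' q'" using PQ xP le by (intro arrow_shift_source[OF s, symmetric]) auto
  finally show ?thesis .
qed

text \<open>This makes the deformations of the open stars below independent of the choice of an occurrence of
  each object.\<close>

lemma nerve_act_unique:
  assumes s: "is_simplex n x f" and \<phi>: "\<phi> \<in> order_maps m n" and \<psi>: "\<psi> \<in> order_maps m n"
    and eq: "\<And>j. j \<le> m \<Longrightarrow> x (\<phi> j) = x (\<psi> j)"
  shows "nerve_act A m \<phi> (x, f) = nerve_act A m \<psi> (x, f)"
  unfolding nerve_act_arrow
proof (intro arg_cong2[of _ _ _ _ Pair] restrict_ext)
  show "arrow x f (\<phi> j) (\<phi> (Suc j)) = arrow x f (\<psi> j) (\<psi> (Suc j))" if "j \<in> {..<m}" for j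
    using that order_mapsD[OF \<phi>] order_mapsD[OF \<psi>] eq
    by (intro arrow_unique[OF s]) (auto simp: Suc_le_eq)
qed (use eq in auto)

end

section \<open>Points of the classifying space\<close>

lemma generated_equiv_class_eq:
  assumes "r \<subseteq> T \<times> T" "(p, p') \<in> r"
  shows "generated_equiv T r `` {p} = generated_equiv T r `` {p'}"
proof -
  have "(p, p') \<in> (r \<union> r\<inverse>)\<^sup>*" "(p', p) \<in> (r \<union> r\<inverse>)\<^sup>*" "p \<in> T" "p' \<in> T" using assms by auto
  then show ?thesis unfolding generated_equiv_def by (auto intro: rtrancl_trans)
qed

lemma generated_equiv_class_invariant:
  assumes inv: "\<And>p p'. (p, p') \<in> r \<Longrightarrow> F p = F p'"
    and p: "p \<in> T" "p' \<in> T" and eq: "generated_equiv T r `` {p} = generated_equiv T r `` {p'}"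
  shows "F p = F p'"
proof -
  have "(p', p') \<in> generated_equiv T r" using p by (simp add: generated_equiv_def)
  then have "(p, p') \<in> (r \<union> r\<inverse>)\<^sup>*" using eq by (auto simp: generated_equiv_def)
  then show ?thesis
  proof (induction rule: rtrancl_induct)
    case (step y z)
    then show ?case using inv[of y z] inv[of z y] by auto
  qed simp
qed

type_synonym ('o, 'm) cell_point = "nat \<times> (nat \<Rightarrow> real) \<times> (nat \<Rightarrow> 'o) \<times> (nat \<Rightarrow> 'm)"

text \<open>Coordinates at equal objects are added up, because degeneracies split a vertex into several equal
  ones and only the sum is compatible with the gluing.\<close>

fun weight :: "'o \<Rightarrow> ('o, 'm) cell_point \<Rightarrow> real" where
  "weight a (n, t, x, f) = (\<Sum>i\<le>n. if x i = a then t i else 0)"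

lemma simplex_act_sum:
  assumes "\<phi> \<in> order_maps m n"
  shows "(\<Sum>i\<le>n. c i * simplex_act m \<phi> t i) = (\<Sum>j\<le>m. c (\<phi> j) * t j)"
proof -
  have "(\<Sum>i\<le>n. c i * simplex_act m \<phi> t i) = (\<Sum>i\<le>n. \<Sum>j | j \<in> {..m} \<and> \<phi> j = i. c (\<phi> j) * t j)"
    by (simp add: simplex_act_def sum_distrib_left)
  also have "\<dots> = (\<Sum>j\<le>m. c (\<phi> j) * t j)"
    using assms by (intro sum.group) (auto simp: order_maps_def)
  finally show ?thesis .
qed

lemma simplex_act_in_simplex:
  assumes \<phi>: "\<phi> \<in> order_maps m n" and t: "t \<in> standard_simplex m"
  shows "simplex_act m \<phi> t \<in> standard_simplex n"
proof -
  have nn: "0 \<le> simplex_act m \<phi> t i" for i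
    using t by (auto simp: simplex_act_def standard_simplex_def intro: sum_nonneg)
  have sum1: "(\<Sum>i\<le>n. simplex_act m \<phi> t i) = 1"
    using simplex_act_sum[OF \<phi>, of "\<lambda>_. 1" t] t by (simp add: standard_simplex_def)
  have zero: "simplex_act m \<phi> t i = 0" if "i > n" for i
  proof -
    have "\<phi> j \<le> n" if "j \<le> m" for j using \<phi> that by (auto simp: order_maps_def)
    then have "{j. j \<le> m \<and> \<phi> j = i} = {}" using \<open>i > n\<close> by (metis (mono_tags, lifting) Collect_empty_eq leD)
    then show ?thesis by (simp only: simplex_act_def sum.empty)
  qed
  have "simplex_act m \<phi> t i \<le> 1" for i
  proof (cases "i \<le> n")
    case True
    then show ?thesis using member_le_sum[of i "{..n}" "simplex_act m \<phi> t"] nn sum1 by simp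
  qed (simp add: zero)
  then show ?thesis using nn sum1 zero by (simp add: standard_simplex_def)
qed

context topological_category
begin

abbreviation cells :: "('o, 'm) cell_point topology" where
  "cells \<equiv> realization_cells (nerve A)"

abbreviation glue :: "(('o, 'm) cell_point \<times> ('o, 'm) cell_point) set" where
  "glue \<equiv> realization_glue (nerve A) (nerve_act A)"

abbreviation BA :: "('o, 'm) cell_point set topology" where
  "BA \<equiv> classifying_space A"

definition cl :: "('o, 'm) cell_point \<Rightarrow> ('o, 'm) cell_point set" where
  "cl p = generated_equiv (topspace cells) glue `` {p}"

lemma topspace_cells: "(n, t, x, f) \<in> topspace cells \<longleftrightarrow> t \<in> standard_simplex n \<and> is_simplex n x f"
  by (simp add: realization_cells_def kprod_def simplex_space_def topspace_nerve)

lemma glueE: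
  assumes "(p, p') \<in> glue"
  obtains m n \<phi> t x f where "p = (m, t, nerve_act A m \<phi> (x, f))" "p' = (n, simplex_act m \<phi> t, x, f)"
    "\<phi> \<in> order_maps m n" "t \<in> standard_simplex m" "is_simplex n x f"
proof -
  obtain m n \<phi> t y where "p = (m, t, nerve_act A m \<phi> y)" "p' = (n, simplex_act m \<phi> t, y)"
    "\<phi> \<in> order_maps m n" "t \<in> standard_simplex m" "y \<in> topspace (nerve A n)"
    using assms unfolding realization_glue_def by blast
  then show ?thesis using that topspace_nerve by (cases y) blast
qed

lemma glueI:
  "\<lbrakk>\<phi> \<in> order_maps m n; t \<in> standard_simplex m; is_simplex n x f\<rbrakk> \<Longrightarrow>
    ((m, t, nerve_act A m \<phi> (x, f)), (n, simplex_act m \<phi> t, x, f)) \<in> glue"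
  unfolding realization_glue_def using topspace_nerve by blast

lemma glue_subset: "glue \<subseteq> topspace cells \<times> topspace cells"
proof
  fix z assume "z \<in> glue"
  then obtain p p' where z: "z = (p, p')" "(p, p') \<in> glue" by (cases z) auto
  from z(2) show "z \<in> topspace cells \<times> topspace cells"
  proof (rule glueE)
    fix m n \<phi> t x f
    assume h: "p = (m, t, nerve_act A m \<phi> (x, f))" "p' = (n, simplex_act m \<phi> t, x, f)"
      "\<phi> \<in> order_maps m n" "t \<in> standard_simplex m" "is_simplex n x f"
    have "p = (m, t, fst (nerve_act A m \<phi> (x, f)), snd (nerve_act A m \<phi> (x, f)))" by (simp add: h(1))
    then have "p \<in> topspace cells"
      using topspace_cells is_simplex_nerve_act[OF h(5,3)] h(4) by metis
    moreover have "p' \<in> topspace cells"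
      using h topspace_cells simplex_act_in_simplex by metis
    ultimately show ?thesis by (simp add: z(1))
  qed
qed

lemma cl_eq_if_glue: "(p, p') \<in> glue \<Longrightarrow> cl p = cl p'"
  unfolding cl_def by (rule generated_equiv_class_eq[OF glue_subset])

lemma quotient_map_cl: "quotient_map cells BA cl"
proof -
  have "cl = (\<lambda>p. generated_equiv (topspace cells) glue `` {p})" by (simp add: fun_eq_iff cl_def)
  then show ?thesis
    unfolding classifying_space_def geometric_realization_def
    by (simp add: quotient_map_quotient_topology)
qed

lemma topspace_BA: "topspace BA = cl ` topspace cells"
  using quotient_imp_surjective_map[OF quotient_map_cl] by simp

definition rep :: "('o, 'm) cell_point set \<Rightarrow> ('o, 'm) cell_point" where
  "rep b = (SOME p. p \<in> topspace cells \<and> cl p = b)"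

lemma rep_cl:
  assumes "p \<in> topspace cells"
  shows "rep (cl p) \<in> topspace cells" "cl (rep (cl p)) = cl p"
  using someI[of "\<lambda>p'. p' \<in> topspace cells \<and> cl p' = cl p" p] assms by (auto simp: rep_def)

lemma invariant_rep:
  assumes "\<And>p p'. (p, p') \<in> glue \<Longrightarrow> F p = F p'" "p \<in> topspace cells"
  shows "F (rep (cl p)) = F p"
  using generated_equiv_class_invariant[of glue F "rep (cl p)" "topspace cells" p] rep_cl[OF assms(2)] assms
  by (simp add: cl_def)

lemma weight_glue: "(p, p') \<in> glue \<Longrightarrow> weight a p = weight a p'"
proof (erule glueE)
  fix m n \<phi> t x f
  assume h: "p = (m, t, nerve_act A m \<phi> (x, f))" "p' = (n, simplex_act m \<phi> t, x, f)"
    "\<phi> \<in> order_maps m n" "t \<in> standard_simplex m" "is_simplex n x f"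
  have if_mult: "(if P then b else 0) = (if P then 1 else 0) * b" for P and b :: real by simp
  have "weight a p' = (\<Sum>i\<le>n. (if x i = a then 1 else 0) * simplex_act m \<phi> t i)"
    using h(2) by (simp add: if_mult[of _ "simplex_act m \<phi> t _"])
  also have "\<dots> = (\<Sum>j\<le>m. (if x (\<phi> j) = a then 1 else 0) * t j)"
    using simplex_act_sum[OF h(3), of "\<lambda>i. if x i = a then 1 else 0" t] by simp
  also have "\<dots> = (\<Sum>j\<le>m. if restrict (\<lambda>j. x (\<phi> j)) {..m} j = a then t j else 0)"
    by (intro sum.cong) auto
  also have "\<dots> = weight a p" using h(1) by (simp add: nerve_act_def)
  finally show ?thesis by simp
qed

definition bweight :: "'o \<Rightarrow> ('o, 'm) cell_point set \<Rightarrow> real" where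
  "bweight a b = weight a (rep b)"

lemma bweight_cl: "p \<in> topspace cells \<Longrightarrow> bweight a (cl p) = weight a p"
  unfolding bweight_def by (rule invariant_rep[OF weight_glue])

lemma sum_weight:
  assumes "p \<in> topspace cells" "finite (Obj A)"
  shows "(\<Sum>a\<in>Obj A. weight a p) = 1"
proof -
  obtain n t x f where p: "p = (n, t, x, f)" by (metis prod_cases4)
  then have s: "t \<in> standard_simplex n" "is_simplex n x f" using assms topspace_cells by auto
  have "(\<Sum>a\<in>Obj A. weight a p) = (\<Sum>i\<le>n. \<Sum>a\<in>Obj A. if x i = a then t i else 0)"
    unfolding p weight.simps by (rule sum.swap)
  also have "\<dots> = (\<Sum>i\<le>n. t i)"
    using assms(2) is_simplex_Obj[OF s(2)] by (intro sum.cong) (auto simp: sum.delta)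
  finally show ?thesis using s(1) by (simp add: standard_simplex_def)
qed

lemma weight_pos_object:
  assumes "0 < weight a (n, t, x, f)"
  shows "\<exists>i\<le>n. x i = a"
proof (rule ccontr)
  assume "\<not> (\<exists>i\<le>n. x i = a)"
  then have "weight a (n, t, x, f) = 0" by (auto intro!: sum.neutral)
  with assms show False by simp
qed

end

section \<open>Open stars in the classifying space\<close>

lemma continuous_map_from_sum:
  assumes "\<And>i. i \<in> I \<Longrightarrow> continuous_map (X i) Y (\<lambda>z. h (i, z))"
  shows "continuous_map (sum_topology X I) Y h"
  unfolding continuous_map_def
proof (intro conjI allI impI)
  show "h \<in> topspace (sum_topology X I) \<rightarrow> topspace Y"
    using assms by (fastforce simp: continuous_map_def)
  fix U assume U: "openin Y U"
  show "openin (sum_topology X I) {p \<in> topspace (sum_topology X I). h p \<in> U}"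
    unfolding openin_sum_topology
  proof (intro conjI ballI)
    fix i assume i: "i \<in> I"
    have "{z. (i, z) \<in> {p \<in> topspace (sum_topology X I). h p \<in> U}} = {z \<in> topspace (X i). h (i, z) \<in> U}"
      using i by auto
    then show "openin (X i) {z. (i, z) \<in> {p \<in> topspace (sum_topology X I). h p \<in> U}}"
      using openin_continuous_map_preimage[OF assms[OF i] U] by simp
  qed auto
qed

lemma continuous_map_from_empty: "topspace X = {} \<Longrightarrow> continuous_map X Y h"
  by (auto simp: continuous_map_def)

context topological_category
begin

abbreviation cell_space :: "nat \<Rightarrow> ((nat \<Rightarrow> real) \<times> (nat \<Rightarrow> 'o) \<times> (nat \<Rightarrow> 'm)) topology" where
  "cell_space n \<equiv> prod_topology (simplex_space n) (nerve A n)"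

lemma cells_eq: "cells = sum_topology (\<lambda>n. kify (cell_space n)) UNIV"
  by (simp add: realization_cells_def kprod_def)

lemma t1_space_Hom: "a \<in> Obj A \<Longrightarrow> b \<in> Obj A \<Longrightarrow> t1_space (Hom A a b)"
  using CGWH_Hom weak_Hausdorff_imp_t1 by (auto simp: CGWH_space_def)

lemma t1_space_hom_product:
  assumes "\<And>i. i \<le> n \<Longrightarrow> x i \<in> Obj A"
  shows "t1_space (product_topology (\<lambda>i. Hom A (x (Suc i)) (x i)) {..<n})"
  unfolding t1_space_product_topology using assms by (auto intro!: t1_space_Hom)

lemma t1_space_cell_space: "t1_space (cell_space n)"
proof -
  have "Hausdorff_space (simplex_space n)"
    unfolding simplex_space_def
    by (intro Hausdorff_space_subtopology) (simp add: Hausdorff_space_product_topology)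
  then have "t1_space (simplex_space n)" by (rule Hausdorff_imp_t1_space)
  moreover have "t1_space (nerve A n)"
    unfolding nerve_def kproduct_def
    by (intro t1_space_sum_topology t1_space_kify t1_space_hom_product) auto
  ultimately show ?thesis by (simp add: t1_space_prod_topology)
qed

lemma continuous_map_vertex_indicator:
  "continuous_map (nerve A n) euclideanreal (\<lambda>y. if fst y i = a then 1 else 0)"
  unfolding nerve_def by (rule continuous_map_from_sum) simp

lemma continuous_map_cell_coordinate: "continuous_map (cell_space n) euclideanreal (\<lambda>z. fst z i)"
  using continuous_map_compose[OF continuous_map_fst continuous_map_coordinate]
  by (simp add: o_def simplex_space_def)

lemma continuous_map_cell_indicator:
  "continuous_map (cell_space n) euclideanreal (\<lambda>z. if fst (snd z) i = a then 1 else 0)"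
  using continuous_map_compose[OF continuous_map_snd continuous_map_vertex_indicator]
  by (simp add: o_def)

lemma continuous_map_weight: "continuous_map (cell_space n) euclideanreal (\<lambda>z. weight a (n, z))"
proof -
  have "continuous_map (cell_space n) euclideanreal
      (\<lambda>z. \<Sum>i\<le>n. (if fst (snd z) i = a then 1 else 0) * fst z i)"
    by (intro continuous_intros continuous_map_cell_indicator continuous_map_cell_coordinate) auto
  moreover have "(\<Sum>i\<le>n. (if fst (snd z) i = a then 1 else 0) * fst z i) = weight a (n, z)"
    for z :: "(nat \<Rightarrow> real) \<times> (nat \<Rightarrow> 'o) \<times> (nat \<Rightarrow> 'm)"
    by (cases z) (auto intro!: sum.cong)
  ultimately show ?thesis by (simp only:)
qed

lemma continuous_map_bweight: "continuous_map BA euclideanreal (bweight a)"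
proof -
  have "continuous_map cells euclideanreal (weight a)"
    unfolding cells_eq
    by (rule continuous_map_from_sum) (intro continuous_map_from_kify continuous_map_weight)
  then have "continuous_map cells euclideanreal (bweight a \<circ> cl)"
    by (rule continuous_map_eq) (simp add: bweight_cl)
  then show ?thesis unfolding continuous_compose_quotient_map_eq[OF quotient_map_cl] .
qed

text \<open>Composing a test map with the quotient map: locally compact Hausdorff test spaces do not notice
  that the cells carry the compactly generated product topology.\<close>

lemma continuous_map_probe:
  assumes L: "locally_compact_space L" "Hausdorff_space L" and u: "continuous_map L (cell_space n) u"
  shows "continuous_map L BA (\<lambda>z. cl (n, u z))"
proof -
  have "continuous_map L (kify (cell_space n)) u"
    using t1_space_cell_space L u by (rule continuous_map_into_kify)
  moreover have "continuous_map (kify (cell_space n)) cells (Pair n)"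
    unfolding cells_eq by (rule continuous_map_component_injection) simp
  ultimately have "continuous_map L cells (Pair n \<circ> u)" by (rule continuous_map_compose)
  from continuous_map_compose[OF this quotient_imp_continuous_map[OF quotient_map_cl]]
  show ?thesis by (simp add: o_def)
qed

definition open_star :: "'o set \<Rightarrow> ('o, 'm) cell_point set set" where
  "open_star S = {b \<in> topspace BA. \<forall>a\<in>S. 0 < bweight a b}"

lemma openin_open_star:
  assumes "finite S"
  shows "openin BA (open_star S)"
  using assms
proof (induction S rule: finite_induct)
  case empty
  then show ?case by (simp add: open_star_def)
next
  case (insert a S)
  have "openin BA {b \<in> topspace BA. bweight a b \<in> {0<..}}"
    by (rule openin_continuous_map_preimage[OF continuous_map_bweight]) simp
  moreover have "open_star (insert a S) = open_star S \<inter> {b \<in> topspace BA. bweight a b \<in> {0<..}}"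
    by (auto simp: open_star_def)
  ultimately show ?case using insert.IH by (simp add: openin_Int)
qed

lemma open_star_cover:
  assumes "finite (Obj A)"
  shows "(\<Union>a\<in>Obj A. open_star {a}) = topspace BA"
proof
  show "topspace BA \<subseteq> (\<Union>a\<in>Obj A. open_star {a})"
  proof
    fix b assume b: "b \<in> topspace BA"
    then obtain p where p: "p \<in> topspace cells" "b = cl p" by (auto simp: topspace_BA)
    have "\<exists>a\<in>Obj A. 0 < weight a p"
    proof (rule ccontr)
      assume "\<not> (\<exists>a\<in>Obj A. 0 < weight a p)"
      then have "(\<Sum>a\<in>Obj A. weight a p) \<le> 0" by (intro sum_nonpos) (auto simp: not_less)
      with sum_weight[OF p(1) assms] show False by simp
    qed
    then show "b \<in> (\<Union>a\<in>Obj A. open_star {a})" using b p by (auto simp: open_star_def bweight_cl)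
  qed
qed (auto simp: open_star_def)

lemma cl_in_open_star:
  "p \<in> topspace cells \<Longrightarrow> cl p \<in> open_star S \<longleftrightarrow> (\<forall>a\<in>S. 0 < weight a p)"
  by (auto simp: open_star_def topspace_BA bweight_cl)

lemma continuous_map_composite:
  assumes x: "\<And>j. j \<le> n \<Longrightarrow> x j \<in> Obj A" and "i + k \<le> n"
  shows "continuous_map (kify (product_topology (\<lambda>i. Hom A (x (Suc i)) (x i)) {..<n}))
    (Hom A (x (i + k)) (x i)) (\<lambda>f. composite A x f i k)"
  using assms(2)
proof (induction k)
  case 0
  then show ?case using x[of i] Idn_in_Hom by simp
next
  case (Suc k)
  let ?P = "product_topology (\<lambda>i. Hom A (x (Suc i)) (x i)) {..<n}"
  have "continuous_map (kify ?P) (Hom A (x (i + Suc k)) (x (i + k))) (\<lambda>f. f (i + k))"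
    using Suc.prems continuous_map_product_projection[of "i + k" "{..<n}" "\<lambda>i. Hom A (x (Suc i)) (x i)"]
    by (intro continuous_map_from_kify) auto
  then have "continuous_map (kify ?P)
      (prod_topology (Hom A (x (i + k)) (x i)) (Hom A (x (i + Suc k)) (x (i + k))))
      (\<lambda>f. (composite A x f i k, f (i + k)))"
    using Suc by (simp add: continuous_map_paired)
  moreover have "t1_space (prod_topology (Hom A (x (i + k)) (x i)) (Hom A (x (i + Suc k)) (x (i + k))))"
    using Suc.prems x by (simp add: t1_space_prod_topology t1_space_Hom)
  ultimately have "continuous_map (kify ?P)
      (kprod (Hom A (x (i + k)) (x i)) (Hom A (x (i + Suc k)) (x (i + k))))
      (\<lambda>f. (composite A x f i k, f (i + k)))"
    unfolding kprod_def by (intro continuous_map_kify_kify)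
  moreover have "continuous_map (kprod (Hom A (x (i + k)) (x i)) (Hom A (x (i + Suc k)) (x (i + k))))
      (Hom A (x (i + Suc k)) (x i)) (\<lambda>(g, f). Cmp A (x (i + Suc k)) (x (i + k)) (x i) g f)"
    using Suc.prems x by (intro continuous_Cmp) auto
  ultimately have "continuous_map (kify ?P) (Hom A (x (i + Suc k)) (x i))
      ((\<lambda>(g, f). Cmp A (x (i + Suc k)) (x (i + k)) (x i) g f) \<circ> (\<lambda>f. (composite A x f i k, f (i + k))))"
    by (rule continuous_map_compose)
  then show ?case by (simp add: o_def)
qed

lemma continuous_map_arrow:
  assumes "\<And>j. j \<le> n \<Longrightarrow> x j \<in> Obj A" "p \<le> q" "q \<le> n"
  shows "continuous_map (kify (product_topology (\<lambda>i. Hom A (x (Suc i)) (x i)) {..<n}))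
    (Hom A (x q) (x p)) (\<lambda>f. arrow x f p q)"
  using continuous_map_composite[of n x p "q - p"] assms by (simp add: arrow_def)

fun rescale :: "('o \<Rightarrow> real) \<Rightarrow> ('o, 'm) cell_point \<Rightarrow> ('o, 'm) cell_point" where
  "rescale w (n, t, x, f) = (n, \<lambda>i. w (x i) * t i, x, f)"

lemma weight_rescale: "weight a (rescale w p) = w a * weight a p"
proof -
  obtain n t x f where p: "p = (n, t, x, f)" by (metis prod_cases4)
  show ?thesis unfolding p by (simp add: sum_distrib_left) (intro sum.cong, auto)
qed

lemma rescale_in_cells:
  assumes p: "p \<in> topspace cells" and fin: "finite (Obj A)"
    and w: "\<And>a. a \<in> Obj A \<Longrightarrow> 0 \<le> w a" "(\<Sum>a\<in>Obj A. w a * weight a p) = 1"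
  shows "rescale w p \<in> topspace cells"
proof -
  obtain n t x f where pe: "p = (n, t, x, f)" by (metis prod_cases4)
  then have t: "t \<in> standard_simplex n" and s: "is_simplex n x f" using p topspace_cells by auto
  let ?t = "\<lambda>i. w (x i) * t i"
  have nn: "0 \<le> ?t i" for i
    using t w(1)[OF is_simplex_Obj[OF s, of i]] by (cases "i \<le> n") (auto simp: standard_simplex_def)
  have "(\<Sum>a\<in>Obj A. w a * weight a p) = (\<Sum>i\<le>n. \<Sum>a\<in>Obj A. if x i = a then w a * t i else 0)"
    unfolding pe weight.simps sum_distrib_left by (subst sum.swap) (intro sum.cong, auto)
  also have "\<dots> = (\<Sum>i\<le>n. ?t i)"
    using fin is_simplex_Obj[OF s] by (intro sum.cong) (auto simp: sum.delta')
  finally have sum1: "(\<Sum>i\<le>n. ?t i) = 1" using w(2) by simp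
  have zero: "?t i = 0" if "i > n" for i using t that by (simp add: standard_simplex_def)
  have "?t i \<le> 1" for i
  proof (cases "i \<le> n")
    case True
    then show ?thesis using member_le_sum[of i "{..n}" ?t] nn sum1 by simp
  next
    case False
    then show ?thesis using zero[of i] by (simp only: not_le zero_le_one)
  qed
  then have "?t \<in> standard_simplex n" using nn sum1 zero by (simp add: standard_simplex_def)
  then show ?thesis using s unfolding pe rescale.simps topspace_cells by blast
qed

text \<open>The factors depend on objects, not on vertices, so rescaling commutes with adding up coordinates.\<close>

lemma rescale_glue:
  assumes "(p, p') \<in> glue" and "rescale w p \<in> topspace cells"
  shows "(rescale w p, rescale w p') \<in> glue"
  using assms(1)
proof (rule glueE)
  fix m n \<phi> t x f
  assume h: "p = (m, t, nerve_act A m \<phi> (x, f))" "p' = (n, simplex_act m \<phi> t, x, f)"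
    "\<phi> \<in> order_maps m n" "t \<in> standard_simplex m" "is_simplex n x f"
  define y where "y = restrict (\<lambda>j. x (\<phi> j)) {..m}"
  define t' where "t' = (\<lambda>i. w (y i) * t i)"
  have p1: "rescale w p = (m, t', nerve_act A m \<phi> (x, f))"
    by (simp add: h(1) nerve_act_def y_def t'_def)
  then have t': "t' \<in> standard_simplex m"
    using assms(2) by (simp add: nerve_act_def topspace_cells)
  have "simplex_act m \<phi> t' = (\<lambda>i. w (x i) * simplex_act m \<phi> t i)"
    unfolding simplex_act_def t'_def sum_distrib_left
    by (intro ext sum.cong) (auto simp: y_def)
  then have "rescale w p' = (n, simplex_act m \<phi> t', x, f)" by (simp add: h(2))
  then show ?thesis unfolding p1 using glueI[OF h(3) t' h(5)] by simp
qed

end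

context acyclic_topological_category
begin

text \<open>Barycentric coordinates and the underlying simplex determine a point: mass can be moved to the
  first vertex of each block of equal objects, because the resulting order preserving map acts
  trivially on the simplex.\<close>

lemma cl_eq_if_weight_eq:
  assumes s: "is_simplex n x f" and t: "t \<in> standard_simplex n" "t' \<in> standard_simplex n"
    and eq: "\<And>a. weight a (n, t, x, f) = weight a (n, t', x, f)"
  shows "cl (n, t, x, f) = cl (n, t', x, f)"
proof -
  define \<phi> where "\<phi> i = (LEAST j. x j = x i)" for i
  have x\<phi>: "x (\<phi> i) = x i" for i unfolding \<phi>_def by (rule LeastI[of _ i]) simp
  have le: "\<phi> i \<le> i" for i unfolding \<phi>_def by (rule Least_le) simp
  have \<phi>_cong: "\<phi> i = \<phi> j" if "x i = x j" for i j using that by (simp add: \<phi>_def)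
  have "\<phi> i \<le> \<phi> j" if "i \<le> j" "j \<le> n" for i j
  proof (rule ccontr)
    assume lt: "\<not> \<phi> i \<le> \<phi> j"
    then have "\<phi> j \<le> i" using le[of i] by simp
    then have "x i = x (\<phi> j)" using block_constant[OF s, of "\<phi> j" i j] that x\<phi> by simp
    then have "\<phi> i = \<phi> j" using x\<phi> \<phi>_cong by metis
    with lt show False by simp
  qed
  then have \<phi>: "\<phi> \<in> order_maps n n"
    using le by (auto simp: order_maps_def mono_on_def intro: order_trans)
  have id: "(\<lambda>i. i) \<in> order_maps n n" by (auto simp: order_maps_def mono_on_def)
  have act: "nerve_act A n \<phi> (x, f) = (x, f)"
    using nerve_act_unique[OF s \<phi> id] x\<phi> nerve_act_id[OF s] by simp
  have move: "cl (n, u, x, f) = cl (n, \<lambda>i. if i \<le> n \<and> \<phi> i = i then weight (x i) (n, u, x, f) else 0, x, f)"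
    if u: "u \<in> standard_simplex n" for u
  proof -
    have "simplex_act n \<phi> u i = (if i \<le> n \<and> \<phi> i = i then weight (x i) (n, u, x, f) else 0)" for i
    proof (cases "i \<le> n \<and> \<phi> i = i")
      case True
      have "{j. j \<le> n \<and> \<phi> j = i} = {j \<in> {..n}. x j = x i}"
      proof -
        have "\<phi> j = i \<longleftrightarrow> x j = x i" for j using True x\<phi>[of j] \<phi>_cong[of j i] by metis
        then show ?thesis by simp
      qed
      then have "simplex_act n \<phi> u i = (\<Sum>j \<in> {j \<in> {..n}. x j = x i}. u j)"
        by (simp only: simplex_act_def)
      also have "\<dots> = (\<Sum>j\<le>n. if x j = x i then u j else 0)" by (rule sum.inter_filter) simp
      finally show ?thesis using True by simp
    next
      case False
      have "{j. j \<le> n \<and> \<phi> j = i} = {}"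
      proof -
        have "i \<le> n \<and> \<phi> i = i" if "j \<le> n" "\<phi> j = i" for j
          using that le[of j] x\<phi>[of j] \<phi>_cong[of i j] by (metis order_trans)
        with False show ?thesis by blast
      qed
      then have "simplex_act n \<phi> u i = 0" by (simp only: simplex_act_def sum.empty)
      then show ?thesis unfolding if_not_P[OF False] .
    qed
    then have "simplex_act n \<phi> u = (\<lambda>i. if i \<le> n \<and> \<phi> i = i then weight (x i) (n, u, x, f) else 0)"
      by (rule ext)
    then show ?thesis
      using cl_eq_if_glue[OF glueI[OF \<phi> u s]] by (simp only: act)
  qed
  show ?thesis unfolding move[OF t(1)] move[OF t(2)] eq ..
qed

end

text \<open>The objects are numbered against the direction of the arrows, like the vertices of a simplex of the
  nerve. The absence of arrows in the other direction forces the order in which they can occur there.\<close>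

locale object_chain = acyclic_topological_category A for A :: "('o, 'm) topcat" +
  fixes k :: nat and s :: "nat \<Rightarrow> 'o"
  assumes finite_Obj: "finite (Obj A)"
    and s: "s \<in> {..k} \<rightarrow>\<^sub>E Obj A" and inj: "inj_on s {..k}"
    and no_arrow: "\<And>i j. i < j \<Longrightarrow> j \<le> k \<Longrightarrow> hom (s i) (s j) = {}"
begin

text \<open>The first position of an object of the chain in a simplex. The sequence \<open>x\<close> has
  a default value beyond the last vertex, which does no harm to a least position.\<close>

definition pos :: "(nat \<Rightarrow> 'o) \<Rightarrow> nat \<Rightarrow> nat" where
  "pos x i = (LEAST j. x j = s i)"

definition covers :: "nat \<Rightarrow> (nat \<Rightarrow> 'o) \<Rightarrow> bool" where
  "covers n x \<longleftrightarrow> (\<forall>i\<le>k. \<exists>j\<le>n. x j = s i)"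

lemma s_Obj: "i \<le> k \<Longrightarrow> s i \<in> Obj A"
  using s by auto

lemma pos_covers:
  assumes "covers n x" "i \<le> k"
  shows "pos x i \<le> n" "x (pos x i) = s i"
proof -
  obtain j where j: "j \<le> n" "x j = s i" using assms by (auto simp: covers_def)
  show "x (pos x i) = s i" unfolding pos_def using j(2) by (rule LeastI)
  show "pos x i \<le> n" unfolding pos_def using Least_le[of "\<lambda>j. x j = s i" j] j by simp
qed

text \<open>Since no arrow leads from an earlier to a later object of the chain, the positions increase.\<close>

lemma pos_order_map:
  assumes sx: "is_simplex n x f" and c: "covers n x"
  shows "pos x \<in> order_maps k n"
proof -
  have "pos x i \<le> pos x j" if "i \<le> j" "j \<le> k" for i j
  proof (cases "i = j")
    case False
    show ?thesis
    proof (rule ccontr)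
      assume "\<not> pos x i \<le> pos x j"
      then have "hom (x (pos x i)) (x (pos x j)) \<noteq> {}"
        using arrow_in_hom[OF sx, of "pos x j" "pos x i"] pos_covers[OF c] that by auto
      then show False using no_arrow[of i j] that False pos_covers[OF c] by auto
    qed
  qed simp
  then show ?thesis using pos_covers[OF c] by (auto simp: order_maps_def mono_on_def)
qed

lemma nerve_act_pos:
  assumes "is_simplex n x f" "covers n x"
  shows "nerve_act A k (pos x) (x, f) = (s, snd (nerve_act A k (pos x) (x, f)))"
proof -
  have "restrict (\<lambda>j. x (pos x j)) {..k} = s"
    using pos_covers(2)[OF assms(2)] s by (auto simp: PiE_def extensional_def restrict_def)
  then show ?thesis by (simp add: nerve_act_def)
qed

abbreviation star :: "('o, 'm) cell_point set set" where
  "star \<equiv> open_star (s ` {..k})"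

definition star_cell :: "('o, 'm) cell_point \<Rightarrow> bool" where
  "star_cell p \<longleftrightarrow> (\<forall>i\<le>k. 0 < weight (s i) p)"

lemma cl_in_star: "p \<in> topspace cells \<Longrightarrow> cl p \<in> star \<longleftrightarrow> star_cell p"
  by (auto simp: cl_in_open_star star_cell_def)

lemma star_cell_covers:
  assumes "star_cell (n, t, x, f)"
  shows "covers n x"
  unfolding covers_def
proof (intro allI impI)
  fix i assume "i \<le> k"
  then have "0 < weight (s i) (n, t, x, f)" using assms by (simp only: star_cell_def)
  then show "\<exists>j\<le>n. x j = s i" by (rule weight_pos_object)
qed

lemma star_cases:
  assumes "b \<in> star"
  obtains n t x f where "b = cl (n, t, x, f)" "(n, t, x, f) \<in> topspace cells" "star_cell (n, t, x, f)"
    "t \<in> standard_simplex n" "is_simplex n x f" "covers n x"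
proof -
  obtain p where p: "p \<in> topspace cells" "b = cl p"
    using assms by (auto simp: open_star_def topspace_BA)
  obtain n t x f where pe: "p = (n, t, x, f)" by (metis prod_cases4)
  have "star_cell p" using cl_in_star p assms by simp
  moreover from this have "covers n x"
    using star_cell_covers by (simp only: pe)
  ultimately show thesis using that p pe topspace_cells by blast
qed

abbreviation homs :: "(nat \<Rightarrow> 'm) topology" where
  "homs \<equiv> product_topology (\<lambda>i. Hom A (s (Suc i)) (s i)) {..<k}"

abbreviation khoms :: "(nat \<Rightarrow> 'm) topology" where
  "khoms \<equiv> kproduct (\<lambda>i. Hom A (s (Suc i)) (s i)) {..<k}"

text \<open>The composites between the first occurrences of the objects of the chain do not depend on the
  coordinates, and not on the choice of the occurrences.\<close>

fun retract_cell :: "('o, 'm) cell_point \<Rightarrow> nat \<Rightarrow> 'm" where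
  "retract_cell (n, t, x, f) = snd (nerve_act A k (pos x) (x, f))"

definition retract :: "('o, 'm) cell_point set \<Rightarrow> nat \<Rightarrow> 'm" where
  "retract b = retract_cell (rep b)"

lemma star_cell_glue: "(p, p') \<in> glue \<Longrightarrow> star_cell p \<longleftrightarrow> star_cell p'"
  using weight_glue by (simp add: star_cell_def)

lemma retract_cell_glue:
  assumes "(p, p') \<in> glue" "star_cell p"
  shows "retract_cell p = retract_cell p'"
  using assms(1)
proof (rule glueE)
  fix m n \<phi> t x f
  assume h: "p = (m, t, nerve_act A m \<phi> (x, f))" "p' = (n, simplex_act m \<phi> t, x, f)"
    "\<phi> \<in> order_maps m n" "t \<in> standard_simplex m" "is_simplex n x f"
  define y where "y = fst (nerve_act A m \<phi> (x, f))"
  define g where "g = snd (nerve_act A m \<phi> (x, f))"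
  have yg: "nerve_act A m \<phi> (x, f) = (y, g)" by (simp add: y_def g_def)
  have yj: "y j = x (\<phi> j)" if "j \<le> m" for j using that by (simp add: y_def nerve_act_def)
  have sy: "is_simplex m y g" unfolding y_def g_def by (rule is_simplex_nerve_act[OF h(5,3)])
  have cy: "covers m y" using assms(2) by (intro star_cell_covers) (simp add: h(1) yg)
  have "star_cell p'" using assms star_cell_glue by simp
  then have cx: "covers n x" by (intro star_cell_covers) (simp add: h(2))
  note oy = pos_order_map[OF sy cy] and ox = pos_order_map[OF h(5) cx]
  have "nerve_act A k (pos y) (y, g) = nerve_act A k (\<phi> \<circ> pos y) (x, f)"
    using nerve_act_nerve_act[OF h(5,3) oy] yg by simp
  also have "\<dots> = nerve_act A k (pos x) (x, f)"
  proof (rule nerve_act_unique[OF h(5) _ ox])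
    show "\<phi> \<circ> pos y \<in> order_maps k n"
      using order_mapsD[OF h(3)] order_mapsD[OF oy] by (auto simp: order_maps_def mono_on_def)
    show "x ((\<phi> \<circ> pos y) j) = x (pos x j)" if "j \<le> k" for j
      using pos_covers[OF cy that] pos_covers[OF cx that] yj by simp
  qed
  finally show ?thesis by (simp add: h(1,2) yg)
qed

lemma retract_cl:
  assumes "p \<in> topspace cells" "star_cell p"
  shows "retract (cl p) = retract_cell p"
proof -
  let ?F = "\<lambda>p. (star_cell p, if star_cell p then retract_cell p else undefined)"
  have "?F (rep (cl p)) = ?F p"
    by (rule invariant_rep[OF _ assms(1)]) (auto simp: star_cell_glue retract_cell_glue)
  then show ?thesis using assms(2) by (auto simp: retract_def)
qed

lemma continuous_map_retract_nerve:
  "continuous_map (subtopology (nerve A n) {y. covers n (fst y)}) homs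
    (\<lambda>y. snd (nerve_act A k (pos (fst y)) y))"
proof -
  let ?X = "\<lambda>x. kproduct (\<lambda>i. Hom A (x (Suc i)) (x i)) {..<n}"
  let ?V = "\<lambda>x. if covers n x then topspace (?X x) else {}"
  let ?I = "{..n} \<rightarrow>\<^sub>E Obj A"
  have "topspace (nerve A n) \<inter> {y. covers n (fst y)} = Sigma ?I ?V"
    by (auto simp: nerve_def split: if_splits)
  then have "subtopology (nerve A n) {y. covers n (fst y)} = subtopology (nerve A n) (Sigma ?I ?V)"
    using subtopology_restrict[of "nerve A n" "{y. covers n (fst y)}"] by simp
  also have "\<dots> = sum_topology (\<lambda>x. subtopology (?X x) (?V x)) ?I"
    unfolding nerve_def by (rule subtopology_sum_topology)
  also have "continuous_map \<dots> homs (\<lambda>y. snd (nerve_act A k (pos (fst y)) y))"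
  proof (rule continuous_map_from_sum)
    fix x assume x: "x \<in> ?I"
    show "continuous_map (subtopology (?X x) (?V x)) homs (\<lambda>f. snd (nerve_act A k (pos (fst (x, f))) (x, f)))"
    proof (cases "topspace (subtopology (?X x) (?V x)) = {}")
      case True
      then show ?thesis by (rule continuous_map_from_empty)
    next
      case False
      then obtain f0 where "f0 \<in> topspace (subtopology (?X x) (?V x))" by blast
      then have f0: "f0 \<in> topspace (?X x)" and c: "covers n x" by (auto split: if_splits)
      then have "is_simplex n x f0" using x by (auto simp: is_simplex_def kproduct_def)
      note o = pos_order_map[OF this c]
      have "continuous_map (?X x) homs (\<lambda>f. restrict (\<lambda>j. arrow x f (pos x j) (pos x (Suc j))) {..<k})"
        unfolding continuous_map_componentwise
      proof (intro conjI ballI)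
        fix j assume j: "j \<in> {..<k}"
        then have "continuous_map (?X x) (Hom A (x (pos x (Suc j))) (x (pos x j)))
            (\<lambda>f. arrow x f (pos x j) (pos x (Suc j)))"
          unfolding kproduct_def using x order_mapsD[OF o] by (intro continuous_map_arrow) auto
        then show "continuous_map (?X x) (Hom A (s (Suc j)) (s j))
            (\<lambda>f. restrict (\<lambda>j. arrow x f (pos x j) (pos x (Suc j))) {..<k} j)"
          using j pos_covers(2)[OF c] by simp
      qed auto
      then show ?thesis using c by (simp add: nerve_act_arrow)
    qed
  qed
  finally show ?thesis .
qed

lemma t1_space_homs: "t1_space homs"
  by (rule t1_space_hom_product) (rule s_Obj)

lemma locally_compact_probe:
  assumes K: "compact_space K" "Hausdorff_space K" and u: "continuous_map K (cell_space n) u"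
  defines "L \<equiv> subtopology K {z \<in> topspace K. cl (n, u z) \<in> star}"
  shows "locally_compact_space L" "Hausdorff_space L" "continuous_map L (cell_space n) u"
    "\<And>z. z \<in> topspace L \<Longrightarrow> (n, u z) \<in> topspace cells \<and> star_cell (n, u z)"
proof -
  have "continuous_map K BA (\<lambda>z. cl (n, u z))"
    using K u by (intro continuous_map_probe compact_imp_locally_compact_space)
  from openin_continuous_map_preimage[OF this openin_open_star, of "s ` {..k}"]
  have "openin K {z \<in> topspace K. cl (n, u z) \<in> star}" by simp
  then show "locally_compact_space L"
    unfolding L_def using K by (intro locally_compact_space_open_subset compact_imp_locally_compact_space) auto
  show "Hausdorff_space L" unfolding L_def using K(2) by (rule Hausdorff_space_subtopology)
  show "continuous_map L (cell_space n) u" unfolding L_def using u by (rule continuous_map_from_subtopology)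
  fix z assume z: "z \<in> topspace L"
  then have "u z \<in> topspace (cell_space n)"
    using continuous_map_image_subset_topspace[OF u] by (auto simp: L_def)
  then have "(n, u z) \<in> topspace cells" by (simp add: cells_eq)
  then show "(n, u z) \<in> topspace cells \<and> star_cell (n, u z)"
    using z cl_in_star by (simp add: L_def)
qed

lemma continuous_map_retract:
  "continuous_map (subtopology BA star) (khoms) retract"
proof (rule continuous_map_quotient[OF quotient_map_cl[unfolded cells_eq] openin_open_star])
  show "finite (s ` {..k})" by simp
  fix n and K :: "((nat \<Rightarrow> real) \<times> (nat \<Rightarrow> 'o) \<times> (nat \<Rightarrow> 'm) \<Rightarrow> real) topology" and u
  assume K: "compact_space K" "Hausdorff_space K" and u: "continuous_map K (cell_space n) u"
  let ?L = "subtopology K {z \<in> topspace K. cl (n, u z) \<in> star}"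
  note L = locally_compact_probe[OF K u]
  have "continuous_map ?L (nerve A n) (snd \<circ> u)"
    using L(3) by (simp add: continuous_map_pairwise)
  moreover have "(snd \<circ> u) \<in> topspace ?L \<rightarrow> {y. covers n (fst y)}"
  proof
    fix z assume "z \<in> topspace ?L"
    then have "star_cell (n, u z)" using L(4) by blast
    then show "(snd \<circ> u) z \<in> {y. covers n (fst y)}"
      using star_cell_covers by (cases "u z") auto
  qed
  ultimately have "continuous_map ?L (subtopology (nerve A n) {y. covers n (fst y)}) (snd \<circ> u)"
    by (rule continuous_map_into_subtopology)
  from continuous_map_compose[OF this continuous_map_retract_nerve]
  have c: "continuous_map ?L (kify homs) ((\<lambda>y. snd (nerve_act A k (pos (fst y)) y)) \<circ> (snd \<circ> u))"
    using t1_space_homs L by (intro continuous_map_into_kify)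
  show "continuous_map ?L (khoms) (\<lambda>z. retract (cl (n, u z)))"
    unfolding kproduct_def
  proof (rule continuous_map_eq[OF c])
    fix z assume "z \<in> topspace ?L"
    then have "retract (cl (n, u z)) = retract_cell (n, u z)" using L(4) retract_cl by blast
    then show "((\<lambda>y. snd (nerve_act A k (pos (fst y)) y)) \<circ> (snd \<circ> u)) z = retract (cl (n, u z))"
      by (cases "u z") auto
  qed
qed

definition barycenter :: "nat \<Rightarrow> real" where
  "barycenter i = (if i \<le> k then 1 / (real k + 1) else 0)"

definition incl :: "(nat \<Rightarrow> 'm) \<Rightarrow> ('o, 'm) cell_point set" where
  "incl f = cl (k, barycenter, s, f)"

lemma barycenter_in_simplex: "barycenter \<in> standard_simplex k"
  by (auto simp: standard_simplex_def barycenter_def divide_simps)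

lemma is_simplex_chain: "f \<in> topspace homs \<Longrightarrow> is_simplex k s f"
  using s by (auto simp: is_simplex_def)

lemma weight_barycenter:
  "weight a (k, barycenter, s, f) = (if a \<in> s ` {..k} then 1 / (real k + 1) else 0)"
proof (cases "a \<in> s ` {..k}")
  case True
  then obtain j where j: "j \<le> k" "a = s j" by auto
  have "(\<Sum>i\<le>k. if s i = a then barycenter i else 0) = (\<Sum>i\<le>k. if i = j then 1 / (real k + 1) else 0)"
    using j inj by (intro sum.cong) (auto simp: barycenter_def dest: inj_onD)
  then show ?thesis using j True by (simp add: sum.delta)
next
  case False
  then show ?thesis by (auto intro!: sum.neutral)
qed

lemma include_in_star:
  assumes "f \<in> topspace homs"
  shows "(k, barycenter, s, f) \<in> topspace cells" "star_cell (k, barycenter, s, f)" "incl f \<in> star"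
proof -
  show c: "(k, barycenter, s, f) \<in> topspace cells"
    using barycenter_in_simplex is_simplex_chain[OF assms] topspace_cells by blast
  show st: "star_cell (k, barycenter, s, f)" by (simp add: star_cell_def weight_barycenter del: weight.simps)
  show "incl f \<in> star" using cl_in_star[OF c] st by (simp add: incl_def)
qed

lemma continuous_map_include:
  "continuous_map (khoms) (subtopology BA star) incl"
proof (rule continuous_map_into_subtopology)
  let ?P = "khoms"
  show "incl \<in> topspace ?P \<rightarrow> star" using include_in_star(3) by (auto simp: kproduct_def)
  have "continuous_map ?P (nerve A k) (Pair s)"
    unfolding nerve_def using s by (rule continuous_map_component_injection)
  then have "continuous_map ?P (cell_space k) (\<lambda>f. (barycenter, s, f))"
    using barycenter_in_simplex by (simp add: continuous_map_paired simplex_space_def)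
  then have "continuous_map ?P (kify (cell_space k)) (\<lambda>f. (barycenter, s, f))"
    unfolding kproduct_def using t1_space_cell_space by (intro continuous_map_kify_kify)
  moreover have "continuous_map (kify (cell_space k)) cells (Pair k)"
    unfolding cells_eq by (rule continuous_map_component_injection) simp
  ultimately have "continuous_map ?P cells (Pair k \<circ> (\<lambda>f. (barycenter, s, f)))"
    by (rule continuous_map_compose)
  from continuous_map_compose[OF this quotient_imp_continuous_map[OF quotient_map_cl]]
  show "continuous_map ?P BA incl" by (simp add: o_def incl_def[abs_def])
qed

lemma retract_include:
  assumes f: "f \<in> topspace homs"
  shows "retract (incl f) = f"
proof -
  have pos: "pos s i = i" if "i \<le> k" for i
    unfolding pos_def
  proof (rule Least_equality)
    fix j assume "s j = s i"
    show "i \<le> j"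
    proof (rule ccontr)
      assume "\<not> i \<le> j"
      then have "j = i" using \<open>s j = s i\<close> that inj by (auto dest: inj_onD)
      with \<open>\<not> i \<le> j\<close> show False by simp
    qed
  qed simp
  note sf = is_simplex_chain[OF f]
  have c: "covers k s" by (auto simp: covers_def)
  have id: "(\<lambda>i. i) \<in> order_maps k k" by (auto simp: order_maps_def mono_on_def)
  have "nerve_act A k (pos s) (s, f) = nerve_act A k (\<lambda>i. i) (s, f)"
    by (rule nerve_act_unique[OF sf pos_order_map[OF sf c] id]) (simp add: pos)
  then show ?thesis
    using include_in_star[OF f] retract_cl nerve_act_id[OF sf] by (simp add: incl_def)
qed

text \<open>The linear homotopy towards the point whose weights are equal on the chain and vanish
  elsewhere. It only rescales the coordinates by factors depending on the object, and is therefore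
  compatible with the gluing. The sum in a factor has at most one nonzero term; as a sum of indicator
  functions it is visibly continuous.\<close>

definition factor :: "real \<Rightarrow> ('o, 'm) cell_point \<Rightarrow> 'o \<Rightarrow> real" where
  "factor c p a = (1 - c) + c * (\<Sum>i\<le>k. if a = s i then 1 / ((real k + 1) * weight (s i) p) else 0)"

lemma factor_chain: "i \<le> k \<Longrightarrow> factor c p (s i) = (1 - c) + c / ((real k + 1) * weight (s i) p)"
proof -
  assume i: "i \<le> k"
  have "(\<Sum>j\<le>k. if s i = s j then 1 / ((real k + 1) * weight (s j) p) else 0)
      = (\<Sum>j\<le>k. if j = i then 1 / ((real k + 1) * weight (s i) p) else 0)"
    using i inj by (intro sum.cong) (auto dest: inj_onD)
  then show ?thesis using i by (simp add: factor_def sum.delta)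
qed

lemma factor_off_chain: "a \<notin> s ` {..k} \<Longrightarrow> factor c p a = 1 - c"
  by (auto simp: factor_def intro!: sum.neutral)

lemma factor_glue: "(p, p') \<in> glue \<Longrightarrow> factor c p = factor c p'"
  unfolding factor_def by (simp only: weight_glue)

lemma factor_nonneg:
  assumes "star_cell p" "0 \<le> c" "c \<le> 1"
  shows "0 \<le> factor c p a"
proof (cases "a \<in> s ` {..k}")
  case True
  then obtain i where i: "i \<le> k" "a = s i" by auto
  then have "0 < weight (s i) p" using assms(1) by (simp add: star_cell_def)
  then have "0 \<le> c / ((real k + 1) * weight (s i) p)" using assms(2) by simp
  then show ?thesis using assms(3) by (simp add: factor_chain[OF i(1)] i(2))
next
  case False
  then show ?thesis using assms by (simp add: factor_off_chain)
qed

text \<open>The factors at the objects of the chain are chosen to make all weights there equal to \<open>1 / (k + 1)\<close> at the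
  end of the homotopy; the total weight stays \<open>1\<close>.\<close>

lemma sum_factor:
  assumes p: "p \<in> topspace cells" "star_cell p"
  shows "(\<Sum>a\<in>Obj A. factor c p a * weight a p) = 1"
proof -
  let ?S = "s ` {..k}"
  have S: "?S \<subseteq> Obj A" using s_Obj by auto
  have pos: "0 < weight a p" if "a \<in> ?S" for a using p(2) that by (auto simp: star_cell_def)
  have "factor c p a * weight a p = (1 - c) * weight a p + c * (if a \<in> ?S then 1 / (real k + 1) else 0)" for a
  proof (cases "a \<in> ?S")
    case True
    then obtain i where i: "i \<le> k" "a = s i" by auto
    have "c / ((real k + 1) * weight a p) * weight a p = c * (1 / (real k + 1))"
      using pos[OF True] by simp
    then show ?thesis using True factor_chain[OF i(1), of c p] i(2) by (simp add: distrib_right)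
  qed (auto simp: factor_off_chain)
  then have "(\<Sum>a\<in>Obj A. factor c p a * weight a p)
      = (1 - c) * (\<Sum>a\<in>Obj A. weight a p) + c * (\<Sum>a\<in>Obj A. if a \<in> ?S then 1 / (real k + 1) else 0)"
    by (simp add: sum.distrib sum_distrib_left)
  also have "(\<Sum>a\<in>Obj A. if a \<in> ?S then 1 / (real k + 1) else 0) = (\<Sum>a\<in>?S. 1 / (real k + 1))"
    using S finite_Obj by (simp add: sum.inter_restrict[symmetric] Int_absorb1)
  also have "\<dots> = 1" using inj by (simp add: card_image)
  finally show ?thesis using sum_weight[OF p(1) finite_Obj] by simp
qed

lemma rescale_factor_in_cells:
  "\<lbrakk>p \<in> topspace cells; star_cell p; 0 \<le> c; c \<le> 1\<rbrakk> \<Longrightarrow> rescale (factor c p) p \<in> topspace cells"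
  by (rule rescale_in_cells) (simp_all add: finite_Obj factor_nonneg sum_factor)

lemma star_cell_rescale:
  assumes "star_cell p" "0 \<le> c" "c \<le> 1"
  shows "star_cell (rescale (factor c p) p)"
  unfolding star_cell_def
proof (intro allI impI)
  fix i assume i: "i \<le> k"
  have w: "0 < weight (s i) p" using assms(1) i by (simp add: star_cell_def)
  have "0 < factor c p (s i)"
  proof (cases "c = 1")
    case True
    then show ?thesis using w by (simp add: factor_chain[OF i])
  next
    case False
    have "0 \<le> c / ((real k + 1) * weight (s i) p)" using assms(2) w by simp
    then show ?thesis using False assms(3) by (simp add: factor_chain[OF i])
  qed
  then show "0 < weight (s i) (rescale (factor c p) p)" using w by (simp add: weight_rescale)
qed

definition flow :: "real \<Rightarrow> ('o, 'm) cell_point set \<Rightarrow> ('o, 'm) cell_point set" where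
  "flow c b = cl (rescale (factor c (rep b)) (rep b))"

lemma flow_cl:
  assumes p: "p \<in> topspace cells" "star_cell p" and c: "0 \<le> c" "c \<le> 1"
  shows "flow c (cl p) = cl (rescale (factor c p) p)"
proof -
  define F where "F q = (if star_cell q then cl (rescale (factor c q) q) else undefined)" for q
  have inv: "F q = F q'" if g: "(q, q') \<in> glue" for q q'
  proof (cases "star_cell q")
    case True
    have "q \<in> topspace cells" using g glue_subset by blast
    then have "rescale (factor c q) q \<in> topspace cells" using True c by (intro rescale_factor_in_cells)
    from cl_eq_if_glue[OF rescale_glue[OF g this]] show ?thesis
      using True star_cell_glue[OF g] factor_glue[OF g] by (simp add: F_def)
  next
    case False
    then show ?thesis using star_cell_glue[OF g] by (simp add: F_def)
  qed
  have "star_cell (rep (cl p))" using invariant_rep[of star_cell, OF star_cell_glue p(1)] p(2) by simp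
  moreover have "F (rep (cl p)) = F p" by (rule invariant_rep[OF inv p(1)])
  ultimately show ?thesis using p(2) unfolding F_def flow_def by (simp only: if_True)
qed

lemma continuous_map_flow:
  "continuous_map (cylinder (subtopology BA star)) BA (\<lambda>(c, b). flow c b)"
proof (rule continuous_map_interval_quotient[OF quotient_map_cl[unfolded cells_eq] openin_open_star])
  show "finite (s ` {..k})" by simp
  fix n and K :: "((nat \<Rightarrow> real) \<times> (nat \<Rightarrow> 'o) \<times> (nat \<Rightarrow> 'm) \<Rightarrow> real) topology" and u
  assume K: "compact_space K" "Hausdorff_space K" and u: "continuous_map K (cell_space n) u"
  let ?L = "subtopology K {z \<in> topspace K. cl (n, u z) \<in> star}"
  let ?IL = "cylinder ?L"
  note L = locally_compact_probe[OF K u]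
  have IL: "locally_compact_space ?IL" "Hausdorff_space ?IL"
    using L(1,2) by (simp_all add: locally_compact_space_prod_topology Hausdorff_space_prod_topology
        compact_imp_locally_compact_space compact_space_subtopology Hausdorff_space_subtopology)
  have uIL: "continuous_map ?IL (cell_space n) (\<lambda>z. u (snd z))"
    using continuous_map_compose[OF continuous_map_snd L(3)] by (simp add: o_def)
  note via = continuous_map_compose[OF uIL, unfolded o_def]
  define t' where "t' z i = factor (fst z) (n, u (snd z)) (fst (snd (u (snd z))) i) * fst (u (snd z)) i"
    for z :: "real \<times> _" and i
  have resc: "rescale (factor c (n, u z)) (n, u z) = (n, t' (c, z), snd (u z))" for c z
    by (cases "u z") (simp add: t'_def fun_eq_iff)
  have "continuous_map ?IL euclideanreal (\<lambda>z. t' z i)" for i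
  proof -
    have if_eq: "(if a = s j then 1 / ((real k + 1) * w) else 0) = (if a = s j then 1 else 0) / ((real k + 1) * w)"
      for a j and w :: real by simp
    have "continuous_map ?IL euclideanreal
        (\<lambda>z. ((1 - fst z) + fst z * (\<Sum>j\<le>k. (if fst (snd (u (snd z))) i = s j then 1 else 0)
            / ((real k + 1) * weight (s j) (n, u (snd z))))) * fst (u (snd z)) i)"
    proof (intro continuous_intros continuous_map_interval_fst via[OF continuous_map_cell_indicator]
        via[OF continuous_map_weight] via[OF continuous_map_cell_coordinate])
      fix j z assume "j \<in> {..k}" "z \<in> topspace ?IL"
      then have "snd z \<in> topspace ?L" "j \<le> k" by auto
      then have "0 < weight (s j) (n, u (snd z))" using L(4) unfolding star_cell_def by blast
      then show "(real k + 1) * weight (s j) (n, u (snd z)) \<noteq> 0" by simp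
    qed simp_all
    then show ?thesis unfolding t'_def factor_def if_eq .
  qed
  moreover have "t' z \<in> standard_simplex n" if z: "z \<in> topspace ?IL" for z
  proof -
    obtain c y where cy: "z = (c, y)" "0 \<le> c" "c \<le> 1" "y \<in> topspace ?L" using z by auto
    have "rescale (factor c (n, u y)) (n, u y) \<in> topspace cells"
      using rescale_factor_in_cells L(4)[OF cy(4)] cy(2,3) by blast
    then show ?thesis unfolding resc cy(1) by (cases "snd (u y)") (simp add: topspace_cells)
  qed
  ultimately have "continuous_map ?IL (simplex_space n) t'"
    unfolding simplex_space_def continuous_map_in_subtopology continuous_map_componentwise_UNIV by auto
  moreover have "continuous_map ?IL (nerve A n) (\<lambda>z. snd (u (snd z)))"
    using uIL by (simp add: continuous_map_pairwise o_def)
  ultimately have "continuous_map ?IL (cell_space n) (\<lambda>z. (t' z, snd (u (snd z))))"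
    by (simp add: continuous_map_paired)
  from continuous_map_probe[OF IL this]
  have c: "continuous_map ?IL BA (\<lambda>z. cl (n, t' z, snd (u (snd z))))" .
  show "continuous_map ?IL BA (\<lambda>(c, z). (\<lambda>(c, b). flow c b) (c, cl (n, u z)))"
  proof (rule continuous_map_eq[OF c])
    fix z assume z: "z \<in> topspace ?IL"
    then obtain c y where cy: "z = (c, y)" "0 \<le> c" "c \<le> 1" "y \<in> topspace ?L" by auto
    have "flow c (cl (n, u y)) = cl (rescale (factor c (n, u y)) (n, u y))"
      using flow_cl L(4)[OF cy(4)] cy(2,3) by blast
    then show "cl (n, t' z, snd (u (snd z))) = (\<lambda>(c, z). (\<lambda>(c, b). flow c b) (c, cl (n, u z))) z"
      unfolding resc by (simp add: cy(1))
  qed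
qed

lemma flow_0: "b \<in> star \<Longrightarrow> flow 0 b = b"
proof (erule star_cases)
  fix n t x f assume b: "b = cl (n, t, x, f)" "(n, t, x, f) \<in> topspace cells" "star_cell (n, t, x, f)"
  have "rescale (factor 0 (n, t, x, f)) (n, t, x, f) = (n, t, x, f)" by (simp add: factor_def)
  then show ?thesis using flow_cl[OF b(2,3), of 0] by (simp only: b(1) order_refl zero_le_one)
qed

text \<open>At the end of the homotopy a point has the same weights as the image of its retraction, taken in the
  same simplex.\<close>

lemma flow_1: "b \<in> star \<Longrightarrow> flow 1 b = incl (retract b)"
proof (erule star_cases)
  fix n t x f
  assume b: "b = cl (n, t, x, f)" "(n, t, x, f) \<in> topspace cells" "star_cell (n, t, x, f)"
    and t: "t \<in> standard_simplex n" and sx: "is_simplex n x f" and c: "covers n x"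
  let ?p = "(n, t, x, f)"
  define g where "g = retract_cell ?p"
  note o = pos_order_map[OF sx c]
  have act: "nerve_act A k (pos x) (x, f) = (s, g)" using nerve_act_pos[OF sx c] by (simp add: g_def)
  define t1 where "t1 i = factor 1 ?p (x i) * t i" for i
  define t2 where "t2 = simplex_act k (pos x) barycenter"
  have r: "rescale (factor 1 ?p) ?p = (n, t1, x, f)" by (simp add: t1_def fun_eq_iff)
  have "(n, t1, x, f) \<in> topspace cells" using rescale_factor_in_cells[OF b(2,3), of 1] r by simp
  then have t1: "t1 \<in> standard_simplex n" by (simp add: topspace_cells)
  have t2: "t2 \<in> standard_simplex n" unfolding t2_def by (rule simplex_act_in_simplex[OF o barycenter_in_simplex])
  have gl: "((k, barycenter, s, g), (n, t2, x, f)) \<in> glue"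
    using glueI[OF o barycenter_in_simplex sx] by (simp add: act t2_def)
  have "weight a (n, t1, x, f) = weight a (n, t2, x, f)" for a
  proof -
    have "weight a (n, t1, x, f) = factor 1 ?p a * weight a ?p"
      using weight_rescale[of a "factor 1 ?p" ?p] by (simp only: r)
    also have "\<dots> = (if a \<in> s ` {..k} then 1 / (real k + 1) else 0)"
    proof (cases "a \<in> s ` {..k}")
      case True
      then obtain i where i: "i \<le> k" "a = s i" by auto
      have "0 < weight a ?p" using b(3) i by (simp only: star_cell_def)
      then show ?thesis using True factor_chain[OF i(1), of 1 ?p] i(2) by (simp del: weight.simps)
    qed (simp add: factor_off_chain)
    also have "\<dots> = weight a (n, t2, x, f)"
      using weight_glue[OF gl, of a] weight_barycenter by simp
    finally show ?thesis .
  qed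
  from cl_eq_if_weight_eq[OF sx t1 t2 this] have "cl (n, t1, x, f) = cl (n, t2, x, f)" .
  also have "\<dots> = incl g" using cl_eq_if_glue[OF gl] by (simp add: incl_def)
  finally have "cl (n, t1, x, f) = incl g" .
  moreover have "flow 1 b = cl (n, t1, x, f)" using flow_cl[OF b(2,3), of 1] r b(1) by simp
  moreover have "retract b = g" using retract_cl[OF b(2,3)] by (simp only: b(1) g_def)
  ultimately show ?thesis by simp
qed

lemma flow_in_star:
  assumes "b \<in> star" "0 \<le> c" "c \<le> 1"
  shows "flow c b \<in> star"
  using assms(1)
proof (rule star_cases)
  fix n t x f assume b: "b = cl (n, t, x, f)" "(n, t, x, f) \<in> topspace cells" "star_cell (n, t, x, f)"
  have "rescale (factor c (n, t, x, f)) (n, t, x, f) \<in> topspace cells"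
    "star_cell (rescale (factor c (n, t, x, f)) (n, t, x, f))"
    using rescale_factor_in_cells[OF b(2,3) assms(2,3)] star_cell_rescale[OF b(3) assms(2,3)] by blast+
  then show ?thesis using flow_cl[OF b(2,3) assms(2,3)] cl_in_star b(1) by metis
qed

text \<open>Shrinking a star: \<open>retract\<close> and \<open>incl\<close> are mutually inverse up to \<open>flow\<close>.\<close>

theorem star_homotopy_equivalent:
  "khoms homotopy_equivalent_space subtopology BA star"
  unfolding homotopy_equivalent_space_def
proof (intro exI conjI)
  let ?P = "khoms"
  show "continuous_map ?P (subtopology BA star) incl" by (rule continuous_map_include)
  show "continuous_map (subtopology BA star) ?P retract" by (rule continuous_map_retract)
  show "homotopic_with (\<lambda>_. True) ?P ?P (retract \<circ> incl) id"
    by (rule homotopic_withI[OF continuous_map_snd]) (auto simp: retract_include kproduct_def)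
  have top: "topspace (subtopology BA star) = star" by (auto simp: open_star_def)
  show "homotopic_with (\<lambda>_. True) (subtopology BA star) (subtopology BA star) (incl \<circ> retract) id"
  proof (subst homotopic_with_sym, rule homotopic_withI)
    show "continuous_map (cylinder (subtopology BA star)) (subtopology BA star)
        (\<lambda>(c, b). flow c b)"
      by (rule continuous_map_into_subtopology[OF continuous_map_flow])
        (auto simp: top intro: flow_in_star)
  qed (simp_all add: top flow_0 flow_1)
qed

theorem has_chi_star:
  assumes "measurable_topcat A"
  shows "has_chi (subtopology BA star) (\<Prod>i<k. euler_char (Hom A (s (Suc i)) (s i)))"
proof -
  have "has_chi homs (\<Prod>i<k. euler_char (Hom A (s (Suc i)) (s i)))"
    using assms s_Obj by (intro has_chi_product_topology) (simp add: measurable_topcat_def)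
  from has_chi_kify[OF t1_space_homs this] show ?thesis
    using has_chi_homotopy_equivalent[OF star_homotopy_equivalent] by (simp add: kproduct_def)
qed

end

section \<open>Inclusion and exclusion over the open stars\<close>

text \<open>Solution of a unitriangular system of equations with right-hand sides 1.\<close>

fun unitriangular_solution :: "(nat \<Rightarrow> nat \<Rightarrow> int) \<Rightarrow> nat \<Rightarrow> int" where
  "unitriangular_solution z i = 1 - (\<Sum>j<i. z i j * unitriangular_solution z j)"

declare unitriangular_solution.simps [simp del]

lemma unitriangular_solution:
  assumes "z i i = 1" "\<And>j. i < j \<Longrightarrow> j < N \<Longrightarrow> z i j = 0" "i < N"
  shows "(\<Sum>j<N. z i j * unitriangular_solution z j) = 1"
proof -
  let ?u = "unitriangular_solution z"
  have "(\<Sum>j<N. z i j * ?u j) = (\<Sum>j<Suc i. z i j * ?u j)"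
    using assms by (intro sum.mono_neutral_right) auto
  also have "\<dots> = (\<Sum>j<i. z i j * ?u j) + ?u i" using assms(1) by simp
  also have "\<dots> = 1" by (subst (2) unitriangular_solution.simps) simp
  finally show ?thesis .
qed

context acyclic_topological_category
begin

text \<open>Counting the objects that can be reached from \<open>a\<close> gives a function that decreases along every arrow
  between different objects. Sorting by it puts the target of an arrow before its source.\<close>

lemma object_enumeration:
  assumes fin: "finite (Obj A)"
  obtains e where "bij_betw e {..<card (Obj A)} (Obj A)"
    "\<And>i j. \<lbrakk>i < card (Obj A); j < card (Obj A); hom (e i) (e j) \<noteq> {}\<rbrakk> \<Longrightarrow> j \<le> i"
proof -
  define h where "h a = card {b \<in> Obj A. hom a b \<noteq> {}}" for a
  have less: "h b < h a" if ab: "a \<in> Obj A" "b \<in> Obj A" "hom a b \<noteq> {}" "a \<noteq> b" for a b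
    unfolding h_def
  proof (rule psubset_card_mono)
    show "finite {c \<in> Obj A. hom a c \<noteq> {}}" using fin by simp
    have "{c \<in> Obj A. hom b c \<noteq> {}} \<subseteq> {c \<in> Obj A. hom a c \<noteq> {}}"
      using ab Cmp_in_hom[of a b] by blast
    moreover have "a \<in> {c \<in> Obj A. hom a c \<noteq> {}}" using ab Idn_in_Hom by blast
    moreover have "a \<notin> {c \<in> Obj A. hom b c \<noteq> {}}" using ab hom_antisym by blast
    ultimately show "{c \<in> Obj A. hom b c \<noteq> {}} \<subset> {c \<in> Obj A. hom a c \<noteq> {}}" by blast
  qed
  obtain ys where ys: "set ys = Obj A" "distinct ys" using finite_distinct_list[OF fin] by blast
  define xs where "xs = sort_key h ys"
  have xs: "set xs = Obj A" "distinct xs" "sorted (map h xs)" using ys by (simp_all add: xs_def)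
  have len: "length xs = card (Obj A)" using xs distinct_card by metis
  show thesis
  proof (rule that[of "\<lambda>i. xs ! i"])
    show "bij_betw (\<lambda>i. xs ! i) {..<card (Obj A)} (Obj A)"
      by (rule bij_betw_nth[OF xs(2)]) (simp_all add: len xs(1))
    fix i j assume ij: "i < card (Obj A)" "j < card (Obj A)" "hom (xs ! i) (xs ! j) \<noteq> {}"
    show "j \<le> i"
    proof (rule ccontr)
      assume "\<not> j \<le> i"
      then have "i < j" by simp
      then have "xs ! i \<noteq> xs ! j" using xs(2) ij len by (simp add: nth_eq_iff_index_eq)
      moreover have "xs ! i \<in> Obj A" "xs ! j \<in> Obj A"
        using ij len nth_mem[of i xs] nth_mem[of j xs] by (simp_all add: xs(1))
      ultimately have "h (xs ! j) < h (xs ! i)" using less ij(3) by blast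
      moreover have "h (xs ! i) \<le> h (xs ! j)"
        using sorted_nth_mono[OF xs(3), of i j] \<open>i < j\<close> ij len by simp
      ultimately show False by simp
    qed
  qed
qed

text \<open>The stars of the objects are added one at a time, targets of arrows first. The star of the new
  object contributes \<open>1\<close>, and its intersection with the union so far is taken off. This intersection
  is computed by the same induction, which therefore runs over the intersections of the union with
  the stars of all sets \<open>c\<close> of later objects. The contribution of the new object turns out to satisfy
  the recursion that defines the weighting.\<close>

theorem has_chi_classifying_space:
  assumes fin: "finite (Obj A)" and meas: "measurable_topcat A"
    and e: "bij_betw e {..<N} (Obj A)"
    and ord: "\<And>i j. \<lbrakk>i < N; j < N; hom (e i) (e j) \<noteq> {}\<rbrakk> \<Longrightarrow> j \<le> i"
  defines "z i j \<equiv> euler_char (Hom A (e i) (e j))"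
  shows "has_chi BA (\<Sum>i<N. unitriangular_solution z i)"
proof -
  let ?w = "unitriangular_solution z"
  define Z where "Z c = (\<Prod>i<length c - 1. z (c ! Suc i) (c ! i))" for c
  define head where "head c i = (case c of [] \<Rightarrow> 1 | x # _ \<Rightarrow> z x i)" for c i
  define V where "V m = (\<Union>i<m. open_star {e i})" for m
  have Z_Cons: "Z (m # c) = Z c * head c m" for m c
  proof (cases c)
    case (Cons x c')
    have "Z (m # c) = (\<Prod>i<Suc (length c'). z ((m # c) ! Suc i) ((m # c) ! i))"
      by (simp add: Z_def Cons)
    also have "\<dots> = z x m * Z c"
      unfolding prod.lessThan_Suc_shift by (simp add: Z_def Cons)
    finally show ?thesis by (simp add: head_def Cons)
  qed (simp add: Z_def head_def)
  \<comment> \<open>\<open>Z c\<close> is the value for the star of \<open>c\<close>, and \<open>head c i\<close> is the factor by which it changes when a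
    smaller index \<open>i\<close> is put in front of \<open>c\<close>.\<close>
  have star: "has_chi (subtopology BA (open_star (e ` set c))) (Z c)"
    if c: "c \<noteq> []" "sorted_wrt (<) c" "set c \<subseteq> {..<N}" for c
  proof -
    define k where "k = length c - 1"
    define s where "s = restrict (\<lambda>i. e (c ! i)) {..k}"
    have len: "length c = Suc k" using c(1) by (simp add: k_def)
    have cN: "c ! i < N" if "i \<le> k" for i
    proof -
      have "c ! i \<in> set c" using that len by (intro nth_mem) simp
      then show ?thesis using c(3) by blast
    qed
    have lt: "c ! i < c ! j" if "i < j" "j \<le> k" for i j
      using sorted_wrt_nth_less[OF c(2)] that len by simp
    interpret object_chain A k s
    proof
      show "finite (Obj A)" by (rule fin)
      show "s \<in> {..k} \<rightarrow>\<^sub>E Obj A" using cN e by (auto simp: s_def bij_betw_def)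
      have "inj_on (\<lambda>i. c ! i) {..k}"
        using lt by (intro inj_onI) (metis atMost_iff nat_neq_iff)
      moreover have "inj_on e ((\<lambda>i. c ! i) ` {..k})"
        using e cN by (auto simp: bij_betw_def intro: inj_on_subset)
      ultimately have "inj_on (e \<circ> (\<lambda>i. c ! i)) {..k}" by (rule comp_inj_on)
      then show "inj_on s {..k}" by (auto simp: s_def inj_on_def)
      show "hom (s i) (s j) = {}" if "i < j" "j \<le> k" for i j
      proof (rule ccontr)
        assume "hom (s i) (s j) \<noteq> {}"
        then have "hom (e (c ! i)) (e (c ! j)) \<noteq> {}" using that by (simp add: s_def)
        then have "c ! j \<le> c ! i" using ord cN that by simp
        with lt[OF that] show False by simp
      qed
    qed
    have "s ` {..k} = e ` set c"
    proof -
      have "set c = (\<lambda>i. c ! i) ` {..k}" using len by (auto simp: set_conv_nth less_Suc_eq_le)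
      then show ?thesis by (auto simp: s_def)
    qed
    moreover have "(\<Prod>i<k. euler_char (Hom A (s (Suc i)) (s i))) = Z c"
      unfolding Z_def k_def[symmetric] by (intro prod.cong) (auto simp: s_def z_def)
    ultimately show ?thesis using has_chi_star[OF meas] by simp
  qed
  have openV: "openin BA (V m)" for m
    unfolding V_def by (intro openin_Union) (auto intro: openin_open_star)
  have main: "has_chi (subtopology BA (open_star (e ` set c) \<inter> V m)) (Z c * (\<Sum>i<m. head c i * ?w i))"
    if "m \<le> N" "sorted_wrt (<) c" "set c \<subseteq> {m..<N}" for m c
    using that
  proof (induction m arbitrary: c)
    case 0
    have "has_chi (subtopology BA (open_star (e ` set c) \<inter> V 0)) 0"
      by (rule has_chi_empty) (simp add: V_def)
    then show ?case by simp
  next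
    case (Suc m)
    let ?S = "open_star (e ` set c)" and ?T = "open_star (e ` set (m # c))"
    have T: "?T = ?S \<inter> open_star {e m}" by (auto simp: open_star_def)
    have c': "sorted_wrt (<) (m # c)" "set (m # c) \<subseteq> {m..<N}" "set (m # c) \<subseteq> {..<N}"
      "set c \<subseteq> {m..<N}"
      using Suc.prems by (fastforce simp: Suc_le_eq)+
    have "has_chi (subtopology BA ((?S \<inter> V m) \<union> ?T))
        (Z c * (\<Sum>i<m. head c i * ?w i) + Z (m # c) - Z (m # c) * (\<Sum>i<m. head (m # c) i * ?w i))"
    proof (rule has_chi_Mayer_Vietoris)
      show "openin BA (?S \<inter> V m)" using openV by (simp add: openin_Int openin_open_star)
      show "openin BA ?T" by (simp add: openin_open_star)
      show "has_chi (subtopology BA (?S \<inter> V m)) (Z c * (\<Sum>i<m. head c i * ?w i))"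
        using Suc c' by simp
      show "has_chi (subtopology BA ?T) (Z (m # c))" using c' by (intro star) auto
      have "?S \<inter> V m \<inter> ?T = ?T \<inter> V m" unfolding T by blast
      moreover have "has_chi (subtopology BA (?T \<inter> V m)) (Z (m # c) * (\<Sum>i<m. head (m # c) i * ?w i))"
        using Suc.IH[of "m # c"] Suc.prems(1) c' by simp
      ultimately show "has_chi (subtopology BA (?S \<inter> V m \<inter> ?T)) (Z (m # c) * (\<Sum>i<m. head (m # c) i * ?w i))"
        by simp
    qed
    moreover have "(?S \<inter> V m) \<union> ?T = ?S \<inter> V (Suc m)"
      unfolding T by (auto simp: V_def less_Suc_eq)
    moreover have "Z c * (\<Sum>i<m. head c i * ?w i) + Z (m # c) - Z (m # c) * (\<Sum>i<m. head (m # c) i * ?w i)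
        = Z c * (\<Sum>i<Suc m. head c i * ?w i)"
    proof -
      have "?w m = 1 - (\<Sum>i<m. head (m # c) i * ?w i)"
        by (subst unitriangular_solution.simps) (simp add: head_def)
      then show ?thesis
        by (simp only: Z_Cons sum.lessThan_Suc) (simp only: distrib_left right_diff_distrib mult_1_right mult.assoc add_diff_eq)
    qed
    ultimately show ?case by simp
  qed
  have "V N = topspace BA"
  proof -
    have "Obj A = e ` {..<N}" using e by (simp add: bij_betw_def)
    then show ?thesis using open_star_cover[OF fin] by (simp add: V_def)
  qed
  moreover have "open_star (e ` set []) = topspace BA" by (simp add: open_star_def)
  ultimately show ?thesis using main[of N "[]"] by (simp add: Z_def head_def)
qed

end

theorem theorem1p2:
  fixes A :: "('o, 'm) topcat"
  assumes "topological_category A"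
    and "finite_topcat A"
    and "measurable_topcat A"
    and "acyclic_topcat A"
  shows "has_cat_euler_char A \<and> has_euler_char (classifying_space A) \<and>
    cat_euler_char A = of_int (euler_char (classifying_space A))"
proof -
  interpret topological_category A by fact
  interpret acyclic_topological_category A by unfold_locales fact
  have fin: "finite (Obj A)" using assms(2) by (simp add: finite_topcat_def)
  define N where "N = card (Obj A)"
  obtain e where e: "bij_betw e {..<N} (Obj A)"
    and ord: "\<And>i j. \<lbrakk>i < N; j < N; hom (e i) (e j) \<noteq> {}\<rbrakk> \<Longrightarrow> j \<le> i"
    using object_enumeration[OF fin] unfolding N_def by blast
  define z where "z i j = euler_char (Hom A (e i) (e j))" for i j
  let ?w = "unitriangular_solution z"
  have eO: "e i \<in> Obj A" if "i < N" for i using e that by (auto simp: bij_betw_def)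
  have diag: "z i i = 1" if i: "i < N" for i
  proof -
    obtain p where "hom (e i) (e i) = {p}"
      using assms(4) eO[OF i] by (auto simp: acyclic_topcat_def)
    from has_chi_singleton[OF this] show ?thesis by (simp add: has_chi_iff z_def)
  qed
  have zero: "z i j = 0" if "i < j" "j < N" for i j
  proof -
    have "hom (e i) (e j) = {}" using ord[of i j] that by auto
    from has_chi_empty[OF this] show ?thesis by (simp add: has_chi_iff z_def)
  qed
  have index: "inv_into {..<N} e (e i) = i" if "i < N" for i
    using e that by (simp add: bij_betw_def inv_into_f_f)
  have sum_Obj: "(\<Sum>b\<in>Obj A. g b) = (\<Sum>j<N. g (e j))" for g :: "'o \<Rightarrow> rat"
    by (rule sum.reindex_bij_betw[OF e, symmetric])
  have Obj_e: "\<exists>i<N. a = e i" if "a \<in> Obj A" for a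
    using e that by (auto simp: bij_betw_def)

  define W where "W b = rat_of_int (?w (inv_into {..<N} e b))" for b
  have weighting: "weighting A W"
    unfolding weighting_def
  proof
    fix a assume "a \<in> Obj A"
    then obtain i where i: "i < N" "a = e i" using Obj_e by blast
    have "(\<Sum>b\<in>Obj A. zeta A a b * W b) = rat_of_int (\<Sum>j<N. z i j * ?w j)"
      unfolding sum_Obj of_int_sum by (intro sum.cong) (simp_all add: W_def index zeta_def z_def i)
    also have "(\<Sum>j<N. z i j * ?w j) = 1"
      using diag zero i by (intro unitriangular_solution) auto
    finally show "(\<Sum>b\<in>Obj A. zeta A a b * W b) = 1" by simp
  qed

  \<comment> \<open>A coweighting solves the transposed system, which is unitriangular in the opposite order.\<close>
  define z' where "z' i j = z (N - Suc j) (N - Suc i)" for i j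
  let ?v = "unitriangular_solution z'"
  define v where "v a = rat_of_int (?v (N - Suc (inv_into {..<N} e a)))" for a
  have "coweighting A v"
    unfolding coweighting_def
  proof
    fix b assume "b \<in> Obj A"
    then obtain j where j: "j < N" "b = e j" using Obj_e by blast
    have "(\<Sum>a\<in>Obj A. v a * zeta A a b) = (\<Sum>i<N. rat_of_int (z i j * ?v (N - Suc i)))"
      unfolding sum_Obj by (intro sum.cong) (simp_all add: v_def index zeta_def z_def j)
    also have "\<dots> = (\<Sum>i<N. rat_of_int (z (N - Suc i) j * ?v (N - Suc (N - Suc i))))"
      by (rule sum.nat_diff_reindex[symmetric])
    also have "\<dots> = rat_of_int (\<Sum>i<N. z' (N - Suc j) i * ?v i)"
      unfolding of_int_sum using j by (intro sum.cong) (simp_all add: z'_def Suc_diff_Suc)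
    also have "(\<Sum>i<N. z' (N - Suc j) i * ?v i) = 1"
      using j by (intro unitriangular_solution) (auto simp: z'_def intro!: diag zero)
    finally show "(\<Sum>a\<in>Obj A. v a * zeta A a b) = 1" by simp
  qed
  with weighting have has: "has_cat_euler_char A" by (auto simp: has_cat_euler_char_def)

  have "cat_euler_char A = (\<Sum>a\<in>Obj A. W a)"
    by (rule cat_euler_char_eq_weighting[OF has weighting])
  also have "\<dots> = rat_of_int (\<Sum>i<N. ?w i)"
    unfolding sum_Obj of_int_sum by (intro sum.cong) (simp_all add: W_def index)
  finally have cat: "cat_euler_char A = rat_of_int (\<Sum>i<N. ?w i)" .
  have "has_chi BA (\<Sum>i<N. ?w i)"
    using has_chi_classifying_space[OF fin assms(3) e ord] unfolding z_def by blast
  then show ?thesis using has cat by (simp add: has_chi_iff)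
qed

end
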